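(* (Wexler-Raz biorthogonality) Assume $g,\gamma\in S_0(\mathbb{R}^d)$ with $\langle\gamma,g\rangle\neq0$. Then for any $1\le p<\infty$ and $1\le q\le\infty$ the following conditions are equivalent: (i) $\displaystyle\lim_{(a,b)\to(0,0)}S_{a,b;g,\gamma}f=\lim_{(a,b)\to(0,0)}S_{a,b;\gamma,g}f=f$ for every $f\in W(L^p,\ell^q)$, with convergence in $W(L^p,\ell^q)$. (ii) $\displaystyle\lim_{(a,b)\to(0,0)}\frac{1}{\langle\gamma,g\rangle}\langle\gamma,M_{l/a}T_{n/b}g\rangle=\delta_{l0}\delta_{n0}$ for all $l,n\in\mathbb{Z}^d$.
   Context: Let $d\ge1$, $Q=[0,1)^d$, $T_xf(t)=f(t-x)$ and $M_\omega f(t)=e^{2\pi i\langle\omega,t\rangle}f(t)$ for $x,\omega\in\mathbb{R}^d$. For $1\le p,q\le\infty$, $W(L^p,\ell^q)$ is the space of measurable $f$ on $\mathbb{R}^d$ with $\|f\|_{W(L^p,\ell^q)}=\big(\sum_{k\in\mathbb{Z}^d}\|f\cdot T_k\chi_Q\|_p^q\big)^{1/q}<\infty$ (supremum over $k$ if $q=\infty$). The pairing is $\langle f,h\rangle=\int_{\mathbb{R}^d}f(x)\overline{h(x)}\,dx$. $\delta$ is the Kronecker delta on $\mathbb{Z}^d$. Limits are over $a,b>0$. Time-frequency shifts: $(\tau(t,\omega)g)(x)=g(x-t)e^{2\pi i\langle x,\omega\rangle}$. The windowed Fourier transform of $f\in L^2(\mathbb{R}^d)$ with respect to $g\in L^2(\mathbb{R}^d)$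 is $(F_gf)(t,\omega)=\langle f,\tau(t,\omega)g\rangle$. Feichtinger's algebra is $S_0(\mathbb{R}^d)=\{g\in L^2(\mathbb{R}^d):F_gg\in L^1(\mathbb{R}^{2d})\}$; it is contained in the Wiener space $W(\mathbb{R}^d)=W(L^\infty,\ell^1)$. For $a,b>0$ (and $\langle\gamma,g\rangle\ne0$), $$S_{a,b;g,\gamma}f=\frac{(ab)^d}{\langle\gamma,g\rangle}\sum_{n,m\in\mathbb{Z}^d}\langle f,\tau(na,mb)g\rangle\,\tau(na,mb)\gamma ,$$ and $S_{a,b;\gamma,g}$ is the same operator with the roles of $g$ and $\gamma$ interchanged. For $g,\gamma\in W(\mathbb{R}^d)$ these operators are understood on $W(L^p,\ell^q)$ through the Walnut representation $$(S_{a,b;g,\gamma}f)(x)=\frac{1}{\langle\gamma,g\rangle}\sum_{n\in\mathbb{Z}^d}a^dG_{a,b;n}(x)f\left(x-\tfrac nb\right),\qquad G_{a,b;n}(x)=\sum_{k\in\mathbb{Z}^d}\overline{g}\left(x-\tfrac nb-ak\right)\gamma(x-ak).$$ *)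

theory Defs
  imports "HOL-Analysis.Analysis" "HOL-Probability.Essential_Supremum"
begin

text \<open>
  The dimension \<open>d\<close> is \<open>CARD('d)\<close>, which is at least 1. Elements of function spaces are
  Lebesgue measurable representatives \<open>real^'d \<Rightarrow> complex\<close>; all notions below are invariant under
  changing a function on a null set, up to changing the result on a null set.
\<close>

definition zvec :: "int^'d \<Rightarrow> real^'d" where
  "zvec k = (\<chi> i. real_of_int (k $ i))"

definition unit_cube :: "(real^'d) set" where
  "unit_cube = {x. \<forall>i. 0 \<le> x $ i \<and> x $ i < 1}"

definition transl :: "real^'d \<Rightarrow> (real^'d \<Rightarrow> complex) \<Rightarrow> real^'d \<Rightarrow> complex" where
  "transl x f = (\<lambda>t. f (t - x))"

definition modul :: "real^'d \<Rightarrow> (real^'d \<Rightarrow> complex) \<Rightarrow> real^'d \<Rightarrow> complex" where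
  "modul \<omega> f = (\<lambda>t. exp (2 * of_real pi * \<i> * of_real (\<omega> \<bullet> t)) * f t)"

definition tf_shift :: "real^'d \<Rightarrow> real^'d \<Rightarrow> (real^'d \<Rightarrow> complex) \<Rightarrow> real^'d \<Rightarrow> complex" where
  "tf_shift t \<omega> g = (\<lambda>x. g (x - t) * exp (2 * of_real pi * \<i> * of_real (x \<bullet> \<omega>)))"

definition pairing :: "(real^'d \<Rightarrow> complex) \<Rightarrow> (real^'d \<Rightarrow> complex) \<Rightarrow> complex" where
  "pairing f h = (LINT x|lebesgue. f x * cnj (h x))"

text \<open>Power with a positive real exponent on \<open>[0, \<infinity>]\<close>.\<close>

definition epow :: "ennreal \<Rightarrow> real \<Rightarrow> ennreal" where
  "epow x r = (if x = \<infinity> then \<infinity> else ennreal (enn2real x powr r))"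

text \<open>Exponents range over \<open>[1, \<infinity>]\<close>, norms over \<open>[0, \<infinity>]\<close>.\<close>

definition Lp_norm :: "ennreal \<Rightarrow> ('a::euclidean_space \<Rightarrow> complex) \<Rightarrow> ennreal" where
  "Lp_norm p f =
     (if p = \<infinity> then esssup lebesgue (\<lambda>x. ennreal (norm (f x)))
      else epow (\<integral>\<^sup>+ x. ennreal (norm (f x) powr enn2real p) \<partial>lebesgue) (1 / enn2real p))"

definition Lp_space :: "ennreal \<Rightarrow> ('a::euclidean_space \<Rightarrow> complex) set" where
  "Lp_space p = {f \<in> borel_measurable lebesgue. Lp_norm p f < \<infinity>}"

definition W_norm :: "ennreal \<Rightarrow> ennreal \<Rightarrow> (real^'d \<Rightarrow> complex) \<Rightarrow> ennreal" where
  "W_norm p q f =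
     (let c = (\<lambda>k::int^'d. Lp_norm p (\<lambda>t. f t * transl (zvec k) (indicator unit_cube) t))
      in if q = \<infinity> then (SUP k. c k)
         else epow (\<Sum>\<^sub>\<infinity>k. epow (c k) (enn2real q)) (1 / enn2real q))"

definition W_space :: "ennreal \<Rightarrow> ennreal \<Rightarrow> (real^'d \<Rightarrow> complex) set" where
  "W_space p q = {f \<in> borel_measurable lebesgue. W_norm p q f < \<infinity>}"

definition W_tendsto ::
  "ennreal \<Rightarrow> ennreal \<Rightarrow> ('b \<Rightarrow> real^'d \<Rightarrow> complex) \<Rightarrow> (real^'d \<Rightarrow> complex) \<Rightarrow> 'b filter \<Rightarrow> bool" where
  "W_tendsto p q u f F \<longleftrightarrow>
     f \<in> W_space p q \<and> (\<forall>\<^sub>F y in F. u y \<in> W_space p q) \<and>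
     ((\<lambda>y. W_norm p q (\<lambda>x. u y x - f x)) \<longlongrightarrow> 0) F"

definition windowed_fourier ::
  "(real^'d \<Rightarrow> complex) \<Rightarrow> (real^'d \<Rightarrow> complex) \<Rightarrow> (real^'d) \<times> (real^'d) \<Rightarrow> complex" where
  "windowed_fourier g f = (\<lambda>(t, \<omega>). pairing f (tf_shift t \<omega> g))"

definition feichtinger_S0 :: "(real^'d \<Rightarrow> complex) set" where
  "feichtinger_S0 = {g \<in> Lp_space 2. windowed_fourier g g \<in> Lp_space 1}"

definition walnut_G ::
  "real \<Rightarrow> real \<Rightarrow> (real^'d \<Rightarrow> complex) \<Rightarrow> (real^'d \<Rightarrow> complex) \<Rightarrow> int^'d \<Rightarrow> real^'d \<Rightarrow> complex" where
  "walnut_G a b g \<gamma> n x =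
     (\<Sum>\<^sub>\<infinity>k::int^'d. cnj (g (x - zvec n /\<^sub>R b - a *\<^sub>R zvec k)) * \<gamma> (x - a *\<^sub>R zvec k))"

text \<open>
  The normalised Gabor frame-type operator \<open>S\<^bsub>a,b;g,\<gamma>\<^esub>\<close>, formally
  \<open>f \<mapsto> (a b)\<^sup>d / \<langle>\<gamma>, g\<rangle> * \<Sum>n m. \<langle>f, tf_shift (n a) (m b) g\<rangle> tf_shift (n a) (m b) \<gamma>\<close>, understood on
  the amalgam spaces through its Walnut representation. For windows in the Wiener space
  \<open>W_space \<infinity> 1\<close> both series converge absolutely almost everywhere, so the value 0 that
  \<open>infsum\<close> takes at points of non-summability matters only on a null set.
\<close>

definition frame_op ::
  "real \<Rightarrow> real \<Rightarrow> (real^'d \<Rightarrow> complex) \<Rightarrow> (real^'d \<Rightarrow> complex) \<Rightarrow>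
     (real^'d \<Rightarrow> complex) \<Rightarrow> real^'d \<Rightarrow> complex" where
  "frame_op a b g \<gamma> f x =
     1 / pairing \<gamma> g *
     (\<Sum>\<^sub>\<infinity>n::int^'d. of_real (a ^ CARD('d)) * walnut_G a b g \<gamma> n x * f (x - zvec n /\<^sub>R b))"

text \<open>The limit \<open>(a, b) \<rightarrow> (0, 0)\<close> over \<open>a, b > 0\<close>.\<close>

definition lattice_filter :: "(real \<times> real) filter" where
  "lattice_filter = at (0, 0) within {0<..} \<times> {0<..}"

end

theory Submission
  imports Defs "HOL-Probability.Characteristic_Functions"
begin

text \<open>
  For windows in Feichtinger's algebra both conditions of the equivalence are theorems; neither is
  derived from the other. Everything rests on one property of such a window \<open>g\<close>: up to a null set it
  is continuous and dominated, uniformly on neighbourhoods of lattice cells, by a sequence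
  \<open>C :: int^'d \<Rightarrow> ennreal\<close> with finite sum (\<open>feichtinger_S0_continuous_representative\<close>).

  This property comes out of the definition as follows. For fixed \<open>t\<close> the function
  \<open>\<omega> \<mapsto> windowed_fourier g g (t, \<omega>)\<close> is the Fourier transform of \<open>x \<mapsto> g x * cnj (g (x - t))\<close>. It is
  integrable for almost every \<open>t\<close>, with norm \<open>H t\<close> say, so Fourier inversion gives
  \<open>|g x| |g (x - t)| \<le> H t\<close> almost everywhere. Averaging over those \<open>t\<close> for which \<open>x - t\<close> lies in
  a fixed cell on which \<open>g\<close> does not vanish bounds \<open>|g x|\<close> by integrals of \<open>H\<close> over cells whose
  position follows that of \<open>x\<close>, and these have a finite sum since \<open>H\<close> is integrable. Testing the
  inversion formula against a character at which the Fourier transform of \<open>g\<close> does not vanish writes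
  \<open>g\<close> as an absolutely convergent integral of continuous functions of \<open>x\<close>.

  For the convergence of the frame operators, the Walnut representation splits into two parts. The
  term \<open>n = 0\<close> multiplies \<open>f\<close> by a Riemann sum of \<open>cnj g * \<gamma>\<close> over the grid \<open>x + a \<int>\<^sup>d\<close>; it tends
  to \<open>pairing \<gamma> g\<close> uniformly in \<open>x\<close> as \<open>a \<rightarrow> 0\<close> (\<open>grid_sum_approximates_integral\<close>). The term
  with index \<open>n \<noteq> 0\<close> has a coefficient bounded by the overlap of the majorant of \<open>\<gamma>\<close> with that of
  \<open>g\<close> moved by \<open>n / b\<close>, and the sum of these overlaps tends to \<open>0\<close> as \<open>b \<rightarrow> 0\<close>
  (\<open>sum_overlap_le\<close>, \<open>total_far_tail_tendsto_0\<close>). Since the amalgam norm is countably subadditive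
  and translations are uniformly bounded on it, both estimates pass to the operator
  (\<open>amalgam_frame_op_diff_le\<close>).

  The limits of the inner products for \<open>n \<noteq> 0\<close> follow from the same overlaps, those for \<open>n = 0\<close>,
  \<open>l \<noteq> 0\<close> from the Riemann-Lebesgue lemma, and for \<open>l = n = 0\<close> the expression is constantly \<open>1\<close>
  (\<open>biorthogonality_limit\<close>).
\<close>

section \<open>Continuity of translation in the mean\<close>

lemma nn_integral_lborel_affine:
  fixes f :: "'a::euclidean_space \<Rightarrow> ennreal"
  assumes [measurable]: "f \<in> borel_measurable borel" and c: "c \<noteq> 0"
  shows "(\<integral>\<^sup>+x. f x \<partial>lborel) = ennreal (\<bar>c\<bar> ^ DIM('a)) * (\<integral>\<^sup>+x. f (t + c *\<^sub>R x) \<partial>lborel)"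
  by (subst lborel_affine[OF c, of t])
    (simp add: nn_integral_density nn_integral_distr nn_integral_cmult)

lemma integrable_lborel_affine:
  fixes f :: "'a::euclidean_space \<Rightarrow> 'b :: {banach, second_countable_topology}"
  assumes f: "integrable lborel f" and c: "c \<noteq> 0"
  shows "integrable lborel (\<lambda>x. f (t + c *\<^sub>R x))"
proof -
  have m[measurable]: "f \<in> borel_measurable borel"
    using f by auto
  have "ennreal (\<bar>c\<bar> ^ DIM('a)) * (\<integral>\<^sup>+x. ennreal (norm (f (t + c *\<^sub>R x))) \<partial>lborel) < \<infinity>"
    using f by (subst nn_integral_lborel_affine[symmetric, OF _ c]) (auto simp: integrable_iff_bounded)
  then have "(\<integral>\<^sup>+x. ennreal (norm (f (t + c *\<^sub>R x))) \<partial>lborel) < \<infinity>"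
    using c by (auto simp: ennreal_mult_less_top)
  then show ?thesis
    by (intro integrableI_bounded) auto
qed

lemma lborel_integral_affine:
  fixes f :: "'a::euclidean_space \<Rightarrow> 'b :: {banach, second_countable_topology}"
  assumes [measurable]: "f \<in> borel_measurable borel" and c: "c \<noteq> 0"
  shows "(\<integral>x. f x \<partial>lborel) = (\<bar>c\<bar> ^ DIM('a)) *\<^sub>R (\<integral>x. f (t + c *\<^sub>R x) \<partial>lborel)"
  by (subst lborel_affine[OF c, of t]) (simp add: integral_density integral_distr)

lemma nn_integral_lborel_translate:
  fixes f :: "'a::euclidean_space \<Rightarrow> ennreal"
  assumes [measurable]: "f \<in> borel_measurable borel"
  shows "(\<integral>\<^sup>+x. f (x - u) \<partial>lborel) = (\<integral>\<^sup>+x. f x \<partial>lborel)"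
  using nn_integral_lborel_affine[OF assms, of 1 "-u"] by (simp add: algebra_simps)

lemma nn_integral_lborel_reflect:
  fixes f :: "'a::euclidean_space \<Rightarrow> ennreal"
  assumes [measurable]: "f \<in> borel_measurable borel"
  shows "(\<integral>\<^sup>+x. f (u - x) \<partial>lborel) = (\<integral>\<^sup>+x. f x \<partial>lborel)"
  using nn_integral_lborel_affine[OF assms, of "-1" "u"] by (simp add: algebra_simps)

lemma AE_lborel_translate:
  fixes P :: "'a::euclidean_space \<Rightarrow> bool"
  assumes "AE x in lborel. P x"
  shows "AE x in lborel. P (x - u)"
proof -
  obtain N where N: "{x. \<not> P x} \<subseteq> N" "N \<in> sets lborel" "emeasure lborel N = 0"
    using assms by (auto elim!: AE_E)
  then have [measurable]: "N \<in> sets borel" by simp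
  have "(\<integral>\<^sup>+x. indicator N (x - u) \<partial>lborel) = 0"
    using N by (subst nn_integral_lborel_translate) auto
  then have "AE x in lborel. (indicator N (x - u) :: ennreal) = 0"
    by (subst (asm) nn_integral_0_iff_AE) auto
  then show ?thesis
    by eventually_elim (use N in \<open>auto simp: indicator_def split: if_splits\<close>)
qed

lemma ennreal_tendsto_0_le:
  fixes f g :: "'a \<Rightarrow> ennreal"
  assumes "eventually (\<lambda>x. f x \<le> g x) F" "(g \<longlongrightarrow> 0) F"
  shows "(f \<longlongrightarrow> 0) F"
  by (rule tendsto_sandwich[of "\<lambda>_. 0" f F g]) (use assms in auto)

text \<open>
  The \<open>L\<^sup>1\<close> modulus of continuity of \<open>h\<close>. Values in \<open>ennreal\<close> allow estimates without
  side conditions on integrability.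
\<close>

definition shift_dist :: "('a::euclidean_space \<Rightarrow> complex) \<Rightarrow> 'a \<Rightarrow> ennreal" where
  "shift_dist h u = (\<integral>\<^sup>+x. ennreal (norm (h (x - u) - h x)) \<partial>lborel)"

lemma shift_dist_le:
  fixes h k :: "'a::euclidean_space \<Rightarrow> complex"
  assumes [measurable]: "h \<in> borel_measurable borel" "k \<in> borel_measurable borel"
  shows "shift_dist h u \<le> shift_dist k u + 2 * (\<integral>\<^sup>+x. ennreal (norm (h x - k x)) \<partial>lborel)"
proof -
  have "shift_dist h u \<le> (\<integral>\<^sup>+x. ennreal (norm (k (x - u) - k x)) +
      (ennreal (norm (h (x - u) - k (x - u))) + ennreal (norm (h x - k x))) \<partial>lborel)"
    unfolding shift_dist_def
  proof (intro nn_integral_mono)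
    fix x
    have "norm (h (x - u) - h x) =
        norm ((k (x - u) - k x) + ((h (x - u) - k (x - u)) - (h x - k x)))"
      by simp
    also have "\<dots> \<le> norm (k (x - u) - k x) + (norm (h (x - u) - k (x - u)) + norm (h x - k x))"
      by (meson norm_triangle_ineq norm_triangle_ineq4 add_left_mono order_trans)
    finally show "ennreal (norm (h (x - u) - h x)) \<le> ennreal (norm (k (x - u) - k x)) +
      (ennreal (norm (h (x - u) - k (x - u))) + ennreal (norm (h x - k x)))"
      by (simp flip: ennreal_plus)
  qed
  also have "\<dots> = shift_dist k u + ((\<integral>\<^sup>+x. ennreal (norm (h (x - u) - k (x - u))) \<partial>lborel)
      + (\<integral>\<^sup>+x. ennreal (norm (h x - k x)) \<partial>lborel))"
    by (simp add: nn_integral_add shift_dist_def)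
  also have "(\<integral>\<^sup>+x. ennreal (norm (h (x - u) - k (x - u))) \<partial>lborel)
      = (\<integral>\<^sup>+x. ennreal (norm (h x - k x)) \<partial>lborel)"
    by (rule nn_integral_lborel_translate[of "\<lambda>x. ennreal (norm (h x - k x))"]) auto
  finally show ?thesis
    by (simp add: mult_2)
qed

text \<open>
  Continuity of translation passes to \<open>L\<^sup>1\<close> limits because a perturbation of norm \<open>e\<close> changes
  \<^const>\<open>shift_dist\<close> by at most \<open>2 * e\<close>.
\<close>

lemma shift_dist_approx:
  fixes h :: "'a::euclidean_space \<Rightarrow> complex"
  assumes [measurable]: "h \<in> borel_measurable borel"
    and *: "\<And>e::real. e > 0 \<Longrightarrow> \<exists>k \<in> borel_measurable borel.
        (shift_dist k \<longlongrightarrow> 0) (at 0) \<and> (\<integral>\<^sup>+x. ennreal (norm (h x - k x)) \<partial>lborel) < ennreal e"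
  shows "(shift_dist h \<longlongrightarrow> 0) (at 0)"
proof -
  have "eventually (\<lambda>u. shift_dist h u < ennreal e) (at 0)" if e: "e > 0" for e :: real
  proof -
    \<comment> \<open>the budget is one quarter for the translate of k and twice one quarter for the approximation\<close>
    obtain k where k[measurable]: "k \<in> borel_measurable borel"
      "(shift_dist k \<longlongrightarrow> 0) (at 0)" "(\<integral>\<^sup>+x. ennreal (norm (h x - k x)) \<partial>lborel) < ennreal (e/4)"
      using *[of "e/4"] e by auto
    have "eventually (\<lambda>u. shift_dist k u < ennreal (e/4)) (at 0)"
      using k(2) e by (auto simp: order_tendsto_iff)
    then show ?thesis
    proof eventually_elim
      case (elim u)
      have "shift_dist h u \<le> shift_dist k u + 2 * (\<integral>\<^sup>+x. ennreal (norm (h x - k x)) \<partial>lborel)"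
        by (rule shift_dist_le) auto
      also have "\<dots> \<le> ennreal (e/4) + 2 * ennreal (e/4)"
        using elim k(3) by (intro add_mono mult_left_mono) auto
      also have "\<dots> = ennreal (e/4 + 2 * (e/4))"
        using e unfolding mult_2 by (simp flip: ennreal_plus)
      also have "\<dots> < ennreal e"
        using e by (intro ennreal_lessI) auto
      finally show ?case .
    qed
  qed
  then have "eventually (\<lambda>u. shift_dist h u < e) (at 0)" if "e > 0" for e :: ennreal
  proof (cases e)
    case (real r)
    with that \<open>\<And>e. 0 < e \<Longrightarrow> eventually (\<lambda>u. shift_dist h u < ennreal e) (at 0)\<close> show ?thesis by auto
  next
    case top
    from \<open>\<And>e. 0 < e \<Longrightarrow> eventually (\<lambda>u. shift_dist h u < ennreal e) (at 0)\<close>[of 1]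
    have "eventually (\<lambda>u. shift_dist h u < 1) (at 0)" by simp
    then show ?thesis
      unfolding top by eventually_elim (metis ennreal_one_less_top less_trans top.not_eq_extremum)
  qed
  then show ?thesis by (auto simp: order_tendsto_iff)
qed

text \<open>
  For an open set the part of \<open>U\<close> whose translate has left \<open>U\<close> shrinks to nothing pointwise, so its
  measure tends to \<open>0\<close> by dominated convergence. The part entering \<open>U\<close> has the same measure, because
  translation preserves the finite measure of \<open>U\<close>.
\<close>

lemma shift_dist_open:
  fixes U :: "'a::euclidean_space set"
  assumes U: "open U" "emeasure lborel U < \<infinity>"
  shows "(shift_dist (\<lambda>x. indicator U x *\<^sub>R c) \<longlongrightarrow> 0) (at 0)"
  unfolding tendsto_at_iff_sequentially
proof (intro allI impI)
  fix X :: "nat \<Rightarrow> 'a" assume X: "\<forall>i. X i \<in> UNIV - {0}" "X \<longlonglongrightarrow> 0"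
  have [measurable]: "U \<in> sets borel" using U by simp
  define F where "F = (\<lambda>i x. indicator U x * indicator (-U) (x - X i) :: ennreal)"
  have [measurable]: "F i \<in> borel_measurable borel" for i
    unfolding F_def by measurable
  have F0: "(\<lambda>i. (\<integral>\<^sup>+x. F i x \<partial>lborel)) \<longlonglongrightarrow> (\<integral>\<^sup>+x. 0 \<partial>(lborel :: 'a measure))"
  proof (rule nn_integral_dominated_convergence[where w="indicator U"])
    show "(\<integral>\<^sup>+x. indicator U x \<partial>lborel) < \<infinity>"
      using U by simp
    show "AE x in lborel. (\<lambda>i. F i x) \<longlonglongrightarrow> 0"
    proof (intro AE_I2)
      fix x
      have "eventually (\<lambda>i. F i x = 0) sequentially"
      proof (cases "x \<in> U")
        case True
        have "(\<lambda>i. x - X i) \<longlonglongrightarrow> x - 0" by (intro tendsto_intros X)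
        then have "eventually (\<lambda>i. x - X i \<in> U) sequentially"
          using U True by (auto simp: tendsto_def)
        then show ?thesis by eventually_elim (auto simp: F_def)
      qed (auto simp: F_def)
      then show "(\<lambda>i. F i x) \<longlonglongrightarrow> 0" by (rule tendsto_eventually)
    qed
  qed (auto simp: F_def indicator_def)
  have le: "shift_dist (\<lambda>x. indicator U x *\<^sub>R c) (X i) \<le> 2 * ennreal (norm c) * (\<integral>\<^sup>+x. F i x \<partial>lborel)" for i
  proof -
    let ?E = "emeasure lborel U" and ?I = "(\<integral>\<^sup>+x. indicator U x * indicator U (x - X i) \<partial>lborel)"
    have IF: "?I + (\<integral>\<^sup>+x. F i x \<partial>lborel) = ?E"
    proof -
      have "?I + (\<integral>\<^sup>+x. F i x \<partial>lborel) = (\<integral>\<^sup>+x. indicator U x * indicator U (x - X i) + F i x \<partial>lborel)"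
        by (subst nn_integral_add) auto
      also have "\<dots> = (\<integral>\<^sup>+x. indicator U x \<partial>lborel)"
        by (intro nn_integral_cong) (auto simp: F_def indicator_def)
      finally show ?thesis by simp
    qed
    have "?I + (\<integral>\<^sup>+x. indicator (-U) x * indicator U (x - X i) \<partial>lborel) = ?E"
    proof -
      have "?I + (\<integral>\<^sup>+x. indicator (-U) x * indicator U (x - X i) \<partial>lborel)
        = (\<integral>\<^sup>+x. indicator U x * indicator U (x - X i) + indicator (-U) x * indicator U (x - X i) \<partial>lborel)"
        by (subst nn_integral_add) auto
      also have "\<dots> = (\<integral>\<^sup>+x. indicator U (x - X i) \<partial>lborel)"
        by (intro nn_integral_cong) (auto simp: indicator_def)
      also have "\<dots> = ?E" by (subst nn_integral_lborel_translate) auto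
      finally show ?thesis .
    qed
    moreover have "?I < \<infinity>"
    proof -
      have "?I \<le> ?I + (\<integral>\<^sup>+x. F i x \<partial>lborel)" by simp
      with IF U show ?thesis by (metis order_le_less_trans)
    qed
    ultimately have eq: "(\<integral>\<^sup>+x. indicator (-U) x * indicator U (x - X i) \<partial>lborel) = (\<integral>\<^sup>+x. F i x \<partial>lborel)"
      using IF by (metis ennreal_add_left_cancel infinity_ennreal_def less_irrefl)
    have "shift_dist (\<lambda>x. indicator U x *\<^sub>R c) (X i) \<le>
      (\<integral>\<^sup>+x. ennreal (norm c) * (F i x + indicator (-U) x * indicator U (x - X i)) \<partial>lborel)"
      unfolding shift_dist_def
      by (intro nn_integral_mono) (auto simp: F_def indicator_def)
    also have "\<dots> = ennreal (norm c) * ((\<integral>\<^sup>+x. F i x \<partial>lborel) + (\<integral>\<^sup>+x. F i x \<partial>lborel))"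
      by (simp add: nn_integral_cmult nn_integral_add eq)
    finally show ?thesis unfolding mult_2[symmetric] by (simp add: mult_ac)
  qed
  have "(\<lambda>i. 2 * ennreal (norm c) * (\<integral>\<^sup>+x. F i x \<partial>lborel)) \<longlonglongrightarrow> 2 * ennreal (norm c) * 0"
    using F0 by (intro ennreal_tendsto_cmult) (auto simp: ennreal_mult_less_top)
  then show "(shift_dist (\<lambda>x. indicator U x *\<^sub>R c) \<circ> X) \<longlonglongrightarrow> 0"
    unfolding o_def mult_zero_right
    by (rule ennreal_tendsto_0_le[OF always_eventually[OF allI[OF le]]])
qed

text \<open>
  Open sets approximate measurable sets of finite measure from outside, and simple functions
  approximate integrable ones.
\<close>

lemma shift_dist_tendsto_0:
  fixes h :: "'a::euclidean_space \<Rightarrow> complex"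
  assumes "integrable lborel h"
  shows "(shift_dist h \<longlongrightarrow> 0) (at 0)"
  using assms
proof (induction rule: integrable_induct)
  case (base A c)
  then have A[measurable]: "A \<in> sets borel" by simp
  show ?case
  proof (rule shift_dist_approx)
    fix e :: real assume e: "e > 0"
    define e' where "e' = e / (1 + norm c)"
    have e': "e' > 0" "norm c * e' < e"
      using e by (auto simp: e'_def field_simps add_pos_nonneg)
    obtain U where U: "open U" "A \<subseteq> U" "emeasure lborel (U - A) < e'"
      using outer_regular_lborel[OF A e'(1)] by auto
    have [measurable]: "U \<in> sets borel" using U by simp
    have "emeasure lborel U = emeasure lborel A + emeasure lborel (U - A)"
      using U by (subst plus_emeasure) (auto simp: Un_absorb1)
    then have "emeasure lborel U < \<infinity>"
      using base U by (auto simp: less_top[symmetric])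
    moreover have "(\<integral>\<^sup>+x. ennreal (norm (indicator A x *\<^sub>R c - indicator U x *\<^sub>R c)) \<partial>lborel) < ennreal e"
    proof -
      have "(\<integral>\<^sup>+x. ennreal (norm (indicator A x *\<^sub>R c - indicator U x *\<^sub>R c)) \<partial>lborel)
          = (\<integral>\<^sup>+x. ennreal (norm c) * indicator (U - A) x \<partial>lborel)"
        using U by (intro nn_integral_cong) (auto simp: indicator_def)
      also have "\<dots> = ennreal (norm c) * emeasure lborel (U - A)"
        by (simp add: nn_integral_cmult)
      also have "\<dots> \<le> ennreal (norm c) * ennreal e'"
        using U by (intro mult_left_mono) auto
      also have "\<dots> < ennreal e"
        using e' e by (simp add: ennreal_mult[symmetric] ennreal_less_iff)
      finally show ?thesis .
    qed
    ultimately show "\<exists>k\<in>borel_measurable borel. (shift_dist k \<longlongrightarrow> 0) (at 0) \<and>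
        (\<integral>\<^sup>+x. ennreal (norm (indicator A x *\<^sub>R c - k x)) \<partial>lborel) < ennreal e"
      using shift_dist_open[OF U(1), of c] by (intro bexI[of _ "\<lambda>x. indicator U x *\<^sub>R c"]) auto
  qed simp
next
  case (add f g)
  then have [measurable]: "f \<in> borel_measurable borel" "g \<in> borel_measurable borel" by auto
  have le: "shift_dist (\<lambda>x. f x + g x) u \<le> shift_dist f u + shift_dist g u" for u
  proof -
    have "shift_dist (\<lambda>x. f x + g x) u \<le> (\<integral>\<^sup>+x. ennreal (norm (f (x - u) - f x)) + ennreal (norm (g (x - u) - g x)) \<partial>lborel)"
      unfolding shift_dist_def
      by (intro nn_integral_mono)
        (auto simp flip: ennreal_plus intro!: ennreal_leI order_trans[OF _ norm_triangle_ineq] simp: algebra_simps)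
    then show ?thesis by (simp add: nn_integral_add shift_dist_def)
  qed
  have "((\<lambda>u. shift_dist f u + shift_dist g u) \<longlongrightarrow> 0 + 0) (at 0)"
    by (intro tendsto_intros add)
  then show ?case
    unfolding add_0 by (rule ennreal_tendsto_0_le[OF always_eventually[OF allI[OF le]]])
next
  case (lim f s)
  then have [measurable]: "f \<in> borel_measurable borel" "\<And>i. s i \<in> borel_measurable borel" by auto
  show ?case
  proof (rule shift_dist_approx)
    fix e :: real assume e: "e > 0"
    have "(\<lambda>i. (\<integral>\<^sup>+x. ennreal (norm (f x - s i x)) \<partial>lborel)) \<longlonglongrightarrow> 0"
    proof (rule nn_integral_dominated_convergence_norm[where w="\<lambda>x. 2 * norm (f x)"])
      show "(\<integral>\<^sup>+x. ennreal (2 * norm (f x)) \<partial>lborel) < \<infinity>"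
        using \<open>integrable lborel f\<close> by (auto simp: integrable_iff_bounded ennreal_mult nn_integral_cmult ennreal_mult_less_top)
    qed (use lim in auto)
    then have "eventually (\<lambda>i. (\<integral>\<^sup>+x. ennreal (norm (f x - s i x)) \<partial>lborel) < ennreal e) sequentially"
      using e by (auto simp: order_tendsto_iff)
    then obtain i where "(\<integral>\<^sup>+x. ennreal (norm (f x - s i x)) \<partial>lborel) < ennreal e"
      by (auto simp: eventually_sequentially)
    with lim show "\<exists>k\<in>borel_measurable borel. (shift_dist k \<longlongrightarrow> 0) (at 0) \<and>
        (\<integral>\<^sup>+x. ennreal (norm (f x - k x)) \<partial>lborel) < ennreal e"
      by (intro bexI[of _ "s i"]) auto
  qed simp
qed

section \<open>Fourier inversion\<close>

lemma cis_borel_measurable [measurable]: "cis \<in> borel_measurable borel"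
  unfolding cis_conv_exp by (intro borel_measurable_continuous_onI continuous_intros)

lemma cnj_borel_measurable [measurable]: "cnj \<in> borel_measurable borel"
  by (intro borel_measurable_continuous_onI continuous_intros)

lemma complex_of_real_borel_measurable [measurable]: "complex_of_real \<in> borel_measurable borel"
  by (intro borel_measurable_continuous_onI continuous_intros)

definition gauss :: "'a::euclidean_space \<Rightarrow> real" where
  "gauss x = (\<Prod>b\<in>Basis. std_normal_density (x \<bullet> b))"

lemma gauss_eq:
  "sqrt (2 * pi) ^ DIM('a) * gauss (x :: 'a::euclidean_space) = exp (- (norm x)\<^sup>2 / 2)"
proof -
  have "sqrt (2 * pi) ^ DIM('a) * gauss x = (\<Prod>b\<in>(Basis :: 'a set). exp (- (x \<bullet> b)\<^sup>2 / 2))"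
    unfolding gauss_def by (simp add: std_normal_density_def prod_dividef)
  also have "\<dots> = exp (\<Sum>b\<in>(Basis :: 'a set). - (x \<bullet> b)\<^sup>2 / 2)"
    by (simp add: exp_sum)
  also have "(\<Sum>b\<in>(Basis :: 'a set). - (x \<bullet> b)\<^sup>2 / 2) = - (norm x)\<^sup>2 / 2"
    unfolding power2_norm_eq_inner
    by (subst euclidean_inner) (simp add: sum_negf power2_eq_square flip: sum_divide_distrib)
  finally show ?thesis .
qed

lemma gauss_nonneg [simp]: "0 \<le> gauss x"
  unfolding gauss_def by (intro prod_nonneg) auto

lemma gauss_measurable [measurable]: "gauss \<in> borel_measurable borel"
  unfolding gauss_def by measurable

lemma nn_integral_gauss: "(\<integral>\<^sup>+x. ennreal (gauss x) \<partial>lborel) = 1"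
proof -
  have "(\<integral>\<^sup>+x. ennreal (std_normal_density x) \<partial>lborel) = 1"
    using prob_space.emeasure_space_1[OF prob_space_normal_density, of 1 0]
    by (simp add: emeasure_density)
  then have "(\<integral>\<^sup>+x. (\<Prod>b\<in>Basis. ennreal (std_normal_density ((x::'a) \<bullet> b))) \<partial>lborel) = 1"
    by (subst nn_integral_lborel_prod) auto
  then show ?thesis by (simp add: gauss_def prod_ennreal)
qed

lemma integral_gauss: "(LINT x|lborel. gauss x) = 1"
  by (simp add: integral_eq_nn_integral nn_integral_gauss)

lemma integrable_gauss [simp]: "integrable lborel gauss"
  by (intro integrableI_bounded) (auto simp: nn_integral_gauss)

text \<open>
  The density factors over the coordinates, so the transform is a product of characteristic
  functions of the one-dimensional normal distribution.
\<close>

lemma integral_gauss_cis: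
  fixes u :: "'a::euclidean_space"
  shows "(LINT x|lborel. cis (u \<bullet> x) * of_real (gauss x)) = of_real (exp (- (norm u)\<^sup>2 / 2))"
proof -
  interpret product_sigma_finite "\<lambda>_::'a. lborel :: real measure" ..
  have 1: "(LINT x|lborel. cis (t * x) * complex_of_real (std_normal_density x))
      = of_real (exp (- t\<^sup>2 / 2))" for t
  proof -
    have "char std_normal_distribution t = (LINT x|lborel. std_normal_density x *\<^sub>R cis (t * x))"
      unfolding char_def by (subst integral_density) (auto simp: cis_conv_exp)
    then show ?thesis
      by (simp add: char_std_normal_distribution scaleR_conv_of_real mult.commute)
  qed
  have "(LINT x|lborel. cis (u \<bullet> x) * of_real (gauss x))
      = (LINT f|(\<Pi>\<^sub>M b\<in>(Basis :: 'a set). lborel). cis (u \<bullet> (\<Sum>b\<in>Basis. f b *\<^sub>R b)) * of_real (gauss (\<Sum>b\<in>Basis. f b *\<^sub>R b)))"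
    by (subst lborel_eq) (simp add: integral_distr)
  also have "\<dots> = (LINT f|(\<Pi>\<^sub>M b\<in>(Basis :: 'a set). lborel). (\<Prod>b\<in>Basis. cis ((u \<bullet> b) * f b) * of_real (std_normal_density (f b))))"
  proof (intro Bochner_Integration.integral_cong refl)
    fix f :: "'a \<Rightarrow> real"
    have "cis (u \<bullet> (\<Sum>b\<in>Basis. f b *\<^sub>R b)) = (\<Prod>b\<in>Basis. cis ((u \<bullet> b) * f b))"
      by (simp add: cis_conv_exp inner_sum_right sum_distrib_left exp_sum mult_ac)
    moreover have "gauss (\<Sum>b\<in>Basis. f b *\<^sub>R b) = (\<Prod>b\<in>(Basis::'a set). std_normal_density (f b))"
      unfolding gauss_def by (intro prod.cong) auto
    ultimately show "cis (u \<bullet> (\<Sum>b\<in>Basis. f b *\<^sub>R b)) * of_real (gauss (\<Sum>b\<in>Basis. f b *\<^sub>R b))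
      = (\<Prod>b\<in>Basis. cis ((u \<bullet> b) * f b) * complex_of_real (std_normal_density (f b)))"
      by (simp add: prod.distrib)
  qed
  also have "\<dots> = (\<Prod>b\<in>(Basis :: 'a set). LINT x|lborel. cis ((u \<bullet> b) * x) * complex_of_real (std_normal_density x))"
  proof (rule product_integral_prod)
    fix b :: 'a
    have "integrable lborel std_normal_density" by simp
    then show "integrable lborel (\<lambda>x. cis ((u \<bullet> b) * x) * complex_of_real (std_normal_density x))"
      by (rule Bochner_Integration.integrable_bound) (auto simp: norm_mult)
  qed simp
  also have "\<dots> = (\<Prod>b\<in>(Basis :: 'a set). of_real (exp (- (u \<bullet> b)\<^sup>2 / 2)))"
    by (simp only: 1)
  also have "\<dots> = of_real (exp (\<Sum>b\<in>(Basis :: 'a set). - (u \<bullet> b)\<^sup>2 / 2))"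
    by (simp add: exp_sum)
  also have "(\<Sum>b\<in>(Basis :: 'a set). - (u \<bullet> b)\<^sup>2 / 2) = - (norm u)\<^sup>2 / 2"
    unfolding power2_norm_eq_inner
    by (subst euclidean_inner) (simp add: sum_negf power2_eq_square flip: sum_divide_distrib)
  finally show ?thesis .
qed

definition FT :: "('a::euclidean_space \<Rightarrow> complex) \<Rightarrow> 'a \<Rightarrow> complex" where
  "FT h \<omega> = (LINT x|lborel. h x * cis (- (2 * pi * (x \<bullet> \<omega>))))"

definition IFT :: "('a::euclidean_space \<Rightarrow> complex) \<Rightarrow> 'a \<Rightarrow> complex" where
  "IFT H x = (LINT \<omega>|lborel. H \<omega> * cis (2 * pi * (x \<bullet> \<omega>)))"

lemma FT_measurable [measurable]:
  assumes [measurable]: "h \<in> borel_measurable borel"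
  shows "FT h \<in> borel_measurable borel"
  unfolding FT_def by measurable

lemma IFT_measurable [measurable]:
  assumes [measurable]: "h \<in> borel_measurable borel"
  shows "IFT h \<in> borel_measurable borel"
  unfolding IFT_def by measurable

lemma integral_dilated_gauss_cis:
  fixes v :: "'a::euclidean_space"
  assumes \<epsilon>: "\<epsilon> > 0"
  shows "(LINT \<omega>|lborel. cis (2 * pi * (v \<bullet> \<omega>)) * of_real (sqrt (2 * pi) ^ DIM('a) * gauss ((2 * pi * \<epsilon>) *\<^sub>R \<omega>)))
     = of_real (gauss (v /\<^sub>R \<epsilon>) / \<epsilon> ^ DIM('a))"
proof -
  let ?d = "DIM('a)" and ?k = "2 * pi * \<epsilon>"
  let ?I = "LINT \<omega>|lborel. cis (2 * pi * (v \<bullet> \<omega>)) * of_real (gauss (?k *\<^sub>R \<omega>))"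
  have "of_real (exp (- (norm (v /\<^sub>R \<epsilon>))\<^sup>2 / 2)) = (LINT x|lborel. cis ((v /\<^sub>R \<epsilon>) \<bullet> x) * of_real (gauss x))"
    by (rule integral_gauss_cis[symmetric])
  also have "\<dots> = (\<bar>?k\<bar> ^ ?d) *\<^sub>R (LINT \<omega>|lborel. cis ((v /\<^sub>R \<epsilon>) \<bullet> (0 + ?k *\<^sub>R \<omega>)) * of_real (gauss (0 + ?k *\<^sub>R \<omega>)))"
    by (rule lborel_integral_affine) (use \<epsilon> in auto)
  also have "\<dots> = of_real (?k ^ ?d) * ?I"
    using \<epsilon> by (simp add: scaleR_conv_of_real field_simps)
  finally have I: "of_real (?k ^ ?d) * ?I = of_real (exp (- (norm (v /\<^sub>R \<epsilon>))\<^sup>2 / 2))" ..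
  have "of_real (?k ^ ?d) * ?I = of_real (sqrt (2 * pi) ^ ?d * gauss (v /\<^sub>R \<epsilon>))"
    unfolding I gauss_eq ..
  then have "of_real (sqrt (2 * pi) ^ ?d) * ?I
      = of_real (sqrt (2 * pi) ^ ?d * sqrt (2 * pi) ^ ?d * gauss (v /\<^sub>R \<epsilon>) / ?k ^ ?d)"
    using \<epsilon> by (simp add: field_simps)
  also have "sqrt (2 * pi) ^ ?d * sqrt (2 * pi) ^ ?d = (2 * pi) ^ ?d"
    unfolding power_mult_distrib[symmetric] by simp
  also have "(2 * pi) ^ ?d * gauss (v /\<^sub>R \<epsilon>) / ?k ^ ?d = gauss (v /\<^sub>R \<epsilon>) / \<epsilon> ^ ?d"
    by (simp add: power_mult_distrib)
  finally have fin: "of_real (sqrt (2 * pi) ^ ?d) * ?I = of_real (gauss (v /\<^sub>R \<epsilon>) / \<epsilon> ^ ?d)" .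
  have "cis (2 * pi * (v \<bullet> \<omega>)) * of_real (sqrt (2 * pi) ^ ?d * gauss (?k *\<^sub>R \<omega>))
      = of_real (sqrt (2 * pi) ^ ?d) * (cis (2 * pi * (v \<bullet> \<omega>)) * of_real (gauss (?k *\<^sub>R \<omega>)))" for \<omega>
    by (simp only: of_real_mult mult_ac)
  then show ?thesis
    by (simp only: integral_mult_right_zero fin)
qed

text \<open>
  Multiplying the transform by a Gaussian that is \<open>1\<close> at the origin and inverting amounts to averaging
  \<open>h\<close> against a Gaussian of width \<open>\<epsilon>\<close>: the damping makes the double integral absolutely convergent, so
  Fubini applies.
\<close>

lemma FT_gauss_mean:
  fixes h :: "'a::euclidean_space \<Rightarrow> complex"
  assumes h: "integrable lborel h" and \<epsilon>: "\<epsilon> > 0"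
  shows "(LINT \<omega>|lborel. FT h \<omega> * cis (2 * pi * (x \<bullet> \<omega>)) * of_real (sqrt (2 * pi) ^ DIM('a) * gauss ((2 * pi * \<epsilon>) *\<^sub>R \<omega>)))
     = (LINT s|lborel. h (x - \<epsilon> *\<^sub>R s) * of_real (gauss s))"
proof -
  have [measurable]: "h \<in> borel_measurable borel" using h by auto
  let ?w = "\<lambda>\<omega>::'a. sqrt (2 * pi) ^ DIM('a) * gauss ((2 * pi * \<epsilon>) *\<^sub>R \<omega>)"
  have w: "integrable lborel ?w"
    using integrable_lborel_affine[OF integrable_gauss, of "2 * pi * \<epsilon>" 0] \<epsilon> by simp
  define f where "f = (\<lambda>\<omega> y. h y * cis (- (2 * pi * (y \<bullet> \<omega>))) * cis (2 * pi * (x \<bullet> \<omega>)) * of_real (?w \<omega>))"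
  have [measurable]: "case_prod f \<in> borel_measurable (lborel \<Otimes>\<^sub>M lborel)"
    unfolding f_def by measurable
  have nf: "norm (f \<omega> y) = norm (h y) * ?w \<omega>" for \<omega> y
    unfolding f_def norm_mult norm_of_real by (simp add: abs_mult)
  have int: "integrable (lborel \<Otimes>\<^sub>M lborel) (case_prod f)"
  proof (rule lborel_pair.Fubini_integrable)
    show "integrable lborel (\<lambda>\<omega>. LINT y|lborel. norm (case (\<omega>, y) of (\<omega>, y) \<Rightarrow> f \<omega> y))"
      using w by (simp add: nf)
    show "AE \<omega> in lborel. integrable lborel (\<lambda>y. case (\<omega>, y) of (\<omega>, y) \<Rightarrow> f \<omega> y)"
    proof (intro AE_I2)
      fix \<omega>
      have "integrable lborel (\<lambda>y. norm (h y) * ?w \<omega>)" using h by simp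
      then show "integrable lborel (\<lambda>y. case (\<omega>, y) of (\<omega>, y) \<Rightarrow> f \<omega> y)"
        by (rule Bochner_Integration.integrable_bound) (auto simp: nf)
    qed
  qed simp
  have "(LINT \<omega>|lborel. FT h \<omega> * cis (2 * pi * (x \<bullet> \<omega>)) * of_real (?w \<omega>))
      = (LINT \<omega>|lborel. LINT y|lborel. f \<omega> y)"
    unfolding FT_def f_def by (simp only: flip: integral_mult_left_zero)
  also have "\<dots> = (LINT y|lborel. LINT \<omega>|lborel. f \<omega> y)"
    using lborel_pair.Fubini_integral[OF int] by simp
  also have "\<dots> = (LINT y|lborel. h y * of_real (gauss ((x - y) /\<^sub>R \<epsilon>) / \<epsilon> ^ DIM('a)))"
  proof (intro Bochner_Integration.integral_cong refl)
    fix y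
    have "f \<omega> y = h y * (cis (2 * pi * ((x - y) \<bullet> \<omega>)) * of_real (?w \<omega>))" for \<omega>
    proof -
      have "cis (- (2 * pi * (y \<bullet> \<omega>))) * cis (2 * pi * (x \<bullet> \<omega>)) = cis (2 * pi * ((x - y) \<bullet> \<omega>))"
        by (simp add: cis_mult inner_diff_left right_diff_distrib)
      then show ?thesis unfolding f_def mult.assoc by simp
    qed
    then show "(LINT \<omega>|lborel. f \<omega> y) = h y * of_real (gauss ((x - y) /\<^sub>R \<epsilon>) / \<epsilon> ^ DIM('a))"
      unfolding integral_dilated_gauss_cis[OF \<epsilon>, symmetric] by simp
  qed
  also have "\<dots> = (\<bar>-\<epsilon>\<bar> ^ DIM('a)) *\<^sub>R (LINT s|lborel. h (x + (-\<epsilon>) *\<^sub>R s) *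
      of_real (gauss ((x - (x + (-\<epsilon>) *\<^sub>R s)) /\<^sub>R \<epsilon>) / \<epsilon> ^ DIM('a)))"
    by (rule lborel_integral_affine) (use \<epsilon> in auto)
  also have "\<dots> = (LINT s|lborel. h (x - \<epsilon> *\<^sub>R s) * of_real (gauss s))"
  proof -
    have eq: "h (x + (-\<epsilon>) *\<^sub>R s) * of_real (gauss ((x - (x + (-\<epsilon>) *\<^sub>R s)) /\<^sub>R \<epsilon>) / \<epsilon> ^ DIM('a))
        = h (x - \<epsilon> *\<^sub>R s) * of_real (gauss s) * of_real (1 / \<epsilon> ^ DIM('a))" for s
    proof -
      have "x - (x + (-\<epsilon>) *\<^sub>R s) = \<epsilon> *\<^sub>R s" by simp
      then have 1: "(x - (x + (-\<epsilon>) *\<^sub>R s)) /\<^sub>R \<epsilon> = s"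
        using \<epsilon> by (metis less_irrefl scaleR_one scaleR_scaleR left_inverse)
      have 2: "x + (-\<epsilon>) *\<^sub>R s = x - \<epsilon> *\<^sub>R s" by simp
      show ?thesis
        unfolding 1 unfolding 2 by (simp only: of_real_divide of_real_1 times_divide_eq_right mult_1_right)
    qed
    have "\<bar>-\<epsilon>\<bar> ^ DIM('a) * (1 / \<epsilon> ^ DIM('a)) = 1" using \<epsilon> by simp
    then have c: "complex_of_real (\<bar>-\<epsilon>\<bar> ^ DIM('a)) * of_real (1 / \<epsilon> ^ DIM('a)) = 1"
      by (simp only: of_real_mult[symmetric] of_real_1)
    have "(LINT s|lborel. h (x + (-\<epsilon>) *\<^sub>R s) *
        of_real (gauss ((x - (x + (-\<epsilon>) *\<^sub>R s)) /\<^sub>R \<epsilon>) / \<epsilon> ^ DIM('a)))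
      = (LINT s|lborel. h (x - \<epsilon> *\<^sub>R s) * of_real (gauss s) * of_real (1 / \<epsilon> ^ DIM('a)))"
      by (rule Bochner_Integration.integral_cong[OF refl]) (rule eq)
    also have "\<dots> = of_real (1 / \<epsilon> ^ DIM('a)) * (LINT s|lborel. h (x - \<epsilon> *\<^sub>R s) * of_real (gauss s))"
      by (subst integral_mult_left_zero) (rule mult.commute)
    finally show ?thesis
      by (simp only: scaleR_conv_of_real mult.assoc[symmetric] c mult_1_left)
  qed
  finally show ?thesis .
qed

lemma shift_dist_measurable [measurable]:
  assumes [measurable]: "h \<in> borel_measurable borel"
  shows "shift_dist h \<in> borel_measurable borel"
  unfolding shift_dist_def by measurable

lemma shift_dist_tendsto_nhds:
  fixes h :: "'a::euclidean_space \<Rightarrow> complex"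
  assumes "integrable lborel h"
  shows "(shift_dist h \<longlongrightarrow> 0) (nhds 0)"
proof -
  have "shift_dist h 0 = 0" by (simp add: shift_dist_def)
  then show ?thesis
    using shift_dist_tendsto_0[OF assms] tendsto_at_iff_tendsto_nhds[of "shift_dist h" 0] by simp
qed

lemma shift_dist_bound:
  assumes [measurable]: "h \<in> borel_measurable borel"
  shows "shift_dist h u \<le> 2 * (\<integral>\<^sup>+x. ennreal (norm (h x)) \<partial>lborel)"
  using shift_dist_le[of h "\<lambda>_. 0" u] by (simp add: shift_dist_def)

text \<open>
  As \<open>\<epsilon> \<rightarrow> 0\<close> the Gaussian means of \<open>h\<close> converge pointwise to the inverse transform, by dominated
  convergence on the frequency side, and in \<open>L\<^sup>1\<close> to \<open>h\<close>, by continuity of translation. Fatou's lemma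
  identifies the two limits.
\<close>

theorem Fourier_inversion:
  fixes h :: "'a::euclidean_space \<Rightarrow> complex"
  assumes h: "integrable lborel h" and H: "integrable lborel (FT h)"
  shows "AE x in lborel. h x = IFT (FT h) x"
proof -
  have [measurable]: "h \<in> borel_measurable borel" using h by auto
  define \<epsilon> where "\<epsilon> n = 1 / real (Suc n)" for n
  have \<epsilon>: "\<epsilon> n > 0" for n by (simp add: \<epsilon>_def)
  have \<epsilon>0: "\<epsilon> \<longlonglongrightarrow> 0" unfolding \<epsilon>_def by (rule LIMSEQ_Suc[OF lim_1_over_n])
  define M where "M n x = (LINT s|lborel. h (x - \<epsilon> n *\<^sub>R s) * of_real (gauss s))" for n x
  have [measurable]: "M n \<in> borel_measurable borel" for n
    unfolding M_def by measurable
  have lim: "(\<lambda>n. M n x) \<longlonglongrightarrow> IFT (FT h) x" for x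
    unfolding M_def FT_gauss_mean[OF h \<epsilon>, symmetric] IFT_def
  proof (rule integral_dominated_convergence[where w="\<lambda>\<omega>. norm (FT h \<omega>)"])
    show "AE \<omega> in lborel. (\<lambda>n. FT h \<omega> * cis (2 * pi * (x \<bullet> \<omega>)) *
          of_real (sqrt (2 * pi) ^ DIM('a) * gauss ((2 * pi * \<epsilon> n) *\<^sub>R \<omega>)))
        \<longlonglongrightarrow> FT h \<omega> * cis (2 * pi * (x \<bullet> \<omega>))"
    proof (intro AE_I2)
      fix \<omega>
      have "(\<lambda>n. FT h \<omega> * cis (2 * pi * (x \<bullet> \<omega>)) * of_real (exp (- (norm ((2 * pi * \<epsilon> n) *\<^sub>R \<omega>))\<^sup>2 / 2)))
        \<longlonglongrightarrow> FT h \<omega> * cis (2 * pi * (x \<bullet> \<omega>)) * of_real (exp (- (norm ((2 * pi * 0) *\<^sub>R \<omega>))\<^sup>2 / 2))"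
        by (intro tendsto_intros \<epsilon>0) simp
      then show "(\<lambda>n. FT h \<omega> * cis (2 * pi * (x \<bullet> \<omega>)) *
          of_real (sqrt (2 * pi) ^ DIM('a) * gauss ((2 * pi * \<epsilon> n) *\<^sub>R \<omega>)))
        \<longlonglongrightarrow> FT h \<omega> * cis (2 * pi * (x \<bullet> \<omega>))"
        unfolding gauss_eq by simp
    qed
    show "AE \<omega> in lborel. norm (FT h \<omega> * cis (2 * pi * (x \<bullet> \<omega>)) *
          of_real (sqrt (2 * pi) ^ DIM('a) * gauss ((2 * pi * \<epsilon> n) *\<^sub>R \<omega>))) \<le> norm (FT h \<omega>)" for n
      unfolding gauss_eq by (intro AE_I2) (auto simp: norm_mult intro!: mult_left_le)
  qed (use H in auto)
  have le: "(\<integral>\<^sup>+x. ennreal (norm (M n x - h x)) \<partial>lborel)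
      \<le> (\<integral>\<^sup>+s. ennreal (gauss s) * shift_dist h (\<epsilon> n *\<^sub>R s) \<partial>lborel)" for n
  proof -
    \<comment> \<open>the difference is an average of increments of h since the Gaussian has integral 1;
      if the mean does not converge absolutely, the right-hand side is infinite\<close>
    have bnd: "ennreal (norm (M n x - h x)) \<le> (\<integral>\<^sup>+s. ennreal (gauss s) * ennreal (norm (h (x - \<epsilon> n *\<^sub>R s) - h x)) \<partial>lborel)" for x
    proof (cases "integrable lborel (\<lambda>s. h (x - \<epsilon> n *\<^sub>R s) * of_real (gauss s))")
      case True
      have "(LINT s|lborel. complex_of_real (gauss (s :: 'a))) = 1"
        by (simp add: integral_gauss)
      then have "M n x - h x = (LINT s|lborel. h (x - \<epsilon> n *\<^sub>R s) * of_real (gauss s)) - (LINT s|lborel. h x * of_real (gauss (s :: 'a)))"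
        unfolding M_def by simp
      also have "\<dots> = (LINT s|lborel. h (x - \<epsilon> n *\<^sub>R s) * of_real (gauss s) - h x * of_real (gauss s))"
        using True by (intro Bochner_Integration.integral_diff[symmetric]) auto
      finally have eq: "M n x - h x = (LINT s|lborel. h (x - \<epsilon> n *\<^sub>R s) * of_real (gauss s) - h x * of_real (gauss s))" .
      have "ennreal (norm (M n x - h x)) \<le> (\<integral>\<^sup>+s. ennreal (norm (h (x - \<epsilon> n *\<^sub>R s) * of_real (gauss s) - h x * of_real (gauss s))) \<partial>lborel)"
        unfolding eq using True by (intro integral_norm_bound_ennreal) auto
      also have "\<dots> = (\<integral>\<^sup>+s. ennreal (gauss s) * ennreal (norm (h (x - \<epsilon> n *\<^sub>R s) - h x)) \<partial>lborel)"
        unfolding left_diff_distrib[symmetric] norm_mult by (simp add: mult.commute ennreal_mult)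
      finally show ?thesis .
    next
      case False
      have "\<not> integrable lborel (\<lambda>s. h (x - \<epsilon> n *\<^sub>R s) * of_real (gauss s) - h x * of_real (gauss s))"
      proof
        assume "integrable lborel (\<lambda>s. h (x - \<epsilon> n *\<^sub>R s) * of_real (gauss s) - h x * of_real (gauss s))"
        then have "integrable lborel (\<lambda>s. (h (x - \<epsilon> n *\<^sub>R s) * of_real (gauss s) - h x * of_real (gauss s)) + h x * of_real (gauss s))"
          by (intro Bochner_Integration.integrable_add) auto
        with False show False by simp
      qed
      then have "(\<integral>\<^sup>+s. ennreal (norm (h (x - \<epsilon> n *\<^sub>R s) * of_real (gauss s) - h x * of_real (gauss s))) \<partial>lborel) = \<infinity>"
        by (auto simp: integrable_iff_bounded less_top[symmetric])
      also have "(\<integral>\<^sup>+s. ennreal (norm (h (x - \<epsilon> n *\<^sub>R s) * of_real (gauss s) - h x * of_real (gauss s))) \<partial>lborel)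
         = (\<integral>\<^sup>+s. ennreal (gauss s) * ennreal (norm (h (x - \<epsilon> n *\<^sub>R s) - h x)) \<partial>lborel)"
        unfolding left_diff_distrib[symmetric] norm_mult by (simp add: mult.commute ennreal_mult)
      finally show ?thesis by simp
    qed
    have "(\<integral>\<^sup>+x. ennreal (norm (M n x - h x)) \<partial>lborel)
        \<le> (\<integral>\<^sup>+x. (\<integral>\<^sup>+s. ennreal (gauss s) * ennreal (norm (h (x - \<epsilon> n *\<^sub>R s) - h x)) \<partial>lborel) \<partial>lborel)"
      by (intro nn_integral_mono bnd)
    also have "\<dots> = (\<integral>\<^sup>+s. (\<integral>\<^sup>+x. ennreal (gauss s) * ennreal (norm (h (x - \<epsilon> n *\<^sub>R s) - h x)) \<partial>lborel) \<partial>lborel)"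
      by (rule lborel_pair.Fubini') measurable
    finally show ?thesis
      by (simp add: nn_integral_cmult shift_dist_def)
  qed
  have N: "(\<integral>\<^sup>+x. ennreal (norm (h x)) \<partial>lborel) < \<infinity>"
    using h by (simp add: integrable_iff_bounded)
  have "(\<lambda>n. \<integral>\<^sup>+s. ennreal (gauss s) * shift_dist h (\<epsilon> n *\<^sub>R s) \<partial>lborel) \<longlonglongrightarrow> (\<integral>\<^sup>+s. 0 \<partial>(lborel :: 'a measure))"
  proof (rule nn_integral_dominated_convergence[where w="\<lambda>s. ennreal (gauss s) * (2 * (\<integral>\<^sup>+x. ennreal (norm (h x)) \<partial>lborel))"])
    show "AE s in lborel. ennreal (gauss s) * shift_dist h (\<epsilon> n *\<^sub>R s) \<le> ennreal (gauss s) * (2 * (\<integral>\<^sup>+x. ennreal (norm (h x)) \<partial>lborel))" for n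
      by (intro AE_I2 mult_left_mono shift_dist_bound) auto
    show "(\<integral>\<^sup>+s. ennreal (gauss s) * (2 * (\<integral>\<^sup>+x. ennreal (norm (h x)) \<partial>lborel)) \<partial>(lborel :: 'a measure)) < \<infinity>"
      using N by (simp add: nn_integral_multc nn_integral_gauss ennreal_mult_less_top)
    show "AE s in lborel. (\<lambda>n. ennreal (gauss s) * shift_dist h (\<epsilon> n *\<^sub>R s)) \<longlonglongrightarrow> 0"
    proof (intro AE_I2)
      fix s :: 'a
      have "(\<lambda>n. \<epsilon> n *\<^sub>R s) \<longlonglongrightarrow> 0 *\<^sub>R s" by (intro tendsto_intros \<epsilon>0)
      then have "(\<lambda>n. shift_dist h (\<epsilon> n *\<^sub>R s)) \<longlonglongrightarrow> 0"
        by (intro filterlim_compose[OF shift_dist_tendsto_nhds[OF h]]) simp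
      then have "(\<lambda>n. ennreal (gauss s) * shift_dist h (\<epsilon> n *\<^sub>R s)) \<longlonglongrightarrow> ennreal (gauss s) * 0"
        by (intro ennreal_tendsto_cmult) auto
      then show "(\<lambda>n. ennreal (gauss s) * shift_dist h (\<epsilon> n *\<^sub>R s)) \<longlonglongrightarrow> 0" by simp
    qed
  qed auto
  then have "(\<lambda>n. \<integral>\<^sup>+s. ennreal (gauss s) * shift_dist h (\<epsilon> n *\<^sub>R s) \<partial>lborel) \<longlonglongrightarrow> 0"
    by simp
  then have L1: "(\<lambda>n. \<integral>\<^sup>+x. ennreal (norm (M n x - h x)) \<partial>lborel) \<longlonglongrightarrow> 0"
    by (rule ennreal_tendsto_0_le[OF always_eventually[OF allI[OF le]]])
  have "(\<integral>\<^sup>+x. ennreal (norm (IFT (FT h) x - h x)) \<partial>lborel)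
      = (\<integral>\<^sup>+x. liminf (\<lambda>n. ennreal (norm (M n x - h x))) \<partial>lborel)"
    by (intro nn_integral_cong lim_imp_Liminf[symmetric] tendsto_ennrealI tendsto_intros lim) simp
  also have "\<dots> \<le> liminf (\<lambda>n. \<integral>\<^sup>+x. ennreal (norm (M n x - h x)) \<partial>lborel)"
    by (intro nn_integral_liminf) auto
  also have "\<dots> = 0"
    by (intro lim_imp_Liminf L1) simp
  finally have "(\<integral>\<^sup>+x. ennreal (norm (IFT (FT h) x - h x)) \<partial>lborel) = 0" by simp
  then have "AE x in lborel. ennreal (norm (IFT (FT h) x - h x)) = 0"
    by (subst (asm) nn_integral_0_iff_AE) auto
  then show ?thesis by eventually_elim auto
qed

section \<open>Unit cells of the integer lattice\<close>

definition ifloor :: "real^'d \<Rightarrow> int^'d" where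
  "ifloor x = (\<chi> i. \<lfloor>x $ i\<rfloor>)"

lemma vec_nth_borel_measurable [measurable]: "(\<lambda>x::real^'d. x $ i) \<in> borel_measurable borel"
  by (intro borel_measurable_continuous_onI continuous_intros)

lemma ifloor_eq_iff: "ifloor x = k \<longleftrightarrow> (\<forall>i. of_int (k $ i) \<le> x $ i \<and> x $ i < of_int (k $ i) + 1)"
  by (auto simp: ifloor_def vec_eq_iff floor_eq_iff)

lemma ifloor_measurable [measurable]: "ifloor \<in> borel \<rightarrow>\<^sub>M count_space (UNIV :: (int^'d) set)"
  unfolding measurable_count_space_eq2_countable
proof (intro conjI ballI)
  fix k :: "int^'d"
  have "ifloor -` {k} \<inter> space borel = {x \<in> space borel. \<forall>i. of_int (k $ i) \<le> x $ i \<and> x $ i < of_int (k $ i) + 1}"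
    by (rule set_eqI) (simp add: ifloor_eq_iff)
  also have "\<dots> \<in> sets borel" by measurable
  finally show "ifloor -` {k} \<inter> space borel \<in> sets borel" .
qed auto

lemma emeasure_ifloor_cell: "emeasure lborel {x. ifloor x = (k :: int^'d)} = 1"
proof -
  let ?l = "zvec k :: real^'d" and ?u = "zvec k + One :: real^'d"
  have One: "(\<Sum>x\<in>Basis. (x :: real^'d) $ i) = 1" for i
    using inner_sum_Basis[of "axis i 1 :: real^'d"] by (simp add: inner_axis axis_in_Basis_iff)
  have "emeasure lborel (box ?l ?u) \<le> emeasure lborel {x. ifloor x = k}"
    by (intro emeasure_mono) (auto simp: mem_box_cart ifloor_eq_iff zvec_def One less_imp_le)
  moreover have "emeasure lborel {x. ifloor x = k} \<le> emeasure lborel (cbox ?l ?u)"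
    by (intro emeasure_mono) (auto simp: mem_box_cart ifloor_eq_iff zvec_def One less_imp_le)
  ultimately show ?thesis
    by (simp add: emeasure_lborel_box_eq emeasure_lborel_cbox_eq inner_add_left)
qed

lemma nn_integral_cells:
  fixes f :: "real^'d \<Rightarrow> ennreal"
  assumes [measurable]: "f \<in> borel_measurable borel"
  shows "(\<integral>\<^sup>+x. f x \<partial>lborel) = (\<integral>\<^sup>+k. (\<integral>\<^sup>+x. f x * indicator {x. ifloor x = k} x \<partial>lborel) \<partial>count_space UNIV)"
proof -
  have "(\<integral>\<^sup>+x. f x \<partial>lborel) = (\<integral>\<^sup>+x. (\<integral>\<^sup>+k. f x * indicator {x. ifloor x = k} x \<partial>count_space UNIV) \<partial>lborel)"
  proof (intro nn_integral_cong)
    fix x :: "real^'d"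
    have "(\<integral>\<^sup>+k. f x * indicator {x. ifloor x = k} x \<partial>count_space UNIV) = (\<integral>\<^sup>+k. f x * indicator {ifloor x} k \<partial>count_space UNIV)"
      by (intro nn_integral_cong) (auto simp: indicator_def)
    then show "f x = (\<integral>\<^sup>+k. f x * indicator {x. ifloor x = k} x \<partial>count_space UNIV)"
      by (simp add: nn_integral_cmult)
  qed
  also have "\<dots> = (\<integral>\<^sup>+k. (\<integral>\<^sup>+x. f x * indicator {x. ifloor x = k} x \<partial>lborel) \<partial>count_space UNIV)"
    by (rule nn_integral_count_space_nn_integral) auto
  finally show ?thesis .
qed

lemma nn_integral_ifloor:
  "(\<integral>\<^sup>+x. C (ifloor x) \<partial>lborel) = (\<integral>\<^sup>+k. C (k :: int^'d) \<partial>count_space UNIV)"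
proof -
  have [measurable]: "(\<lambda>x. C (ifloor x)) \<in> borel_measurable borel"
    by (rule measurable_compose[OF ifloor_measurable]) simp
  have "(\<integral>\<^sup>+x. C (ifloor x) \<partial>lborel)
      = (\<integral>\<^sup>+k. (\<integral>\<^sup>+x. C k * indicator {x. ifloor x = k} x \<partial>lborel) \<partial>count_space UNIV)"
    by (subst nn_integral_cells) (auto intro!: nn_integral_cong simp: indicator_def)
  then show ?thesis by (simp add: nn_integral_cmult emeasure_ifloor_cell)
qed

text \<open>
  Index differences of size at most \<open>r\<close>. Moving a point by less than \<open>r\<close> in every coordinate
  moves its cell by an element of \<^term>\<open>icube r\<close>.
\<close>

definition icube :: "nat \<Rightarrow> (int^'d) set" where
  "icube r = {e. \<forall>i. \<bar>e $ i\<bar> \<le> int r}"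

lemma finite_icube [simp]: "finite (icube r :: (int^'d) set)"
proof -
  have "vec_nth ` icube r \<subseteq> (PiE (UNIV :: 'd set) (\<lambda>_. {- int r..int r}))"
    by (auto simp: icube_def abs_le_iff minus_le_iff)
  then have "finite (vec_nth ` (icube r :: (int^'d) set))"
    by (rule finite_subset) (intro finite_PiE, auto)
  then show ?thesis
    by (rule finite_imageD) (auto simp: inj_on_def vec_nth_inject)
qed

definition spread :: "nat \<Rightarrow> (int^'d \<Rightarrow> ennreal) \<Rightarrow> int^'d \<Rightarrow> ennreal" where
  "spread r C k = (\<Sum>e\<in>icube r. C (k + e))"

lemma spread_ge: "(\<And>i. \<bar>j $ i - k $ i\<bar> \<le> int r) \<Longrightarrow> C j \<le> spread r C k"
proof -
  assume "\<And>i. \<bar>j $ i - k $ i\<bar> \<le> int r"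
  then have "j - k \<in> icube r" by (auto simp: icube_def)
  then have "C (k + (j - k)) \<le> (\<Sum>e\<in>icube r. C (k + e))"
    by (intro member_le_sum) auto
  then show ?thesis by (simp add: spread_def)
qed

lemma nn_integral_count_space_shift:
  fixes C :: "int^'d \<Rightarrow> ennreal"
  shows "(\<integral>\<^sup>+k. C (k + e) \<partial>count_space UNIV) = (\<integral>\<^sup>+k. C k \<partial>count_space UNIV)"
proof (rule nn_integral_bij_count_space)
  show "bij_betw (\<lambda>k. k + e) UNIV UNIV"
    by (rule bij_betw_byWitness[where f'="\<lambda>k. k - e"]) auto
qed

lemma nn_integral_spread:
  "(\<integral>\<^sup>+k. spread r C k \<partial>count_space UNIV) = of_nat (card (icube r :: (int^'d) set)) * (\<integral>\<^sup>+k. C (k :: int^'d) \<partial>count_space UNIV)"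
  unfolding spread_def by (subst nn_integral_sum) (auto simp: nn_integral_count_space_shift)

section \<open>Continuous majorized representatives in Feichtinger's algebra\<close>

lemma norm_IFT_le: "ennreal (norm (IFT H x)) \<le> (\<integral>\<^sup>+\<omega>. ennreal (norm (H \<omega>)) \<partial>lborel)"
proof (cases "integrable lborel (\<lambda>\<omega>. H \<omega> * cis (2 * pi * (x \<bullet> \<omega>)))")
  case True
  then have "ennreal (norm (IFT H x)) \<le> (\<integral>\<^sup>+\<omega>. ennreal (norm (H \<omega> * cis (2 * pi * (x \<bullet> \<omega>)))) \<partial>lborel)"
    unfolding IFT_def by (rule integral_norm_bound_ennreal)
  then show ?thesis by (simp add: norm_mult)
qed (simp add: IFT_def not_integrable_integral_eq)

lemma continuous_on_integral_dominated:
  fixes f :: "'a::metric_space \<Rightarrow> 'b \<Rightarrow> complex"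
  assumes w: "integrable M w" and [measurable]: "\<And>x. f x \<in> borel_measurable M"
    and "\<And>x z. norm (f x z) \<le> w z" and c: "\<And>z. continuous_on UNIV (\<lambda>x. f x z)"
  shows "continuous_on UNIV (\<lambda>x. LINT z|M. f x z)"
  unfolding continuous_on_sequentially
proof (intro allI ballI impI)
  fix X :: "nat \<Rightarrow> 'a" and a assume X: "(\<forall>n. X n \<in> UNIV) \<and> X \<longlonglongrightarrow> a"
  show "((\<lambda>x. LINT z|M. f x z) \<circ> X) \<longlonglongrightarrow> (LINT z|M. f a z)"
    unfolding o_def
  proof (rule integral_dominated_convergence[OF _ _ w])
    show "AE z in M. (\<lambda>i. f (X i) z) \<longlonglongrightarrow> f a z"
      by (intro AE_I2 continuous_on_tendsto_compose[OF c]) (use X in auto)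
  qed (use assms in auto)
qed

text \<open>
  A continuous function in the Wiener space, with an explicit witness: \<open>C k\<close> bounds \<open>g\<close> on the whole
  closed unit neighbourhood of the cell \<open>k\<close>, so that grid points up to distance \<open>1\<close> are still
  controlled by the cell of the base point.
\<close>

definition wiener_majorant :: "(real^'d \<Rightarrow> complex) \<Rightarrow> (int^'d \<Rightarrow> ennreal) \<Rightarrow> bool" where
  "wiener_majorant g C \<longleftrightarrow> continuous_on UNIV g \<and> (\<integral>\<^sup>+k. C k \<partial>count_space UNIV) < \<infinity> \<and>
     (\<forall>y z. (\<forall>i. \<bar>z $ i - y $ i\<bar> \<le> 1) \<longrightarrow> ennreal (norm (g z)) \<le> C (ifloor y))"

text \<open>
  Open null sets are empty; this turns almost-everywhere bounds on continuous functions into bounds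
  everywhere.
\<close>

lemma open_AE_nonempty:
  fixes S :: "'a::euclidean_space set"
  assumes "open S" "AE w in lborel. w \<notin> S"
  shows "S = {}"
proof (rule ccontr)
  assume "S \<noteq> {}"
  then have "\<not> negligible S" using assms(1) by (rule open_not_negligible[rotated])
  moreover have "AE w in lebesgue. w \<notin> S" using assms(2) by (rule AE_completion)
  then have "S \<in> null_sets lebesgue"
    by (simp add: completion.null_sets_iff_AE)
  ultimately show False by (simp add: negligible_iff_null_sets)
qed

text \<open>
  A bound on almost every point of each cell becomes a bound at every \<open>z\<close> by continuity, from the
  points in the unit ball around \<open>z\<close>. If \<open>z\<close> is within \<open>1\<close> of \<open>y\<close> in each coordinate, those points
  are within \<open>2\<close> of \<open>y\<close>, so their cells differ from that of \<open>y\<close> by at most \<open>2\<close>.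
\<close>

lemma wiener_majorant_from_AE:
  fixes g :: "real^'d \<Rightarrow> complex"
  assumes g: "continuous_on UNIV g" and c: "(\<integral>\<^sup>+k. c k \<partial>count_space UNIV) < \<infinity>"
    and ae: "AE x in lborel. ennreal (norm (g x)) \<le> c (ifloor x)"
  shows "wiener_majorant g (spread 2 c)"
  unfolding wiener_majorant_def
proof (intro conjI allI impI g)
  show "(\<integral>\<^sup>+k. spread 2 c k \<partial>count_space UNIV) < \<infinity>"
    using c by (simp add: nn_integral_spread ennreal_mult_less_top ennreal_of_nat_eq_real_of_nat)
  fix y z :: "real^'d" assume yz: "\<forall>i. \<bar>z $ i - y $ i\<bar> \<le> 1"
  let ?C = "spread 2 c (ifloor y)"
  define S where "S = ball z 1 \<inter> {w. ?C < ennreal (norm (g w))}"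
  have "open S"
  proof (cases "?C")
    case (real r)
    have "continuous_on UNIV (\<lambda>w. norm (g w))" by (intro continuous_intros g)
    then have "open {w. r < norm (g w)}" by (intro open_Collect_less) auto
    with real show ?thesis unfolding S_def by (auto simp: ennreal_less_iff)
  qed (simp add: S_def)
  moreover have "AE w in lborel. w \<notin> S"
    using ae
  proof eventually_elim
    case (elim w)
    show ?case
    proof
      assume w: "w \<in> S"
      have "c (ifloor w) \<le> ?C"
      proof (rule spread_ge)
        fix i
        have "\<bar>(w - z) $ i\<bar> < 1"
          using w by (intro le_less_trans[OF component_le_norm_cart]) (auto simp: S_def dist_norm norm_minus_commute)
        then have "\<bar>w $ i - y $ i\<bar> < 2" using yz[rule_format, of i] by simp
        then show "\<bar>ifloor w $ i - ifloor y $ i\<bar> \<le> int 2"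
          unfolding ifloor_def by simp linarith
      qed
      with elim w show False by (auto simp: S_def)
    qed
  qed
  ultimately have "S = {}" by (rule open_AE_nonempty)
  moreover have "z \<in> ball z 1" by simp
  ultimately show "ennreal (norm (g z)) \<le> ?C" unfolding S_def by (metis (mono_tags, lifting) IntI empty_iff mem_Collect_eq not_le)
qed

text \<open>
  If \<open>m\<close> is the mass of \<open>|g|\<close> on a cell \<open>k0\<close>, integrating the hypothesis over the \<open>t\<close> with
  \<open>x - t\<close> in that cell gives \<open>|g x| * m\<close> on the left and at most the integral of \<open>H\<close> over the
  cells adjacent to the cell of \<open>x\<close> minus \<open>k0\<close> on the right.
\<close>

lemma S0_AE_majorant:
  fixes g H :: "real^'d \<Rightarrow> _"
  assumes [measurable]: "(g :: real^'d \<Rightarrow> complex) \<in> borel_measurable borel" "(H :: real^'d \<Rightarrow> ennreal) \<in> borel_measurable borel"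
    and H: "(\<integral>\<^sup>+t. H t \<partial>lborel) < \<infinity>"
    and le: "AE x in lborel. AE t in lborel. ennreal (norm (g x) * norm (g (x - t))) \<le> H t"
  shows "\<exists>c. (\<integral>\<^sup>+k. c k \<partial>count_space UNIV) < \<infinity> \<and> (AE x in lborel. ennreal (norm (g x)) \<le> c (ifloor x))"
proof (cases "AE x in lborel. g x = 0")
  case True
  then show ?thesis by (intro exI[of _ "\<lambda>_. 0"]) auto
next
  case False
  let ?E = "\<lambda>k. {x. ifloor x = (k :: int^'d)}"
  \<comment> \<open>truncation at 1 makes this mass finite, so that one may divide by it\<close>
  let ?m = "\<lambda>k. (\<integral>\<^sup>+x. ennreal (min 1 (norm (g x))) * indicator (?E k) x \<partial>lborel)"
  have "\<exists>k. ?m k \<noteq> 0"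
  proof (rule ccontr)
    assume "\<not> (\<exists>k. ?m k \<noteq> 0)"
    then have "(\<integral>\<^sup>+x. ennreal (min 1 (norm (g x))) \<partial>lborel) = 0"
      by (subst nn_integral_cells) auto
    then have "AE x in lborel. ennreal (min 1 (norm (g x))) = 0"
      by (subst (asm) nn_integral_0_iff_AE) auto
    then have "AE x in lborel. g x = 0"
      by eventually_elim (auto simp: min_def split: if_splits)
    with False show False by simp
  qed
  then obtain k0 where k0: "?m k0 \<noteq> 0" by auto
  have "?m k0 \<le> (\<integral>\<^sup>+x. indicator (?E k0) x \<partial>lborel)"
    by (intro nn_integral_mono) (auto simp: indicator_def)
  then have mfin: "?m k0 \<noteq> \<infinity>"
    by (auto simp: emeasure_ifloor_cell top_unique)
  define Hc where "Hc k = (\<integral>\<^sup>+t. H t * indicator (?E k) t \<partial>lborel)" for k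
  define c where "c k = spread 1 Hc (k - k0) / ?m k0" for k
  have "(\<integral>\<^sup>+k. c k \<partial>count_space UNIV) = (\<integral>\<^sup>+k. spread 1 Hc (k + (- k0)) \<partial>count_space UNIV) / ?m k0"
    unfolding c_def by (simp add: divide_ennreal_def nn_integral_multc)
  also have "\<dots> = of_nat (card (icube 1 :: (int^'d) set)) * (\<integral>\<^sup>+t. H t \<partial>lborel) / ?m k0"
    by (simp only: nn_integral_count_space_shift nn_integral_spread Hc_def nn_integral_cells[of H, simplified])
  also have "\<dots> < \<infinity>"
    using H k0 by (simp add: divide_ennreal_def ennreal_mult_less_top ennreal_of_nat_eq_real_of_nat less_top[symmetric]
        ennreal_mult_eq_top_iff)
  finally have csum: "(\<integral>\<^sup>+k. c k \<partial>count_space UNIV) < \<infinity>" .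
  have "AE x in lborel. ennreal (norm (g x)) \<le> c (ifloor x)"
    using le
  proof eventually_elim
    case (elim x)
    have "ennreal (norm (g x)) * ?m k0 \<le> ennreal (norm (g x)) * (\<integral>\<^sup>+y. ennreal (norm (g y)) * indicator (?E k0) y \<partial>lborel)"
      by (intro mult_left_mono nn_integral_mono) (auto simp: indicator_def)
    also have "(\<integral>\<^sup>+y. ennreal (norm (g y)) * indicator (?E k0) y \<partial>lborel)
        = (\<integral>\<^sup>+t. ennreal (norm (g (x - t))) * indicator (?E k0) (x - t) \<partial>lborel)"
      by (subst nn_integral_lborel_reflect) auto
    also have "ennreal (norm (g x)) * \<dots> = (\<integral>\<^sup>+t. ennreal (norm (g x) * norm (g (x - t))) * indicator (?E k0) (x - t) \<partial>lborel)"
      by (simp add: ennreal_mult mult.assoc nn_integral_cmult)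
    also have "\<dots> \<le> (\<integral>\<^sup>+t. (\<Sum>e\<in>icube 1. H t * indicator (?E (ifloor x - k0 + e)) t) \<partial>lborel)"
    proof (rule nn_integral_mono_AE, use elim in eventually_elim)
      fix t assume t: "ennreal (norm (g x) * norm (g (x - t))) \<le> H t"
      show "ennreal (norm (g x) * norm (g (x - t))) * indicator (?E k0) (x - t)
          \<le> (\<Sum>e\<in>icube 1. H t * indicator (?E (ifloor x - k0 + e)) t)"
      proof (cases "ifloor (x - t) = k0")
        case True
        define e where "e = ifloor t - (ifloor x - k0)"
        have "e \<in> icube 1"
          unfolding icube_def
        proof (intro CollectI allI)
          fix i
          have "k0 $ i = \<lfloor>x $ i - t $ i\<rfloor>" using True by (auto simp: ifloor_def)
          then show "\<bar>e $ i\<bar> \<le> int 1"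
            unfolding e_def ifloor_def by simp linarith
        qed
        then have "H t * indicator (?E (ifloor x - k0 + e)) t
            \<le> (\<Sum>e\<in>icube 1. H t * indicator (?E (ifloor x - k0 + e)) t)"
          by (intro member_le_sum) auto
        moreover have "H t * indicator (?E (ifloor x - k0 + e)) t = H t"
          by (simp add: e_def)
        ultimately show ?thesis using t True by (simp add: indicator_def)
      qed (simp add: indicator_def)
    qed
    also have "\<dots> = spread 1 Hc (ifloor x - k0)"
      unfolding spread_def Hc_def by (subst nn_integral_sum) auto
    finally have "ennreal (norm (g x)) * ?m k0 \<le> spread 1 Hc (ifloor x - k0)" .
    then have "ennreal (norm (g x)) * ?m k0 / ?m k0 \<le> spread 1 Hc (ifloor x - k0) / ?m k0"
      by (rule divide_right_mono_ennreal)
    also have "ennreal (norm (g x)) * ?m k0 / ?m k0 = ennreal (norm (g x))"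
      using k0 mfin by (simp add: ennreal_mult_divide_eq)
    finally show ?case by (simp add: c_def)
  qed
  with csum show ?thesis by blast
qed

text \<open>
  The characters enter twice. Inversion in the frequency variable gives \<open>g x * cnj (g (x - t))\<close> for
  almost all \<open>x\<close> and \<open>t\<close>. Integrating this against \<open>cis (2 * pi * ((x - t) \<bullet> \<xi>))\<close> over \<open>t\<close> replaces
  the second factor by the constant \<open>cnj (FT g \<xi>)\<close>, and the other side becomes an integral of
  functions continuous in \<open>x\<close> with an integrable bound independent of \<open>x\<close>.
\<close>

theorem S0_continuous_representative:
  fixes g :: "real^'d \<Rightarrow> complex"
  assumes g[measurable]: "g \<in> borel_measurable borel"
    and L2: "(\<integral>\<^sup>+x. ennreal ((norm (g x))\<^sup>2) \<partial>lborel) < \<infinity>"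
    and S0: "(\<integral>\<^sup>+t. (\<integral>\<^sup>+\<omega>. ennreal (norm (FT (\<lambda>x. g x * cnj (g (x - t))) \<omega>)) \<partial>lborel) \<partial>lborel) < \<infinity>"
  obtains g' C where "wiener_majorant g' C" "AE x in lborel. g x = g' x"
proof -
  define h where "h = (\<lambda>t x. g x * cnj (g (x - t)))"
  define V where "V = (\<lambda>t \<omega>. FT (h t) \<omega>)"
  define H where "H t = (\<integral>\<^sup>+\<omega>. ennreal (norm (V t \<omega>)) \<partial>lborel)" for t
  define K where "K = (\<lambda>t x. IFT (V t) x)"
  have [measurable]: "h t \<in> borel_measurable borel" for t
    unfolding h_def by measurable
  have Vm[measurable]: "(\<lambda>z. V (fst z) (snd z)) \<in> borel_measurable (borel \<Otimes>\<^sub>M borel)"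
    unfolding V_def FT_def h_def by measurable
  have [measurable]: "V t \<in> borel_measurable borel" for t
    unfolding V_def by measurable
  have [measurable]: "H \<in> borel_measurable borel"
    unfolding H_def by measurable
  have [measurable]: "(\<lambda>z. K (fst z) (snd z)) \<in> borel_measurable (borel \<Otimes>\<^sub>M borel)"
    unfolding K_def IFT_def V_def FT_def h_def by measurable
  have Km: "(\<lambda>z. K (snd z) (fst z)) \<in> borel_measurable (lborel \<Otimes>\<^sub>M lborel)"
    unfolding K_def IFT_def V_def FT_def h_def by measurable
  have hKm: "{z \<in> space (lborel \<Otimes>\<^sub>M lborel). h (snd z) (fst z) = K (snd z) (fst z)} \<in> sets (lborel \<Otimes>\<^sub>M lborel)"
    using Km unfolding h_def by measurable
  have [measurable]: "(\<lambda>t. K t x) \<in> borel_measurable borel" for x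
    unfolding K_def IFT_def V_def FT_def h_def by measurable
  have Hint: "(\<integral>\<^sup>+t. H t \<partial>lborel) < \<infinity>"
    using S0 by (simp add: H_def V_def h_def)
  have hint: "integrable lborel (h t)" for t
  proof (rule integrableI_bounded)
    have "(\<integral>\<^sup>+x. ennreal (norm (h t x)) \<partial>lborel) \<le> (\<integral>\<^sup>+x. ennreal ((norm (g x))\<^sup>2) + ennreal ((norm (g (x - t)))\<^sup>2) \<partial>lborel)"
    proof (intro nn_integral_mono)
      fix x
      have "2 * (norm (g x) * norm (g (x - t))) \<le> (norm (g x))\<^sup>2 + (norm (g (x - t)))\<^sup>2"
        using sum_squares_bound[of "norm (g x)" "norm (g (x - t))"] by simp
      moreover have "0 \<le> norm (g x) * norm (g (x - t))" by simp
      ultimately have "norm (g x) * norm (g (x - t)) \<le> (norm (g x))\<^sup>2 + (norm (g (x - t)))\<^sup>2"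
        by linarith
      then show "ennreal (norm (h t x)) \<le> ennreal ((norm (g x))\<^sup>2) + ennreal ((norm (g (x - t)))\<^sup>2)"
        by (simp add: h_def norm_mult flip: ennreal_plus)
    qed
    also have "\<dots> = (\<integral>\<^sup>+x. ennreal ((norm (g x))\<^sup>2) \<partial>lborel) + (\<integral>\<^sup>+x. ennreal ((norm (g (x - t)))\<^sup>2) \<partial>lborel)"
      by (rule nn_integral_add) auto
    also have "(\<integral>\<^sup>+x. ennreal ((norm (g (x - t)))\<^sup>2) \<partial>lborel) = (\<integral>\<^sup>+x. ennreal ((norm (g x))\<^sup>2) \<partial>lborel)"
      by (rule nn_integral_lborel_translate[of "\<lambda>x. ennreal ((norm (g x))\<^sup>2)"]) auto
    finally show "(\<integral>\<^sup>+x. ennreal (norm (h t x)) \<partial>lborel) < \<infinity>"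
      using L2 by (simp add: less_top[symmetric] top_unique) (metis ennreal_add_eq_top top.not_eq_extremum top_unique)
  qed simp
  have "AE t in lborel. H t \<noteq> \<infinity>"
    using Hint by (intro nn_integral_PInf_AE) auto
  then have "AE t in lborel. AE x in lborel. h t x = K t x"
  proof eventually_elim
    case (elim t)
    then have "integrable lborel (V t)"
      by (intro integrableI_bounded) (auto simp: H_def less_top)
    then show ?case
      unfolding V_def K_def by (intro Fourier_inversion hint)
  qed
  then have hK: "AE x in lborel. AE t in lborel. h t x = K t x"
    using hKm by (subst lborel_pair.AE_commute) auto
  have "AE x in lborel. AE t in lborel. ennreal (norm (g x) * norm (g (x - t))) \<le> H t"
    using hK
  proof eventually_elim
    case (elim x)
    then show ?case
    proof eventually_elim
      case (elim t)
      have "norm (g x) * norm (g (x - t)) = norm (K t x)"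
        unfolding elim[symmetric] h_def by (simp add: norm_mult)
      then show ?case unfolding K_def H_def using norm_IFT_le[of "V t" x] by simp
    qed
  qed
  then obtain c where c: "(\<integral>\<^sup>+k. c k \<partial>count_space UNIV) < \<infinity>" "AE x in lborel. ennreal (norm (g x)) \<le> c (ifloor x)"
    using S0_AE_majorant[of g H] Hint by auto
  have gint: "integrable lborel g"
  proof (rule integrableI_bounded)
    have "(\<integral>\<^sup>+x. ennreal (norm (g x)) \<partial>lborel) \<le> (\<integral>\<^sup>+x. c (ifloor x) \<partial>lborel)"
      by (intro nn_integral_mono_AE c)
    also have "\<dots> < \<infinity>" using c by (simp add: nn_integral_ifloor)
    finally show "(\<integral>\<^sup>+x. ennreal (norm (g x)) \<partial>lborel) < \<infinity>" .
  qed simp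
  have "\<exists>g'. continuous_on UNIV g' \<and> (AE x in lborel. g x = g' x)"
  \<comment> \<open>a vanishing transform forces g to vanish almost everywhere, again by inversion\<close>
  proof (cases "\<forall>\<xi>. FT g \<xi> = 0")
    case True
    then have FT0: "FT g = (\<lambda>_. 0)" by auto
    have "AE x in lborel. g x = IFT (FT g) x"
      by (rule Fourier_inversion[OF gint]) (simp add: FT0)
    then have "AE x in lborel. g x = 0" by (simp add: FT0 IFT_def)
    then show ?thesis by (intro exI[of _ "\<lambda>_. 0"]) auto
  next
    case False
    then obtain \<xi> where \<xi>: "FT g \<xi> \<noteq> 0" by auto
    define F where "F x z = V (fst z) (snd z) * cis (2 * pi * (x \<bullet> snd z)) * cis (2 * pi * ((x - fst z) \<bullet> \<xi>))" for x z
    have nF: "norm (F x z) = norm (V (fst z) (snd z))" for x z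
      by (simp add: F_def norm_mult)
    have [measurable]: "F x \<in> borel_measurable (borel \<Otimes>\<^sub>M borel)" for x
      unfolding F_def by measurable
    have Vint: "integrable (lborel \<Otimes>\<^sub>M lborel) (\<lambda>z. V (fst z) (snd z))"
    proof (rule integrableI_bounded)
      have "(\<integral>\<^sup>+z. ennreal (norm (V (fst z) (snd z))) \<partial>(lborel \<Otimes>\<^sub>M lborel)) = (\<integral>\<^sup>+t. H t \<partial>lborel)"
        unfolding H_def by (subst lborel.nn_integral_fst[symmetric]) auto
      then show "(\<integral>\<^sup>+z. ennreal (norm (V (fst z) (snd z))) \<partial>(lborel \<Otimes>\<^sub>M lborel)) < \<infinity>"
        using Hint by simp
    qed simp
    have Fint: "integrable (lborel \<Otimes>\<^sub>M lborel) (F x)" for x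
      by (rule Bochner_Integration.integrable_bound[OF Vint]) (auto simp: nF)
    define G where "G x = (LINT z|(lborel \<Otimes>\<^sub>M lborel). F x z)" for x
    have "continuous_on UNIV G"
      unfolding G_def
    proof (rule continuous_on_integral_dominated)
      show "integrable (lborel \<Otimes>\<^sub>M lborel) (\<lambda>z. norm (V (fst z) (snd z)))" using Vint by simp
      show "continuous_on UNIV (\<lambda>x. F x z)" for z
        unfolding F_def cis_conv_exp by (intro continuous_intros)
    qed (auto simp: nF)
    moreover have "AE x in lborel. g x = G x / cnj (FT g \<xi>)"
      using hK
    proof eventually_elim
      case (elim x)
      have "G x = (LINT t|lborel. (LINT \<omega>|lborel. F x (t, \<omega>)))"
        unfolding G_def by (rule lborel_pair.integral_fst'[OF Fint, symmetric])
      also have "\<dots> = (LINT t|lborel. K t x * cis (2 * pi * ((x - t) \<bullet> \<xi>)))"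
        unfolding F_def K_def IFT_def by simp
      also have "\<dots> = (LINT t|lborel. h t x * cis (2 * pi * ((x - t) \<bullet> \<xi>)))"
        by (rule integral_cong_AE) (use elim in \<open>auto simp: h_def\<close>)
      also have "\<dots> = g x * (LINT t|lborel. cnj (g (x - t) * cis (- (2 * pi * ((x - t) \<bullet> \<xi>)))))"
        unfolding h_def by (simp add: mult.assoc cis_cnj)
      also have "(LINT t|lborel. cnj (g (x - t) * cis (- (2 * pi * ((x - t) \<bullet> \<xi>)))))
          = (LINT y|lborel. cnj (g y * cis (- (2 * pi * (y \<bullet> \<xi>)))))"
        using lborel_integral_affine[of "\<lambda>y. cnj (g y * cis (- (2 * pi * (y \<bullet> \<xi>))))" "-1" x] by simp
      also have "\<dots> = cnj (FT g \<xi>)"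
        unfolding FT_def by (rule Bochner_Integration.integral_cnj)
      finally show ?case using \<xi> by simp
    qed
    ultimately show ?thesis
      using \<xi> by (intro exI[of _ "\<lambda>x. G x / cnj (FT g \<xi>)"]) (auto intro!: continuous_intros)
  qed
  then obtain g' where g': "continuous_on UNIV g'" "AE x in lborel. g x = g' x" by blast
  have "AE x in lborel. ennreal (norm (g' x)) \<le> c (ifloor x)"
    using c(2) g'(2) by eventually_elim simp
  then show ?thesis
    using wiener_majorant_from_AE[OF g'(1) c(1)] g'(2) that by blast
qed

section \<open>Amalgam norms\<close>

lemma ennreal_inverse_self: "x \<noteq> 0 \<Longrightarrow> x \<noteq> top \<Longrightarrow> inverse x * (x :: ennreal) = 1"
  by (cases x) (auto simp: inverse_ennreal ennreal_mult[symmetric])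

lemma epow_ennreal: "0 \<le> a \<Longrightarrow> epow (ennreal a) r = ennreal (a powr r)"
  by (simp add: epow_def)

lemma epow_top [simp]: "epow \<infinity> r = \<infinity>" "epow top r = top"
  by (simp_all add: epow_def)

lemma epow_0 [simp]: "epow 0 r = 0"
  by (simp add: epow_def)

lemma epow_mono: "0 \<le> r \<Longrightarrow> x \<le> y \<Longrightarrow> epow x r \<le> epow y r"
  by (cases x; cases y) (auto simp: epow_ennreal powr_mono2 top_unique)

lemma epow_mult: "epow (x * y) r = epow x r * epow y r"
  by (cases x; cases y)
    (auto simp: epow_ennreal powr_mult ennreal_mult[symmetric] ennreal_mult_top ennreal_top_mult epow_def[of 0] split: if_splits)

lemma epow_epow_inverse: "r > 0 \<Longrightarrow> epow (epow x r) (1 / r) = x" "r > 0 \<Longrightarrow> epow (epow x (1 / r)) r = x"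
  by (cases x; simp add: epow_ennreal powr_powr)+

lemma epow_eq_0_iff [simp]: "epow x r = 0 \<longleftrightarrow> x = 0"
  by (cases x) (auto simp: epow_ennreal)

lemma epow_eq_top_iff [simp]: "epow x r = top \<longleftrightarrow> x = top"
  by (cases x) (auto simp: epow_ennreal)

lemma epow_measurable [measurable]: "(\<lambda>x. epow x r) \<in> borel_measurable borel"
  unfolding epow_def by measurable

text \<open>
  The graph of \<open>t powr r\<close> lies above its tangent at \<open>m\<close>.
\<close>

lemma Young_tangent:
  fixes m t r :: real
  assumes "0 \<le> m" "0 \<le> t" "1 \<le> r"
  shows "r * m powr (r - 1) * t \<le> t powr r + (r - 1) * m powr r"
proof (cases "m = 0 \<or> t = 0")
  case False
  then have pos: "m > 0" "t > 0" using assms by auto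
  have "(t powr r) powr (1 / r) * (m powr r) powr (1 - 1 / r) \<le> (1 / r) * t powr r + (1 - 1 / r) * m powr r"
    using pos assms by (intro Youngs_inequality_0) auto
  moreover have "r * (1 - 1 / r) = r - 1" using assms by (simp add: field_simps)
  ultimately have "t * m powr (r - 1) \<le> (1 / r) * t powr r + (1 - 1 / r) * m powr r"
    using pos assms by (simp add: powr_powr)
  then have "r * (t * m powr (r - 1)) \<le> r * ((1 / r) * t powr r + (1 - 1 / r) * m powr r)"
    using assms by (intro mult_left_mono) auto
  also have "\<dots> = t powr r + (r * (1 - 1 / r)) * m powr r"
    using assms by (simp add: algebra_simps)
  also have "r * (1 - 1 / r) = r - 1" by fact
  finally show ?thesis by (simp add: mult_ac)
qed (use assms in auto)

lemma Young_tangent_ennreal: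
  assumes "0 \<le> m" "1 \<le> r"
  shows "ennreal (r * m powr (r - 1)) * v \<le> epow v r + ennreal ((r - 1) * m powr r)"
proof (cases v)
  case (real t)
  then show ?thesis
    using Young_tangent[of m t r] assms
    by (simp add: epow_ennreal ennreal_mult[symmetric] flip: ennreal_plus)
qed simp

text \<open>
  Jensen's inequality for the convex function \<open>t powr r\<close> and countable weights: integrate the tangent
  inequality at the mean \<open>m\<close>. If the mean is infinite, the tangent at \<open>1\<close> shows that the right-hand
  side is infinite as well.
\<close>

lemma epow_weighted_mean_le:
  assumes r: "1 \<le> r" and w: "(\<integral>\<^sup>+i. w i \<partial>count_space UNIV) \<le> 1"
  shows "epow (\<integral>\<^sup>+i. w i * v i \<partial>count_space UNIV) r \<le> (\<integral>\<^sup>+i. w i * epow (v i) r \<partial>count_space UNIV)"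
proof -
  let ?M = "\<integral>\<^sup>+i. w i * v i \<partial>count_space UNIV" and ?R = "\<integral>\<^sup>+i. w i * epow (v i) r \<partial>count_space UNIV"
  have key: "ennreal (r * m powr (r - 1)) * ?M \<le> ?R + ennreal ((r - 1) * m powr r)" if m: "0 \<le> m" for m
  proof -
    have "ennreal (r * m powr (r - 1)) * ?M = (\<integral>\<^sup>+i. w i * (ennreal (r * m powr (r - 1)) * v i) \<partial>count_space UNIV)"
      by (subst nn_integral_cmult[symmetric]) (auto simp: mult_ac)
    also have "\<dots> \<le> (\<integral>\<^sup>+i. w i * epow (v i) r + w i * ennreal ((r - 1) * m powr r) \<partial>count_space UNIV)"
      unfolding distrib_left[symmetric]
      by (intro nn_integral_mono mult_left_mono Young_tangent_ennreal m r) simp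
    also have "\<dots> = ?R + (\<integral>\<^sup>+i. w i \<partial>count_space UNIV) * ennreal ((r - 1) * m powr r)"
      by (simp add: nn_integral_add nn_integral_multc)
    also have "\<dots> \<le> ?R + 1 * ennreal ((r - 1) * m powr r)"
      by (intro add_left_mono mult_right_mono w) simp
    finally show ?thesis by simp
  qed
  show ?thesis
  proof (cases ?M)
    case (real m)
    have "ennreal (r * m powr (r - 1)) * ?M = ennreal (r * (m powr (r - 1) * m))"
      using real r by (simp add: ennreal_mult[symmetric] mult.assoc)
    also have "m powr (r - 1) * m = m powr r"
      using real powr_add[of m "r - 1" 1] by (cases "m = 0") auto
    also have "r * m powr r = m powr r + (r - 1) * m powr r" by (simp add: algebra_simps)
    also have "ennreal \<dots> = ennreal (m powr r) + ennreal ((r - 1) * m powr r)"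
      using r by (intro ennreal_plus) auto
    finally have "ennreal (m powr r) + ennreal ((r - 1) * m powr r) \<le> ?R + ennreal ((r - 1) * m powr r)"
      using key[of m] real by simp
    then show ?thesis
      using real by (simp add: epow_ennreal add.commute[of _ "ennreal ((r - 1) * m powr r)"] ennreal_add_left_cancel_le)
  next
    case top
    then have "?R + ennreal (r - 1) = top"
      using key[of 1] r by (simp add: ennreal_mult_top top_unique)
    then show ?thesis by simp
  qed
qed

lemma case_prod_countable_measurable:
  fixes f :: "'i::countable \<Rightarrow> 'a \<Rightarrow> 'b"
  assumes [measurable]: "\<And>i. f i \<in> M \<rightarrow>\<^sub>M N"
  shows "(\<lambda>(x, i). f i x) \<in> M \<Otimes>\<^sub>M count_space UNIV \<rightarrow>\<^sub>M N"
proof -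
  have "(\<lambda>z. f (snd z) (fst z)) \<in> M \<Otimes>\<^sub>M count_space UNIV \<rightarrow>\<^sub>M N"
    by (rule measurable_compose_countable[of "\<lambda>i z. f i (fst z)"]) measurable
  then show ?thesis by (simp add: case_prod_beta')
qed

lemma nn_integral_countable_measurable:
  fixes u :: "'i::countable \<Rightarrow> 'a \<Rightarrow> ennreal"
  assumes "\<And>i. u i \<in> borel_measurable M"
  shows "(\<lambda>x. \<integral>\<^sup>+i. u i x \<partial>count_space UNIV) \<in> borel_measurable M"
proof -
  interpret sigma_finite_measure "count_space (UNIV :: 'i set)"
    by (rule sigma_finite_measure_count_space_countable) simp
  show ?thesis
    by (rule borel_measurable_nn_integral) (rule case_prod_countable_measurable[OF assms])
qed

lemma integral_countable_measurable:
  fixes u :: "'i::countable \<Rightarrow> 'a \<Rightarrow> complex"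
  assumes "\<And>i. u i \<in> borel_measurable M"
  shows "(\<lambda>x. LINT i|count_space UNIV. u i x) \<in> borel_measurable M"
proof -
  interpret sigma_finite_measure "count_space (UNIV :: 'i set)"
    by (rule sigma_finite_measure_count_space_countable) simp
  show ?thesis
    by (rule borel_measurable_lebesgue_integral) (rule case_prod_countable_measurable[OF assms])
qed

text \<open>
  The \<open>L\<^sup>r\<close> norm of an extended nonnegative function on an arbitrary measure space; with Lebesgue
  measure and with counting measure it gives both layers of the amalgam norm.
\<close>

definition enorm :: "'a measure \<Rightarrow> real \<Rightarrow> ('a \<Rightarrow> ennreal) \<Rightarrow> ennreal" where
  "enorm M r u = epow (\<integral>\<^sup>+x. epow (u x) r \<partial>M) (1 / r)"

lemma epow_enorm: "r > 0 \<Longrightarrow> epow (enorm M r u) r = (\<integral>\<^sup>+x. epow (u x) r \<partial>M)"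
  by (simp add: enorm_def epow_epow_inverse)

lemma enorm_le_iff:
  assumes "r > 0"
  shows "enorm M r u \<le> a \<longleftrightarrow> (\<integral>\<^sup>+x. epow (u x) r \<partial>M) \<le> epow a r"
  using epow_mono[of r "enorm M r u" a] epow_mono[of "1 / r" "\<integral>\<^sup>+x. epow (u x) r \<partial>M" "epow a r"] assms
  by (auto simp: epow_enorm epow_epow_inverse enorm_def)

lemma enorm_mono_AE:
  assumes "r > 0" "AE x in M. u x \<le> v x"
  shows "enorm M r u \<le> enorm M r v"
  unfolding enorm_def using assms by (intro epow_mono nn_integral_mono_AE) (auto intro: epow_mono elim!: eventually_mono)

lemma enorm_cmult:
  assumes "r > 0" and [measurable]: "u \<in> borel_measurable M"
  shows "enorm M r (\<lambda>x. c * u x) = c * enorm M r u"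
  using assms by (simp add: enorm_def epow_mult nn_integral_cmult epow_epow_inverse)

text \<open>
  Minkowski's inequality for countable sums. With \<open>S\<close> the sum of the norms, \<open>(\<Sum> u i) / S\<close> is the
  average of the normalised functions \<open>u i / \<parallel>u i\<parallel>\<close> with weights \<open>\<parallel>u i\<parallel> / S\<close>, and Jensen's inequality
  applies pointwise.
\<close>

theorem enorm_suminf_le:
  fixes u :: "'i::countable \<Rightarrow> 'a \<Rightarrow> ennreal"
  assumes r: "1 \<le> r" and [measurable]: "\<And>i. u i \<in> borel_measurable M"
  shows "enorm M r (\<lambda>x. \<integral>\<^sup>+i. u i x \<partial>count_space UNIV) \<le> (\<integral>\<^sup>+i. enorm M r (u i) \<partial>count_space UNIV)"
proof -
  let ?A = "\<lambda>i. enorm M r (u i)"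
  define S where "S = (\<integral>\<^sup>+i. ?A i \<partial>count_space UNIV)"
  have r0: "r > 0" using r by simp
  \<comment> \<open>terms of norm zero cannot be normalised, but they vanish almost everywhere\<close>
  have z: "AE x in M. \<forall>i. ?A i = 0 \<longrightarrow> u i x = 0"
    unfolding AE_all_countable
  proof
    fix i
    show "AE x in M. ?A i = 0 \<longrightarrow> u i x = 0"
    proof (cases "?A i = 0")
      case True
      then have "(\<integral>\<^sup>+x. epow (u i x) r \<partial>M) = 0" by (simp add: enorm_def)
      then have "AE x in M. epow (u i x) r = 0"
        by (subst (asm) nn_integral_0_iff_AE) auto
      then show ?thesis by eventually_elim simp
    qed simp
  qed
  show ?thesis
  proof (cases "S = 0 \<or> S = top")
    case True
    then show ?thesis
    proof
      assume "S = 0"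
      then have "\<forall>i. ?A i = 0" unfolding S_def by (subst (asm) nn_integral_0_iff_AE) (auto simp: AE_count_space)
      with z have "AE x in M. (\<integral>\<^sup>+i. u i x \<partial>count_space UNIV) \<le> 0"
        by (auto elim!: eventually_mono)
      then have "enorm M r (\<lambda>x. \<integral>\<^sup>+i. u i x \<partial>count_space UNIV) \<le> enorm M r (\<lambda>_. 0)"
        by (rule enorm_mono_AE[OF r0])
      then show ?thesis by (simp add: enorm_def)
    qed (simp add: S_def[symmetric])
  next
    case False
    then have S: "S \<noteq> 0" "S \<noteq> top" by auto
    have Afin: "?A i \<noteq> top" for i
    proof -
      have "?A i \<le> S" unfolding S_def by (intro nn_integral_ge_point) simp
      with S show ?thesis by (auto simp: top_unique)
    qed
    have iS: "inverse S * S = 1" using S by (simp add: ennreal_inverse_self)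
    define w where "w i = inverse S * ?A i" for i
    have w1: "(\<integral>\<^sup>+i. w i \<partial>count_space UNIV) = 1"
      unfolding w_def by (subst nn_integral_cmult) (auto simp: S_def[symmetric] iS)
    let ?v = "\<lambda>i x. inverse (?A i) * u i x"
    have "(\<integral>\<^sup>+x. epow (inverse S * (\<integral>\<^sup>+i. u i x \<partial>count_space UNIV)) r \<partial>M)
        \<le> (\<integral>\<^sup>+x. (\<integral>\<^sup>+i. w i * epow (?v i x) r \<partial>count_space UNIV) \<partial>M)"
    proof (rule nn_integral_mono_AE, use z in eventually_elim)
      fix x assume x: "\<forall>i. ?A i = 0 \<longrightarrow> u i x = 0"
      have "?A i * ?v i x = u i x" for i
      proof (cases "?A i = 0")
        case False
        then have "?A i * inverse (?A i) = 1"
          using Afin[of i] by (subst mult.commute) (simp add: ennreal_inverse_self)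
        then show ?thesis by (simp add: mult.assoc[symmetric])
      qed (use x in simp)
      then have "inverse S * (\<integral>\<^sup>+i. u i x \<partial>count_space UNIV) = (\<integral>\<^sup>+i. w i * ?v i x \<partial>count_space UNIV)"
        unfolding w_def by (simp add: mult.assoc nn_integral_cmult)
      then show "epow (inverse S * (\<integral>\<^sup>+i. u i x \<partial>count_space UNIV)) r \<le> (\<integral>\<^sup>+i. w i * epow (?v i x) r \<partial>count_space UNIV)"
        using epow_weighted_mean_le[OF r, of w "\<lambda>i. ?v i x"] w1 by simp
    qed
    also have "\<dots> = (\<integral>\<^sup>+i. w i * (\<integral>\<^sup>+x. epow (?v i x) r \<partial>M) \<partial>count_space UNIV)"
      by (subst nn_integral_count_space_nn_integral) (auto simp: nn_integral_cmult)
    also have "\<dots> \<le> (\<integral>\<^sup>+i. w i * 1 \<partial>count_space UNIV)"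
    proof (intro nn_integral_mono mult_left_mono)
      fix i
      have "(\<integral>\<^sup>+x. epow (?v i x) r \<partial>M) = epow (inverse (?A i) * ?A i) r"
        using r0 by (simp add: epow_mult nn_integral_cmult epow_enorm)
      also have "\<dots> \<le> epow 1 r"
      proof (rule epow_mono)
        show "inverse (?A i) * ?A i \<le> 1"
        proof (cases "?A i = 0")
          case False
          then show ?thesis
            using Afin[of i] by (simp add: ennreal_inverse_self)
        qed simp
      qed (use r in simp)
      also have "epow 1 r = 1" using epow_ennreal[of 1 r] by simp
      finally show "(\<integral>\<^sup>+x. epow (?v i x) r \<partial>M) \<le> 1" .
    qed simp
    also have "\<dots> = 1" using w1 by simp
    finally have "(\<integral>\<^sup>+x. epow (inverse S * (\<integral>\<^sup>+i. u i x \<partial>count_space UNIV)) r \<partial>M) \<le> epow 1 r"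
      using epow_ennreal[of 1 r] by simp
    then have "enorm M r (\<lambda>x. inverse S * (\<integral>\<^sup>+i. u i x \<partial>count_space UNIV)) \<le> 1"
      using r0 by (simp add: enorm_le_iff)
    moreover have "(\<lambda>x. \<integral>\<^sup>+i. u i x \<partial>count_space UNIV) \<in> borel_measurable M"
      by (rule nn_integral_countable_measurable) simp
    ultimately have "inverse S * enorm M r (\<lambda>x. \<integral>\<^sup>+i. u i x \<partial>count_space UNIV) \<le> 1"
      using r0 by (simp add: enorm_cmult)
    then have "S * (inverse S * enorm M r (\<lambda>x. \<integral>\<^sup>+i. u i x \<partial>count_space UNIV)) \<le> S * 1"
      by (rule mult_left_mono) simp
    then show ?thesis
      unfolding mult.assoc[symmetric] mult.commute[of S "inverse S"] iS by (simp add: S_def)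
  qed
qed

definition qnorm :: "ennreal \<Rightarrow> (int^'d \<Rightarrow> ennreal) \<Rightarrow> ennreal" where
  "qnorm q c = (if q = \<infinity> then (SUP k. c k) else enorm (count_space UNIV) (enn2real q) c)"

lemma enn2real_ge_1: "1 \<le> q \<Longrightarrow> q \<noteq> \<infinity> \<Longrightarrow> 1 \<le> enn2real q"
  by (cases q) (auto simp flip: ennreal_1)

lemma qnorm_mono: "1 \<le> q \<Longrightarrow> (\<And>k. c k \<le> c' k) \<Longrightarrow> qnorm q c \<le> qnorm q c'"
  unfolding qnorm_def using enn2real_ge_1[of q] by (auto intro!: SUP_mono' enorm_mono_AE)

lemma qnorm_cmult: "1 \<le> q \<Longrightarrow> qnorm q (\<lambda>k. a * c k) = a * qnorm q c"
  unfolding qnorm_def using enn2real_ge_1[of q] by (auto simp: enorm_cmult SUP_mult_left_ennreal)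

lemma qnorm_suminf_le:
  fixes c :: "'i::countable \<Rightarrow> int^'d \<Rightarrow> ennreal"
  assumes "1 \<le> q"
  shows "qnorm q (\<lambda>k. \<integral>\<^sup>+i. c i k \<partial>count_space UNIV) \<le> (\<integral>\<^sup>+i. qnorm q (c i) \<partial>count_space UNIV)"
proof (cases "q = \<infinity>")
  case True
  have "(\<integral>\<^sup>+i. c i k \<partial>count_space UNIV) \<le> (\<integral>\<^sup>+i. (SUP k. c i k) \<partial>count_space UNIV)" for k
    by (intro nn_integral_mono SUP_upper) simp
  then show ?thesis unfolding qnorm_def using True by (auto intro!: SUP_least)
qed (use enn2real_ge_1[of q] assms in \<open>auto simp: qnorm_def intro!: enorm_suminf_le\<close>)

lemma qnorm_shift: "qnorm q (\<lambda>k. c (k + e)) = qnorm q c"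
proof -
  have "(SUP k. c (k + e)) = (SUP k. c k)"
  proof (intro SUP_eq)
    show "\<exists>j\<in>UNIV. c i \<le> c (j + e)" for i by (rule bexI[of _ "i - e"]) auto
  qed auto
  then show ?thesis
    unfolding qnorm_def enorm_def by (simp add: nn_integral_count_space_shift[of "\<lambda>k. epow (c k) (enn2real q)"])
qed

definition cell_norm :: "real \<Rightarrow> (real^'d \<Rightarrow> ennreal) \<Rightarrow> int^'d \<Rightarrow> ennreal" where
  "cell_norm p u k = enorm lborel p (\<lambda>x. u x * indicator {x. ifloor x = k} x)"

text \<open>
  The norm of \<open>W(L\<^sup>p, \<ell>\<^sup>q)\<close> as a functional on extended nonnegative functions. This lets dominating
  series enter the estimates before their convergence is known.
\<close>

definition amalgam :: "real \<Rightarrow> ennreal \<Rightarrow> (real^'d \<Rightarrow> ennreal) \<Rightarrow> ennreal" where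
  "amalgam p q u = qnorm q (cell_norm p u)"

lemma amalgam_mono_AE:
  assumes "1 \<le> p" "1 \<le> q" "AE x in lborel. u x \<le> v x"
  shows "amalgam p q u \<le> amalgam p q v"
  unfolding amalgam_def cell_norm_def using assms
  by (intro qnorm_mono enorm_mono_AE) (auto elim!: eventually_mono intro!: mult_right_mono)

lemma amalgam_cmult:
  assumes "1 \<le> p" "1 \<le> q" and [measurable]: "u \<in> borel_measurable borel"
  shows "amalgam p q (\<lambda>x. c * u x) = c * amalgam p q u"
proof -
  have "cell_norm p (\<lambda>x. c * u x) = (\<lambda>k. c * cell_norm p u k)"
    unfolding cell_norm_def using assms by (subst enorm_cmult[symmetric]) (auto simp: mult_ac)
  then show ?thesis unfolding amalgam_def using assms by (simp add: qnorm_cmult)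
qed

lemma amalgam_suminf_le:
  fixes u :: "'i::countable \<Rightarrow> real^'d \<Rightarrow> ennreal"
  assumes pq: "1 \<le> p" "1 \<le> q" and [measurable]: "\<And>i. u i \<in> borel_measurable borel"
  shows "amalgam p q (\<lambda>x. \<integral>\<^sup>+i. u i x \<partial>count_space UNIV) \<le> (\<integral>\<^sup>+i. amalgam p q (u i) \<partial>count_space UNIV)"
proof -
  have "cell_norm p (\<lambda>x. \<integral>\<^sup>+i. u i x \<partial>count_space UNIV) k \<le> (\<integral>\<^sup>+i. cell_norm p (u i) k \<partial>count_space UNIV)" for k
  proof -
    have "cell_norm p (\<lambda>x. \<integral>\<^sup>+i. u i x \<partial>count_space UNIV) k
        = enorm lborel p (\<lambda>x. \<integral>\<^sup>+i. u i x * indicator {x. ifloor x = k} x \<partial>count_space UNIV)"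
      unfolding cell_norm_def by (subst nn_integral_multc) auto
    also have "\<dots> \<le> (\<integral>\<^sup>+i. cell_norm p (u i) k \<partial>count_space UNIV)"
      unfolding cell_norm_def using pq by (intro enorm_suminf_le) auto
    finally show ?thesis .
  qed
  then have "amalgam p q (\<lambda>x. \<integral>\<^sup>+i. u i x \<partial>count_space UNIV) \<le> qnorm q (\<lambda>k. \<integral>\<^sup>+i. cell_norm p (u i) k \<partial>count_space UNIV)"
    unfolding amalgam_def using pq by (intro qnorm_mono)
  also have "\<dots> \<le> (\<integral>\<^sup>+i. amalgam p q (u i) \<partial>count_space UNIV)"
    unfolding amalgam_def by (intro qnorm_suminf_le pq)
  finally show ?thesis .
qed

lemma amalgam_add_le:
  assumes pq: "1 \<le> p" "1 \<le> q" and [measurable]: "u \<in> borel_measurable borel" "v \<in> borel_measurable borel"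
  shows "amalgam p q (\<lambda>x. u x + v x) \<le> amalgam p q u + amalgam p q v"
proof -
  have "amalgam p q (\<lambda>x. \<integral>\<^sup>+b. (if b then u x else v x) \<partial>count_space UNIV)
      \<le> (\<integral>\<^sup>+b. amalgam p q (\<lambda>x. if b then u x else v x) \<partial>count_space UNIV)"
    by (intro amalgam_suminf_le pq) auto
  then show ?thesis by (simp add: nn_integral_count_space_finite UNIV_bool add.commute add.commute[of "amalgam p q v"])
qed

text \<open>
  A translated cell meets at most \<open>card (icube 1)\<close> cells, and shifting the index of the cells does not
  change the outer norm.
\<close>

lemma amalgam_translate_le:
  fixes u :: "real^'d \<Rightarrow> ennreal"
  assumes pq: "1 \<le> p" "1 \<le> q" and [measurable]: "u \<in> borel_measurable borel"
  shows "amalgam p q (\<lambda>x. u (x - y)) \<le> of_nat (card (icube 1 :: (int^'d) set)) * amalgam p q u"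
proof -
  let ?E = "\<lambda>k. {x. ifloor x = (k :: int^'d)}"
  define v where "v e k = cell_norm p u (k + (e - ifloor y))" for e k
  have "cell_norm p (\<lambda>x. u (x - y)) k \<le> (\<integral>\<^sup>+e. indicator (icube 1) e * v e k \<partial>count_space UNIV)" for k
  proof -
    have "(\<integral>\<^sup>+x. epow (u (x - y) * indicator (?E k) x) p \<partial>lborel)
        = (\<integral>\<^sup>+z. epow (u z * indicator (?E k) (z + y)) p \<partial>lborel)"
      using nn_integral_lborel_translate[of "\<lambda>z. epow (u z * indicator (?E k) (z + y)) p" y] by simp
    then have "cell_norm p (\<lambda>x. u (x - y)) k = enorm lborel p (\<lambda>z. u z * indicator (?E k) (z + y))"
      by (simp add: cell_norm_def enorm_def)
    also have "\<dots> \<le> enorm lborel p (\<lambda>z. \<integral>\<^sup>+e. indicator (icube 1) e * (u z * indicator (?E (k + (e - ifloor y))) z) \<partial>count_space UNIV)"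
    proof (intro enorm_mono_AE AE_I2)
      fix z
      show "u z * indicator (?E k) (z + y) \<le> (\<integral>\<^sup>+e. indicator (icube 1) e * (u z * indicator (?E (k + (e - ifloor y))) z) \<partial>count_space UNIV)"
      proof (cases "ifloor (z + y) = k")
        case True
        \<comment> \<open>taking integer parts is additive up to a carry of 1 in each coordinate\<close>
        define e where "e = ifloor z - k + ifloor y"
        have "e \<in> icube 1"
          unfolding icube_def
        proof (intro CollectI allI)
          fix i
          have "k $ i = \<lfloor>z $ i + y $ i\<rfloor>" using True by (auto simp: ifloor_def)
          then show "\<bar>e $ i\<bar> \<le> int 1"
            unfolding e_def ifloor_def by simp linarith
        qed
        then have "u z * indicator (?E k) (z + y) \<le> indicator (icube 1) e * (u z * indicator (?E (k + (e - ifloor y))) z)"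
          by (simp add: e_def indicator_def)
        also have "\<dots> \<le> (\<integral>\<^sup>+e. indicator (icube 1) e * (u z * indicator (?E (k + (e - ifloor y))) z) \<partial>count_space UNIV)"
          by (rule nn_integral_ge_point) simp
        finally show ?thesis .
      qed simp
    qed (use pq in simp)
    also have "\<dots> \<le> (\<integral>\<^sup>+e. enorm lborel p (\<lambda>z. indicator (icube 1) e * (u z * indicator (?E (k + (e - ifloor y))) z)) \<partial>count_space UNIV)"
      using pq by (intro enorm_suminf_le) auto
    also have "\<dots> = (\<integral>\<^sup>+e. indicator (icube 1) e * v e k \<partial>count_space UNIV)"
      using pq by (simp add: enorm_cmult v_def cell_norm_def)
    finally show ?thesis .
  qed
  then have "amalgam p q (\<lambda>x. u (x - y)) \<le> qnorm q (\<lambda>k. \<integral>\<^sup>+e. indicator (icube 1) e * v e k \<partial>count_space UNIV)"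
    unfolding amalgam_def by (intro qnorm_mono pq)
  also have "\<dots> \<le> (\<integral>\<^sup>+e. qnorm q (\<lambda>k. indicator (icube 1) e * v e k) \<partial>count_space UNIV)"
    by (intro qnorm_suminf_le pq)
  also have "\<dots> = (\<integral>\<^sup>+e. amalgam p q u * indicator (icube 1 :: (int^'d) set) e \<partial>count_space UNIV)"
    using pq by (simp add: qnorm_cmult v_def qnorm_shift amalgam_def mult.commute)
  also have "\<dots> = of_nat (card (icube 1 :: (int^'d) set)) * amalgam p q u"
    by (simp add: nn_integral_cmult mult.commute)
  finally show ?thesis .
qed

lemma infsum_ennreal_eq_nn_integral:
  fixes f :: "'i::countable \<Rightarrow> ennreal"
  shows "infsum f UNIV = (\<integral>\<^sup>+i. f i \<partial>count_space UNIV)"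
proof (rule antisym)
  have fin: "sum f F = (\<integral>\<^sup>+i. f i * indicator F i \<partial>count_space UNIV)" if "finite F" for F
    using that by (subst nn_integral_count_space_indicator[symmetric]) (auto simp: nn_integral_count_space_finite)
  have eq: "infsum f UNIV = (SUP F\<in>{F. finite F \<and> F \<subseteq> UNIV}. sum f F)"
    by (rule nonneg_infsum_complete) simp
  show "infsum f UNIV \<le> (\<integral>\<^sup>+i. f i \<partial>count_space UNIV)"
    unfolding eq by (intro SUP_least) (auto simp: fin indicator_def intro!: nn_integral_mono)
  let ?F = "\<lambda>n. {i :: 'i. to_nat i < n}"
  have finF: "finite (?F n)" for n
    by (rule inj_on_finite[of to_nat _ "{..<n}"]) auto
  have "(\<integral>\<^sup>+i. f i \<partial>count_space UNIV) = (\<integral>\<^sup>+i. (SUP n. f i * indicator (?F n) i) \<partial>count_space UNIV)"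
  proof (intro nn_integral_cong antisym)
    fix i
    have "f i * indicator (?F (Suc (to_nat i))) i \<le> (SUP n. f i * indicator (?F n) i)"
      by (rule SUP_upper) simp
    then show "f i \<le> (SUP n. f i * indicator (?F n) i)" by simp
    show "(SUP n. f i * indicator (?F n) i) \<le> f i" by (intro SUP_least) (auto simp: indicator_def)
  qed
  also have "\<dots> = (SUP n. \<integral>\<^sup>+i. f i * indicator (?F n) i \<partial>count_space UNIV)"
    by (rule nn_integral_monotone_convergence_SUP) (auto simp: incseq_def le_fun_def indicator_def)
  also have "\<dots> \<le> infsum f UNIV"
    unfolding eq using finF by (intro SUP_mono) (auto simp: fin[symmetric] intro!: bexI[of _ "?F _"])
  finally show "(\<integral>\<^sup>+i. f i \<partial>count_space UNIV) \<le> infsum f UNIV" .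
qed

lemma W_norm_eq_amalgam:
  assumes p: "1 \<le> p" "p < \<infinity>"
  shows "W_norm p q f = amalgam (enn2real p) q (\<lambda>x. ennreal (norm (f x)))"
proof -
  have p1: "1 \<le> enn2real p" using p by (intro enn2real_ge_1) auto
  have "Lp_norm p (\<lambda>t. f t * transl (zvec k) (indicator unit_cube) t) = cell_norm (enn2real p) (\<lambda>x. ennreal (norm (f x))) k" for k
  proof -
    have ind: "(transl (zvec k) (indicator unit_cube) x :: complex) = indicator {x. ifloor x = k} x" for x
      by (auto simp: transl_def indicator_def unit_cube_def zvec_def ifloor_eq_iff algebra_simps)
    have "ennreal (norm (f x * indicator {x. ifloor x = k} x) powr enn2real p)
        = epow (ennreal (norm (f x)) * indicator {x. ifloor x = k} x) (enn2real p)" for x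
      using p1 by (auto simp: indicator_def epow_ennreal)
    then show ?thesis
      using p unfolding Lp_norm_def cell_norm_def enorm_def ind by (auto simp: nn_integral_completion)
  qed
  then show ?thesis
    unfolding W_norm_def Let_def amalgam_def qnorm_def enorm_def by (simp add: infsum_ennreal_eq_nn_integral)
qed

section \<open>Grid sums as integrals\<close>

text \<open>
  Cells have measure \<open>1\<close>, so sums over the lattice are integrals of functions constant on cells. This
  makes a Riemann sum and the integral it approximates two integrals over the same variable.
\<close>

lemma distr_ifloor: "distr lborel (count_space UNIV) (ifloor :: real^'d \<Rightarrow> int^'d) = count_space UNIV"
proof (rule measure_eqI_countable[of _ UNIV])
  fix k :: "int^'d"
  have "ifloor -` {k} = {x. ifloor x = k}" by auto
  then show "emeasure (distr lborel (count_space UNIV) ifloor) {k} = emeasure (count_space UNIV) {k}"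
    by (subst emeasure_distr) (auto simp: emeasure_ifloor_cell)
qed auto

lemma integrable_ifloor:
  fixes F :: "int^'d \<Rightarrow> complex"
  assumes "integrable (count_space UNIV) F"
  shows "integrable lborel (\<lambda>s. F (ifloor s))"
  using assms by (subst (asm) distr_ifloor[symmetric]) (simp add: integrable_distr_eq)

lemma integral_ifloor:
  fixes F :: "int^'d \<Rightarrow> complex"
  shows "(LINT k|count_space UNIV. F k) = (LINT s|lborel. F (ifloor s))"
  by (subst distr_ifloor[symmetric]) (simp add: integral_distr)

text \<open>
  Unconditional summability of complex numbers is absolute summability, and both sides are \<open>0\<close> when it
  fails. Hence measurability and Fubini arguments apply to the series of the Walnut representation.
\<close>

lemma infsum_eq_integral:
  fixes F :: "'i \<Rightarrow> complex"
  shows "infsum F UNIV = (LINT k|count_space UNIV. F k)"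
proof (cases "integrable (count_space UNIV) F")
  case True
  then show ?thesis
    using infsetsum_infsum[of F UNIV] by (simp add: infsetsum_def abs_summable_on_def)
next
  case False
  then have "\<not> Infinite_Set_Sum.abs_summable_on F UNIV" by (simp add: abs_summable_on_def)
  then have "\<not> (\<lambda>x. norm (F x)) summable_on UNIV" using abs_summable_equivalent[of F UNIV] by simp
  then have "\<not> F summable_on UNIV" using summable_on_iff_abs_summable_on_complex by blast
  then show ?thesis using False by (simp add: infsum_not_exists not_integrable_integral_eq)
qed

definition majorized :: "(real^'d \<Rightarrow> complex) \<Rightarrow> (real^'d \<Rightarrow> ennreal) \<Rightarrow> bool" where
  "majorized h D \<longleftrightarrow> (\<forall>y z. (\<forall>i. \<bar>z $ i - y $ i\<bar> \<le> 1) \<longrightarrow> ennreal (norm (h z)) \<le> D y)"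

lemma grid_point_near:
  fixes s :: "real^'d"
  assumes "0 < a"
  shows "\<bar>(x - a *\<^sub>R zvec (ifloor s)) $ i - (x + (-a) *\<^sub>R s) $ i\<bar> \<le> a"
proof -
  have "\<bar>s $ i - of_int \<lfloor>s $ i\<rfloor>\<bar> \<le> 1" by linarith
  then have "a * \<bar>s $ i - of_int \<lfloor>s $ i\<rfloor>\<bar> \<le> a * 1" using assms by (intro mult_left_mono) auto
  then have "\<bar>a * (s $ i - of_int \<lfloor>s $ i\<rfloor>)\<bar> \<le> a" using assms by (simp add: abs_mult)
  then show ?thesis by (simp add: zvec_def ifloor_def algebra_simps)
qed

text \<open>
  The point \<open>x - a * \<lfloor>s\<rfloor>\<close> is within \<open>a\<close> of \<open>x - a * s\<close> in each coordinate, so the value of \<open>h\<close>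
  there is bounded by \<open>D (x - a * s)\<close>; the factor \<open>a ^ CARD('d)\<close> is the Jacobian of the substitution.
\<close>

lemma majorized_grid_sum:
  fixes h :: "real^'d \<Rightarrow> complex"
  assumes h: "majorized h D" and [measurable]: "D \<in> borel_measurable borel" and a: "0 < a" "a \<le> 1"
  shows "ennreal (a ^ CARD('d)) * (\<integral>\<^sup>+k. ennreal (norm (h (x - a *\<^sub>R zvec k))) \<partial>count_space UNIV) \<le> (\<integral>\<^sup>+y. D y \<partial>lborel)"
proof -
  have "(\<integral>\<^sup>+k. ennreal (norm (h (x - a *\<^sub>R zvec k))) \<partial>count_space UNIV)
      = (\<integral>\<^sup>+s. ennreal (norm (h (x - a *\<^sub>R zvec (ifloor s)))) \<partial>lborel)"
    by (rule nn_integral_ifloor[symmetric])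
  also have "\<dots> \<le> (\<integral>\<^sup>+s. D (x + (-a) *\<^sub>R s) \<partial>lborel)"
    using a order_trans[OF grid_point_near a(2)]
    by (intro nn_integral_mono h[unfolded majorized_def, rule_format]) auto
  finally have "ennreal (a ^ CARD('d)) * (\<integral>\<^sup>+k. ennreal (norm (h (x - a *\<^sub>R zvec k))) \<partial>count_space UNIV)
      \<le> ennreal (\<bar>-a\<bar> ^ DIM(real^'d)) * (\<integral>\<^sup>+s. D (x + (-a) *\<^sub>R s) \<partial>lborel)"
    using a by (auto intro: mult_left_mono)
  also have "\<dots> = (\<integral>\<^sup>+y. D y \<partial>lborel)"
    using a by (intro nn_integral_lborel_affine[symmetric]) auto
  finally show ?thesis .
qed

lemma filterlim_at_rightI_pos:
  fixes X :: "'b \<Rightarrow> real"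
  assumes "(X \<longlongrightarrow> 0) F" "\<And>i. 0 < X i"
  shows "filterlim X (at_right 0) F"
  unfolding filterlim_at using assms(1)
proof (intro conjI always_eventually allI)
  show "X i \<in> {0<..}" "X i \<noteq> 0" for i using assms(2)[of i] by auto
qed

text \<open>
  The oscillation of \<open>h\<close> at scale \<open>a\<close>. The scale is capped at \<open>1\<close> because majorants control \<open>h\<close> only
  up to distance \<open>1\<close>.
\<close>

definition osc :: "(real^'d \<Rightarrow> complex) \<Rightarrow> real \<Rightarrow> real^'d \<Rightarrow> ennreal" where
  "osc h a y = (SUP u\<in>{u. \<forall>i. \<bar>u $ i\<bar> \<le> min a 1}. ennreal (norm (h (y + u) - h y)))"

text \<open>
  A supremum of continuous functions is lower semicontinuous, however many there are.
\<close>

lemma osc_measurable: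
  fixes h :: "real^'d \<Rightarrow> complex"
  assumes h: "continuous_on UNIV h"
  shows "osc h a \<in> borel_measurable borel"
proof (rule borel_measurableI_greater)
  fix c :: ennreal
  have "open {y :: real^'d. c < osc h a y}"
  proof -
    have "{y :: real^'d. c < osc h a y} = (\<Union>u\<in>{u :: real^'d. \<forall>i. \<bar>u $ i\<bar> \<le> min a 1}. {y :: real^'d. c < ennreal (norm (h (y + u) - h y))})"
      unfolding osc_def by (auto simp: less_SUP_iff)
    moreover have "open {y :: real^'d. c < ennreal (norm (h (y + u) - h y))}" for u
      by (intro open_Collect_less continuous_intros continuous_on_ennreal continuous_on_compose2[OF h] h) auto
    ultimately show ?thesis by auto
  qed
  then show "{x \<in> space borel. c < osc h a x} \<in> sets borel" by simp
qed

lemma osc_le: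
  fixes h :: "real^'d \<Rightarrow> complex"
  assumes h: "majorized h D"
  shows "osc h a y \<le> 2 * D y"
  unfolding osc_def
proof (rule SUP_least)
  fix u :: "real^'d" assume u: "u \<in> {u. \<forall>i. \<bar>u $ i\<bar> \<le> min a 1}"
  have "ennreal (norm (h (y + u) - h y)) \<le> ennreal (norm (h (y + u))) + ennreal (norm (h y))"
    by (simp add: norm_triangle_ineq4 flip: ennreal_plus)
  also have "\<dots> \<le> D y + D y"
    using u by (intro add_mono h[unfolded majorized_def, rule_format]) auto
  finally show "ennreal (norm (h (y + u) - h y)) \<le> 2 * D y" by (simp add: mult_2)
qed

lemma osc_tendsto_0:
  fixes h :: "real^'d \<Rightarrow> complex"
  assumes h: "continuous_on UNIV h"
  shows "((\<lambda>a. osc h a y) \<longlongrightarrow> 0) (at_right 0)"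
proof -
  have "eventually (\<lambda>a. osc h a y < e) (at_right 0)" if "e > 0" for e
  proof -
    obtain z where z: "0 < z" "z < e" using dense[OF \<open>e > 0\<close>] by blast
    then obtain r where r: "0 < r" "ennreal r < e"
      by (cases z) (auto simp: ennreal_zero_less_mult_iff)
    have "continuous (at y) h" using h by (simp add: continuous_on_eq_continuous_at)
    then obtain \<delta> where \<delta>: "\<delta> > 0" "\<And>z. dist z y < \<delta> \<Longrightarrow> dist (h z) (h y) < r"
      using r(1) unfolding continuous_at_eps_delta by blast
    have "eventually (\<lambda>a. a < \<delta> / real CARD('d)) (at_right 0)"
      using \<delta> unfolding eventually_at_right_field by (intro exI[of _ "\<delta> / real CARD('d)"]) auto
    then show ?thesis
    proof eventually_elim
      case (elim a)
      have "osc h a y \<le> ennreal r"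
        unfolding osc_def
      proof (rule SUP_least)
        fix u :: "real^'d" assume u: "u \<in> {u. \<forall>i. \<bar>u $ i\<bar> \<le> min a 1}"
        have "norm u \<le> (\<Sum>i\<in>UNIV. \<bar>u $ i\<bar>)" by (rule norm_le_l1_cart)
        also have "\<dots> \<le> (\<Sum>i\<in>(UNIV :: 'd set). a)" using u by (intro sum_mono) auto
        also have "\<dots> < \<delta>" using elim by (simp add: field_simps)
        finally have "dist (h (y + u)) (h y) < r" by (intro \<delta>(2)) (simp add: dist_norm)
        then show "ennreal (norm (h (y + u) - h y)) \<le> ennreal r"
          by (intro ennreal_leI) (simp add: dist_norm)
      qed
      with r show ?case by (rule_tac le_less_trans) auto
    qed
  qed
  then show ?thesis by (auto simp: order_tendsto_iff)
qed

definition total_osc :: "(real^'d \<Rightarrow> complex) \<Rightarrow> real \<Rightarrow> ennreal" where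
  "total_osc h a = (\<integral>\<^sup>+y. osc h a y \<partial>lborel)"

lemma total_osc_tendsto_0:
  fixes h :: "real^'d \<Rightarrow> complex"
  assumes h: "continuous_on UNIV h" "majorized h D" and D[measurable]: "D \<in> borel_measurable borel" "(\<integral>\<^sup>+y. D y \<partial>lborel) < \<infinity>"
  shows "(total_osc h \<longlongrightarrow> 0) (at_right 0)"
  unfolding tendsto_at_iff_sequentially
proof (intro allI impI)
  fix X :: "nat \<Rightarrow> real" assume X: "\<forall>i. X i \<in> {0<..} - {0}" "X \<longlonglongrightarrow> 0"
  note osc_measurable[OF h(1), measurable]
  have fX: "filterlim X (at_right 0) sequentially"
    by (rule filterlim_at_rightI_pos) (use X in auto)
  have "(\<lambda>n. \<integral>\<^sup>+y. osc h (X n) y \<partial>lborel) \<longlonglongrightarrow> (\<integral>\<^sup>+y. 0 \<partial>(lborel :: (real^'d) measure))"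
  proof (rule nn_integral_dominated_convergence[where w="\<lambda>y. 2 * D y"])
    show "(\<integral>\<^sup>+y. 2 * D y \<partial>lborel) < \<infinity>" using D by (simp add: nn_integral_cmult ennreal_mult_less_top)
    show "AE y in lborel. (\<lambda>n. osc h (X n) y) \<longlonglongrightarrow> 0"
      by (intro AE_I2 filterlim_compose[OF osc_tendsto_0[OF h(1)] fX])
  qed (auto intro: osc_le[OF h(2)])
  then show "(total_osc h \<circ> X) \<longlonglongrightarrow> 0" by (simp add: total_osc_def o_def)
qed

text \<open>
  After the substitution \<open>y = x - a * s\<close> the error is the integral of
  \<open>h (x - a * \<lfloor>s\<rfloor>) - h (x - a * s)\<close> times \<open>a ^ CARD('d)\<close>, and the integrand is an increment of \<open>h\<close> at
  scale \<open>a\<close>. The resulting bound does not depend on \<open>x\<close>.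
\<close>

theorem grid_sum_approximates_integral:
  fixes h :: "real^'d \<Rightarrow> complex"
  assumes h: "continuous_on UNIV h" "majorized h D" and D[measurable]: "D \<in> borel_measurable borel" "(\<integral>\<^sup>+y. D y \<partial>lborel) < \<infinity>"
    and a: "0 < a" "a \<le> 1"
  shows "ennreal (norm (of_real (a ^ CARD('d)) * (LINT k|count_space UNIV. h (x - a *\<^sub>R zvec k)) - (LINT y|lborel. h y))) \<le> total_osc h a"
proof -
  let ?d = "CARD('d)"
  note osc_measurable[OF h(1), measurable]
  have [measurable]: "h \<in> borel_measurable borel" using h by (intro borel_measurable_continuous_onI)
  have "ennreal (a ^ ?d) * (\<integral>\<^sup>+k. ennreal (norm (h (x - a *\<^sub>R zvec k))) \<partial>count_space UNIV) < \<infinity>"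
    using majorized_grid_sum[OF h(2) D(1) a, of x] D(2) by (rule le_less_trans)
  then have "(\<integral>\<^sup>+k. ennreal (norm (h (x - a *\<^sub>R zvec k))) \<partial>count_space UNIV) < \<infinity>"
    using a by (auto simp: ennreal_mult_less_top)
  then have int1: "integrable lborel (\<lambda>s. h (x - a *\<^sub>R zvec (ifloor s)))"
    by (intro integrable_ifloor integrableI_bounded) auto
  have "integrable lborel h"
  proof (rule integrableI_bounded)
    have "(\<integral>\<^sup>+y. ennreal (norm (h y)) \<partial>lborel) \<le> (\<integral>\<^sup>+y. D y \<partial>lborel)"
      by (intro nn_integral_mono h(2)[unfolded majorized_def, rule_format]) auto
    then show "(\<integral>\<^sup>+y. ennreal (norm (h y)) \<partial>lborel) < \<infinity>" using D(2) by (rule le_less_trans)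
  qed simp
  then have int2: "integrable lborel (\<lambda>s. h (x + (-a) *\<^sub>R s))"
    using a by (intro integrable_lborel_affine) auto
  have I: "(LINT y|lborel. h y) = of_real (a ^ ?d) * (LINT s|lborel. h (x + (-a) *\<^sub>R s))"
    using lborel_integral_affine[of h "-a" x] a by (simp add: scaleR_conv_of_real)
  have "of_real (a ^ ?d) * (LINT k|count_space UNIV. h (x - a *\<^sub>R zvec k)) - (LINT y|lborel. h y)
      = of_real (a ^ ?d) * (LINT s|lborel. h (x - a *\<^sub>R zvec (ifloor s)) - h (x + (-a) *\<^sub>R s))"
    unfolding I integral_ifloor Bochner_Integration.integral_diff[OF int1 int2] by (simp only: right_diff_distrib)
  then have "ennreal (norm (of_real (a ^ ?d) * (LINT k|count_space UNIV. h (x - a *\<^sub>R zvec k)) - (LINT y|lborel. h y)))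
      = ennreal (a ^ ?d) * ennreal (norm (LINT s|lborel. h (x - a *\<^sub>R zvec (ifloor s)) - h (x + (-a) *\<^sub>R s)))"
    using a by (simp add: norm_mult norm_power ennreal_mult)
  also have "\<dots> \<le> ennreal (a ^ ?d) * (\<integral>\<^sup>+s. ennreal (norm (h (x - a *\<^sub>R zvec (ifloor s)) - h (x + (-a) *\<^sub>R s))) \<partial>lborel)"
    using int1 int2 by (intro mult_left_mono integral_norm_bound_ennreal Bochner_Integration.integrable_diff) auto
  also have "\<dots> \<le> ennreal (\<bar>-a\<bar> ^ DIM(real^'d)) * (\<integral>\<^sup>+s. osc h a (x + (-a) *\<^sub>R s) \<partial>lborel)"
  proof (intro mult_mono nn_integral_mono)
    fix s :: "real^'d"
    let ?y = "x + (-a) *\<^sub>R s"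
    have "ennreal (norm (h (?y + ((x - a *\<^sub>R zvec (ifloor s)) - ?y)) - h ?y)) \<le> osc h a ?y"
      unfolding osc_def
      using grid_point_near[OF a(1), of x s] a by (intro SUP_upper) auto
    then show "ennreal (norm (h (x - a *\<^sub>R zvec (ifloor s)) - h ?y)) \<le> osc h a ?y" by simp
  qed (use a in auto)
  also have "\<dots> = total_osc h a"
    unfolding total_osc_def using a by (intro nn_integral_lborel_affine[symmetric]) auto
  finally show ?thesis .
qed

section \<open>Overlap of distant translates\<close>

text \<open>
  The cells \<open>k\<close> counted here include every cell that a point of the cell \<open>j\<close> can reach when it moves by
  \<open>n / b\<close> with \<open>n \<noteq> 0\<close>: some coordinate moves by at least \<open>1 / b\<close>, and taking integer parts costs
  at most \<open>1\<close>.
\<close>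

definition far_tail :: "(int^'d \<Rightarrow> ennreal) \<Rightarrow> real \<Rightarrow> int^'d \<Rightarrow> ennreal" where
  "far_tail C b j = (\<integral>\<^sup>+k. C k * indicator {k. \<exists>i. 1 / b - 1 \<le> \<bar>of_int (k $ i - j $ i)\<bar>} k \<partial>count_space UNIV)"

lemma far_tail_le: "far_tail C b j \<le> (\<integral>\<^sup>+k. C k \<partial>count_space UNIV)"
  unfolding far_tail_def by (intro nn_integral_mono) (auto simp: indicator_def)

lemma far_tail_tendsto_0:
  fixes C :: "int^'d \<Rightarrow> ennreal"
  assumes C: "(\<integral>\<^sup>+k. C k \<partial>count_space UNIV) < \<infinity>"
    and X: "filterlim X (at_right 0) sequentially"
  shows "(\<lambda>n. far_tail C (X n) j) \<longlonglongrightarrow> 0"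
proof -
  have "(\<lambda>n. far_tail C (X n) j) \<longlonglongrightarrow> (\<integral>\<^sup>+k. 0 \<partial>(count_space UNIV :: (int^'d) measure))"
    unfolding far_tail_def
  proof (rule nn_integral_dominated_convergence[where w=C])
    show "AE k in count_space UNIV. (\<lambda>n. C k * indicator {k. \<exists>i. 1 / X n - 1 \<le> \<bar>of_int (k $ i - j $ i)\<bar>} k) \<longlonglongrightarrow> 0"
    proof (intro AE_I2 tendsto_eventually)
      fix k :: "int^'d"
      have "filterlim (\<lambda>n. inverse (X n)) at_top sequentially"
        by (rule filterlim_compose[OF filterlim_inverse_at_top_right X])
      then have "eventually (\<lambda>n. (\<Sum>i\<in>UNIV. \<bar>real_of_int (k $ i - j $ i)\<bar>) + 1 < inverse (X n)) sequentially"
        by (rule filterlim_at_top_dense[THEN iffD1, rule_format])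
      then show "\<forall>\<^sub>F n in sequentially. C k * indicator {k. \<exists>i. 1 / X n - 1 \<le> \<bar>of_int (k $ i - j $ i)\<bar>} k = 0"
      proof eventually_elim
        case (elim n)
        have "\<not> (1 / X n - 1 \<le> \<bar>real_of_int (k $ i - j $ i)\<bar>)" for i
        proof -
          have "\<bar>real_of_int (k $ i - j $ i)\<bar> \<le> (\<Sum>i\<in>UNIV. \<bar>real_of_int (k $ i - j $ i)\<bar>)"
            by (rule member_le_sum) auto
          then show ?thesis using elim unfolding inverse_eq_divide by linarith
        qed
        then show ?case by (auto simp: indicator_def)
      qed
    qed
  qed (use C in \<open>auto simp: indicator_def\<close>)
  then show ?thesis by simp
qed

definition total_far_tail :: "(int^'d \<Rightarrow> ennreal) \<Rightarrow> (int^'d \<Rightarrow> ennreal) \<Rightarrow> real \<Rightarrow> ennreal" where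
  "total_far_tail C C' b = (\<integral>\<^sup>+j. C' j * far_tail C b j \<partial>count_space UNIV)"

lemma total_far_tail_tendsto_0:
  fixes C C' :: "int^'d \<Rightarrow> ennreal"
  assumes C: "(\<integral>\<^sup>+k. C k \<partial>count_space UNIV) < \<infinity>" and C': "(\<integral>\<^sup>+k. C' k \<partial>count_space UNIV) < \<infinity>"
  shows "(total_far_tail C C' \<longlongrightarrow> 0) (at_right 0)"
  unfolding tendsto_at_iff_sequentially
proof (intro allI impI)
  fix X :: "nat \<Rightarrow> real" assume X: "\<forall>i. X i \<in> {0<..} - {0}" "X \<longlonglongrightarrow> 0"
  have fX: "filterlim X (at_right 0) sequentially"
    by (rule filterlim_at_rightI_pos) (use X in auto)
  have "(\<lambda>n. \<integral>\<^sup>+j. C' j * far_tail C (X n) j \<partial>count_space UNIV) \<longlonglongrightarrow> (\<integral>\<^sup>+j. 0 \<partial>(count_space UNIV :: (int^'d) measure))"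
  proof (rule nn_integral_dominated_convergence[where w="\<lambda>j. C' j * (\<integral>\<^sup>+k. C k \<partial>count_space UNIV)"])
    show "(\<integral>\<^sup>+j. C' j * (\<integral>\<^sup>+k. C k \<partial>count_space UNIV) \<partial>count_space UNIV) < \<infinity>"
      using C C' by (simp add: nn_integral_multc ennreal_mult_less_top)
    show "AE j in count_space UNIV. (\<lambda>n. C' j * far_tail C (X n) j) \<longlonglongrightarrow> 0"
    proof (intro AE_I2)
      fix j
      have "C' j \<le> (\<integral>\<^sup>+k. C' k \<partial>count_space UNIV)" by (rule nn_integral_ge_point) simp
      then have "C' j < top" using C' by (metis infinity_ennreal_def le_less_trans)
      then have "(\<lambda>n. C' j * far_tail C (X n) j) \<longlonglongrightarrow> C' j * 0"
        by (intro ennreal_tendsto_cmult far_tail_tendsto_0 C fX)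
      then show "(\<lambda>n. C' j * far_tail C (X n) j) \<longlonglongrightarrow> 0" by simp
    qed
  qed (auto intro!: mult_left_mono far_tail_le)
  then show "(total_far_tail C C' \<circ> X) \<longlonglongrightarrow> 0" by (simp add: total_far_tail_def o_def)
qed

text \<open>
  The common mass of the step functions of \<open>C'\<close> and of \<open>C\<close> moved by \<open>t\<close>. It bounds the inner product
  of one window with a translate of the other, and the Riemann sums of that product.
\<close>

definition overlap :: "(int^'d \<Rightarrow> ennreal) \<Rightarrow> (int^'d \<Rightarrow> ennreal) \<Rightarrow> real^'d \<Rightarrow> ennreal" where
  "overlap C C' t = (\<integral>\<^sup>+y. C (ifloor (y - t)) * C' (ifloor y) \<partial>lborel)"

lemma ifloor_comp_measurable [measurable]:
  "(\<lambda>y. C (ifloor y) :: ennreal) \<in> borel_measurable borel"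
  by (rule measurable_compose[OF ifloor_measurable]) simp

lemma ifloor_comp_translate_measurable [measurable]:
  "(\<lambda>y. C (ifloor (y - t)) :: ennreal) \<in> borel_measurable borel"
  by (rule measurable_compose[OF _ ifloor_comp_measurable]) measurable

text \<open>
  For \<open>b \<le> 1\<close> the points \<open>y - n / b\<close> have mutual distance at least \<open>1\<close> in some coordinate, so they lie
  in different cells; those with \<open>n \<noteq> 0\<close> lie in cells counted by \<^const>\<open>far_tail\<close>.
\<close>

lemma sum_overlap_le:
  fixes C C' :: "int^'d \<Rightarrow> ennreal"
  assumes b: "0 < b" "b \<le> 1"
  shows "(\<integral>\<^sup>+n. indicator (- {0}) n * overlap C C' (zvec n /\<^sub>R b) \<partial>count_space UNIV) \<le> total_far_tail C C' b"
proof -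
  have inner: "(\<integral>\<^sup>+n. indicator (- {0}) n * C (ifloor (y - zvec n /\<^sub>R b)) \<partial>count_space UNIV) \<le> far_tail C b (ifloor y)" for y :: "real^'d"
  proof -
    let ?\<phi> = "\<lambda>n. ifloor (y - zvec n /\<^sub>R b)"
    let ?T = "{k. \<exists>i. 1 / b - 1 \<le> \<bar>of_int (k $ i - ifloor y $ i)\<bar>}"
    have b1: "1 \<le> 1 / b" using b by simp
    have inj: "inj_on ?\<phi> (- {0})"
    proof (rule inj_onI)
      fix m n :: "int^'d" assume eq: "?\<phi> m = ?\<phi> n"
      show "m = n"
      proof (rule ccontr)
        assume "m \<noteq> n"
        then obtain i where i: "m $ i \<noteq> n $ i" by (auto simp: vec_eq_iff)
        then have "1 \<le> \<bar>real_of_int (m $ i - n $ i)\<bar>" by linarith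
        then have "1 / b * 1 \<le> 1 / b * \<bar>real_of_int (m $ i - n $ i)\<bar>" using b by (intro mult_left_mono) auto
        then have "1 / b \<le> \<bar>real_of_int (m $ i) / b - real_of_int (n $ i) / b\<bar>"
          using b by (simp add: abs_mult[symmetric] diff_divide_distrib[symmetric] abs_divide)
        moreover have "\<lfloor>y $ i - real_of_int (m $ i) / b\<rfloor> = \<lfloor>y $ i - real_of_int (n $ i) / b\<rfloor>"
          using eq by (auto simp: ifloor_def vec_eq_iff zvec_def divide_inverse mult.commute)
        then have "\<bar>real_of_int (m $ i) / b - real_of_int (n $ i) / b\<bar> < 1" by linarith
        ultimately show False using b1 by linarith
      qed
    qed
    have img: "?\<phi> ` (- {0}) \<subseteq> ?T"
    proof clarify
      fix n :: "int^'d" assume "n \<noteq> 0"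
      then obtain i where i: "n $ i \<noteq> 0" by (auto simp: vec_eq_iff)
      then have "1 \<le> \<bar>real_of_int (n $ i)\<bar>" by linarith
      then have "1 / b * 1 \<le> 1 / b * \<bar>real_of_int (n $ i)\<bar>" using b by (intro mult_left_mono) auto
      then have n: "1 / b \<le> \<bar>real_of_int (n $ i) / b\<bar>"
        using b by (simp add: abs_divide)
      have "\<bar>real_of_int (\<lfloor>y $ i - real_of_int (n $ i) / b\<rfloor> - \<lfloor>y $ i\<rfloor>)\<bar> \<ge> \<bar>real_of_int (n $ i) / b\<bar> - 1"
        by linarith
      then have "1 / b - 1 \<le> \<bar>real_of_int (?\<phi> n $ i - ifloor y $ i)\<bar>"
        using n by (simp add: ifloor_def zvec_def divide_inverse mult.commute)
      then show "\<exists>i. 1 / b - 1 \<le> \<bar>real_of_int (?\<phi> n $ i - ifloor y $ i)\<bar>" by blast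
    qed
    have "(\<integral>\<^sup>+n. indicator (- {0}) n * C (?\<phi> n) \<partial>count_space UNIV) = (\<integral>\<^sup>+n. C (?\<phi> n) \<partial>count_space (- {0}))"
      by (simp add: nn_integral_count_space_indicator mult.commute)
    also have "\<dots> = (\<integral>\<^sup>+k. C k \<partial>count_space (?\<phi> ` (- {0})))"
      using inj by (intro nn_integral_bij_count_space) (simp add: bij_betw_def)
    also have "\<dots> = (\<integral>\<^sup>+k. C k * indicator (?\<phi> ` (- {0})) k \<partial>count_space UNIV)"
      by (simp add: nn_integral_count_space_indicator)
    also have "\<dots> \<le> far_tail C b (ifloor y)"
      unfolding far_tail_def using img
      by (intro nn_integral_mono mult_left_mono) (auto simp: indicator_def)
    finally show ?thesis .
  qed
  have "(\<integral>\<^sup>+n. indicator (- {0}) n * overlap C C' (zvec n /\<^sub>R b) \<partial>count_space UNIV)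
      = (\<integral>\<^sup>+n. (\<integral>\<^sup>+y. indicator (- {0}) n * (C (ifloor (y - zvec n /\<^sub>R b)) * C' (ifloor y)) \<partial>lborel) \<partial>count_space UNIV)"
    unfolding overlap_def by (intro nn_integral_cong nn_integral_cmult[symmetric]) simp
  also have "\<dots> = (\<integral>\<^sup>+y. (\<integral>\<^sup>+n. indicator (- {0}) n * (C (ifloor (y - zvec n /\<^sub>R b)) * C' (ifloor y)) \<partial>count_space UNIV) \<partial>lborel)"
    by (intro nn_integral_count_space_nn_integral[symmetric]) auto
  also have "\<dots> = (\<integral>\<^sup>+y. C' (ifloor y) * (\<integral>\<^sup>+n. indicator (- {0}) n * C (ifloor (y - zvec n /\<^sub>R b)) \<partial>count_space UNIV) \<partial>lborel)"
    by (intro nn_integral_cong) (simp add: nn_integral_cmult[symmetric] mult_ac)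
  also have "\<dots> \<le> (\<integral>\<^sup>+y. C' (ifloor y) * far_tail C b (ifloor y) \<partial>lborel)"
    by (intro nn_integral_mono mult_left_mono inner) simp
  also have "\<dots> = total_far_tail C C' b"
    unfolding total_far_tail_def by (rule nn_integral_ifloor[of "\<lambda>j. C' j * far_tail C b j"])
  finally show ?thesis .
qed

section \<open>The frame operator in Walnut form\<close>

abbreviation window_product :: "(real^'d \<Rightarrow> complex) \<Rightarrow> (real^'d \<Rightarrow> complex) \<Rightarrow> real^'d \<Rightarrow> real^'d \<Rightarrow> complex" where
  "window_product g \<gamma> t \<equiv> (\<lambda>y. cnj (g (y - t)) * \<gamma> y)"

lemma wiener_majorantD:
  assumes "wiener_majorant g C"
  shows "continuous_on UNIV g" "(\<integral>\<^sup>+k. C k \<partial>count_space UNIV) < \<infinity>"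
    "\<And>y z. (\<And>i. \<bar>z $ i - y $ i\<bar> \<le> 1) \<Longrightarrow> ennreal (norm (g z)) \<le> C (ifloor y)"
    "g \<in> borel_measurable borel"
  using assms by (auto simp: wiener_majorant_def intro: borel_measurable_continuous_onI)

lemma majorized_window_product:
  fixes g \<gamma> :: "real^'d \<Rightarrow> complex"
  assumes g: "wiener_majorant g C" and \<gamma>: "wiener_majorant \<gamma> C'"
  shows "majorized (window_product g \<gamma> t) (\<lambda>y. C (ifloor (y - t)) * C' (ifloor y))"
  unfolding majorized_def
proof (intro allI impI)
  fix y z :: "real^'d" assume yz: "\<forall>i. \<bar>z $ i - y $ i\<bar> \<le> 1"
  have "ennreal (norm (cnj (g (z - t)) * \<gamma> z)) = ennreal (norm (g (z - t))) * ennreal (norm (\<gamma> z))"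
    by (simp add: norm_mult ennreal_mult)
  also have "\<dots> \<le> C (ifloor (y - t)) * C' (ifloor y)"
    using yz by (intro mult_mono wiener_majorantD(3)[OF g] wiener_majorantD(3)[OF \<gamma>]) auto
  finally show "ennreal (norm (cnj (g (z - t)) * \<gamma> z)) \<le> C (ifloor (y - t)) * C' (ifloor y)" .
qed

lemma overlap_finite:
  assumes C: "(\<integral>\<^sup>+k. C k \<partial>count_space UNIV) < \<infinity>" and C': "(\<integral>\<^sup>+k. C' k \<partial>count_space UNIV) < \<infinity>"
  shows "overlap C C' t < \<infinity>"
proof -
  have "overlap C C' t \<le> (\<integral>\<^sup>+y. (\<integral>\<^sup>+k. C k \<partial>count_space UNIV) * C' (ifloor y) \<partial>lborel)"
    unfolding overlap_def by (intro nn_integral_mono mult_right_mono nn_integral_ge_point) auto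
  also have "\<dots> = (\<integral>\<^sup>+k. C k \<partial>count_space UNIV) * (\<integral>\<^sup>+k. C' k \<partial>count_space UNIV)"
    by (simp add: nn_integral_cmult nn_integral_ifloor)
  also have "\<dots> < \<infinity>" using C C' by (simp add: ennreal_mult_less_top)
  finally show ?thesis .
qed

lemma walnut_G_eq:
  "walnut_G a b g \<gamma> n x = (LINT k|count_space UNIV. window_product g \<gamma> (zvec n /\<^sub>R b) (x - a *\<^sub>R zvec k))"
  unfolding walnut_G_def infsum_eq_integral by (simp add: algebra_simps)

lemma norm_integral_le_nn_integral:
  fixes f :: "'a \<Rightarrow> complex"
  shows "ennreal (norm (LINT x|M. f x)) \<le> (\<integral>\<^sup>+x. ennreal (norm (f x)) \<partial>M)"
  by (cases "integrable M f") (auto simp: integral_norm_bound_ennreal not_integrable_integral_eq)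

lemma norm_walnut_G_le:
  fixes g \<gamma> :: "real^'d \<Rightarrow> complex"
  assumes g: "wiener_majorant g C" and \<gamma>: "wiener_majorant \<gamma> C'" and a: "0 < a" "a \<le> 1"
  shows "ennreal (norm (of_real (a ^ CARD('d)) * walnut_G a b g \<gamma> n x)) \<le> overlap C C' (zvec n /\<^sub>R b)"
proof -
  let ?h = "window_product g \<gamma> (zvec n /\<^sub>R b)"
  have "ennreal (norm (of_real (a ^ CARD('d)) * walnut_G a b g \<gamma> n x))
      = ennreal (a ^ CARD('d)) * ennreal (norm (walnut_G a b g \<gamma> n x))"
    using a by (simp add: norm_mult norm_power ennreal_mult)
  also have "\<dots> \<le> ennreal (a ^ CARD('d)) * (\<integral>\<^sup>+k. ennreal (norm (?h (x - a *\<^sub>R zvec k))) \<partial>count_space UNIV)"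
    unfolding walnut_G_eq by (intro mult_left_mono norm_integral_le_nn_integral) simp
  also have "\<dots> \<le> overlap C C' (zvec n /\<^sub>R b)"
    unfolding overlap_def by (intro majorized_grid_sum majorized_window_product g \<gamma> a) measurable
  finally show ?thesis .
qed

lemma pairing_eq_lborel:
  assumes [measurable]: "f \<in> borel_measurable borel" "h \<in> borel_measurable borel"
  shows "pairing f h = (LINT x|lborel. f x * cnj (h x))"
  unfolding pairing_def by (rule integral_completion) measurable

lemma zvec_0 [simp]: "zvec 0 = 0"
  by (simp add: zvec_def vec_eq_iff)

text \<open>
  The estimate holds at every point. Where the outer series fails to converge absolutely,
  \<^const>\<open>frame_op\<close> takes a default value, but there the dominating series on the right is infinite.
\<close>

theorem norm_frame_op_diff_le:
  fixes g \<gamma> f :: "real^'d \<Rightarrow> complex"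
  assumes g: "wiener_majorant g C" and \<gamma>: "wiener_majorant \<gamma> C'" and a: "0 < a" "a \<le> 1"
    and c0: "pairing \<gamma> g \<noteq> 0"
  shows "ennreal (norm (frame_op a b g \<gamma> f x - f x)) \<le> ennreal (1 / norm (pairing \<gamma> g)) *
      (total_osc (window_product g \<gamma> 0) a * ennreal (norm (f x)) +
       (\<integral>\<^sup>+n. indicator (- {0}) n * overlap C C' (zvec n /\<^sub>R b) * ennreal (norm (f (x - zvec n /\<^sub>R b))) \<partial>count_space UNIV))"
proof -
  note [measurable] = wiener_majorantD(4)[OF g] wiener_majorantD(4)[OF \<gamma>]
  let ?c = "pairing \<gamma> g"
  let ?O = "total_osc (window_product g \<gamma> 0) a * ennreal (norm (f x))"
  let ?E = "\<integral>\<^sup>+n. indicator (- {0}) n * overlap C C' (zvec n /\<^sub>R b) * ennreal (norm (f (x - zvec n /\<^sub>R b))) \<partial>count_space UNIV"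
  define T where "T = (\<lambda>n. of_real (a ^ CARD('d)) * walnut_G a b g \<gamma> n x * f (x - zvec n /\<^sub>R b))"
  define T' where "T' = (\<lambda>n. if n = 0 then 0 else T n)"
  have fo: "frame_op a b g \<gamma> f x = 1 / ?c * (LINT n|count_space UNIV. T n)"
    unfolding frame_op_def infsum_eq_integral T_def ..
  have T'E: "(\<integral>\<^sup>+n. ennreal (norm (T' n)) \<partial>count_space UNIV) \<le> ?E"
  proof (rule nn_integral_mono)
    fix n
    have "ennreal (norm (T n))
        = ennreal (norm (of_real (a ^ CARD('d)) * walnut_G a b g \<gamma> n x)) * ennreal (norm (f (x - zvec n /\<^sub>R b)))"
      unfolding T_def by (simp add: norm_mult ennreal_mult)
    also have "\<dots> \<le> overlap C C' (zvec n /\<^sub>R b) * ennreal (norm (f (x - zvec n /\<^sub>R b)))"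
      by (intro mult_right_mono norm_walnut_G_le g \<gamma> a) simp
    finally show "ennreal (norm (T' n)) \<le> indicator (- {0}) n * overlap C C' (zvec n /\<^sub>R b) * ennreal (norm (f (x - zvec n /\<^sub>R b)))"
      by (auto simp: T'_def indicator_def)
  qed
  have T0: "ennreal (norm (T 0 - ?c * f x)) \<le> ?O"
  proof -
    have "T 0 - ?c * f x = (of_real (a ^ CARD('d)) * walnut_G a b g \<gamma> 0 x - ?c) * f x"
      by (simp add: T_def left_diff_distrib)
    moreover have "ennreal (norm (of_real (a ^ CARD('d)) * walnut_G a b g \<gamma> 0 x - ?c)) \<le> total_osc (window_product g \<gamma> 0) a"
    proof -
      have c: "?c = (LINT y|lborel. window_product g \<gamma> 0 y)"
        by (subst pairing_eq_lborel) (auto simp: mult.commute)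
      have cont: "continuous_on UNIV (window_product g \<gamma> 0)"
        using wiener_majorantD(1)[OF g] wiener_majorantD(1)[OF \<gamma>] by (auto intro!: continuous_intros)
      have fin: "(\<integral>\<^sup>+y. C (ifloor (y - 0)) * C' (ifloor y) \<partial>lborel) < \<infinity>"
        using overlap_finite[OF wiener_majorantD(2)[OF g] wiener_majorantD(2)[OF \<gamma>], of 0] unfolding overlap_def .
      show ?thesis
        using grid_sum_approximates_integral[OF cont majorized_window_product[OF g \<gamma>, of 0] _ fin a, of x]
        unfolding c walnut_G_eq by simp
    qed
    ultimately show ?thesis
      by (simp add: norm_mult ennreal_mult mult_right_mono)
  qed
  show ?thesis
  proof (cases "?E = top")
    case True
    then show ?thesis using c0 by (simp add: ennreal_mult_top)
  next
    case False
    then have "(\<integral>\<^sup>+n. ennreal (norm (T' n)) \<partial>count_space UNIV) < \<infinity>"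
      using T'E by (auto simp: top_unique less_top)
    then have iT': "integrable (count_space UNIV) T'"
      by (intro integrableI_bounded) auto
    have i0: "has_bochner_integral (count_space UNIV) (\<lambda>n::int^'d. indicator {0} n *\<^sub>R T 0) (measure (count_space UNIV) {0 :: int^'d} *\<^sub>R T 0)"
      by (intro has_bochner_integral_scaleR_left has_bochner_integral_real_indicator) auto
    have "T = (\<lambda>n. indicator {0} n *\<^sub>R T 0 + T' n)"
      by (auto simp: T'_def indicator_def)
    then have "(LINT n|count_space UNIV. T n) = (LINT n|count_space UNIV. indicator {0 :: int^'d} n *\<^sub>R T 0 + T' n)"
      by simp
    also have "\<dots> = T 0 + (LINT n|count_space UNIV. T' n)"
      using i0 iT' by (subst Bochner_Integration.integral_add) (auto simp: has_bochner_integral_iff)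
    finally have "frame_op a b g \<gamma> f x - f x = 1 / ?c * ((T 0 - ?c * f x) + (LINT n|count_space UNIV. T' n))"
      unfolding fo using c0 by (simp add: field_simps)
    then have "ennreal (norm (frame_op a b g \<gamma> f x - f x))
        = ennreal (1 / norm ?c) * ennreal (norm ((T 0 - ?c * f x) + (LINT n|count_space UNIV. T' n)))"
      by (simp add: norm_mult norm_divide ennreal_mult[symmetric])
    also have "\<dots> \<le> ennreal (1 / norm ?c) * (ennreal (norm (T 0 - ?c * f x)) + ennreal (norm (LINT n|count_space UNIV. T' n)))"
      by (intro mult_left_mono) (auto simp: norm_triangle_ineq simp flip: ennreal_plus)
    also have "\<dots> \<le> ennreal (1 / norm ?c) * (?O + ?E)"
      by (intro mult_left_mono add_mono T0 order_trans[OF norm_integral_le_nn_integral T'E]) simp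
    finally show ?thesis .
  qed
qed

text \<open>
  Norms of the pointwise estimate: countable subadditivity moves the norm inside the series, and each
  translate of \<open>f\<close> costs the same constant \<open>card (icube 1)\<close>.
\<close>

theorem amalgam_frame_op_diff_le:
  fixes g \<gamma> f :: "real^'d \<Rightarrow> complex"
  assumes g: "wiener_majorant g C" and \<gamma>: "wiener_majorant \<gamma> C'"
    and a: "0 < a" "a \<le> 1" and b: "0 < b" "b \<le> 1" and c0: "pairing \<gamma> g \<noteq> 0"
    and f[measurable]: "f \<in> borel_measurable borel" and pq: "1 \<le> p" "1 \<le> q"
  shows "amalgam p q (\<lambda>x. ennreal (norm (frame_op a b g \<gamma> f x - f x)))
    \<le> ennreal (1 / norm (pairing \<gamma> g)) * (total_osc (window_product g \<gamma> 0) a +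
        of_nat (card (icube 1 :: (int^'d) set)) * total_far_tail C C' b) * amalgam p q (\<lambda>x. ennreal (norm (f x)))"
proof -
  let ?k = "ennreal (1 / norm (pairing \<gamma> g))" and ?A = "amalgam p q (\<lambda>x. ennreal (norm (f x)))"
    and ?O = "total_osc (window_product g \<gamma> 0) a" and ?N = "of_nat (card (icube 1 :: (int^'d) set)) :: ennreal"
  let ?\<alpha> = "\<lambda>n. indicator (- {0}) n * overlap C C' (zvec n /\<^sub>R b)"
  let ?S = "\<lambda>x. \<integral>\<^sup>+n. ?\<alpha> n * ennreal (norm (f (x - zvec n /\<^sub>R b))) \<partial>count_space UNIV"
  have [measurable]: "?S \<in> borel_measurable borel"
    by (intro nn_integral_countable_measurable) measurable
  have "amalgam p q (\<lambda>x. ennreal (norm (frame_op a b g \<gamma> f x - f x)))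
      \<le> amalgam p q (\<lambda>x. ?k * (?O * ennreal (norm (f x)) + ?S x))"
    by (intro amalgam_mono_AE pq AE_I2 norm_frame_op_diff_le g \<gamma> a c0)
  also have "\<dots> = ?k * amalgam p q (\<lambda>x. ?O * ennreal (norm (f x)) + ?S x)"
    by (intro amalgam_cmult pq) measurable
  also have "\<dots> \<le> ?k * (amalgam p q (\<lambda>x. ?O * ennreal (norm (f x))) + amalgam p q ?S)"
    by (intro mult_left_mono amalgam_add_le pq) auto
  also have "amalgam p q (\<lambda>x. ?O * ennreal (norm (f x))) = ?O * ?A"
    by (intro amalgam_cmult pq) measurable
  also have "amalgam p q ?S \<le> ?N * total_far_tail C C' b * ?A"
  proof -
    have "amalgam p q ?S \<le> (\<integral>\<^sup>+n. amalgam p q (\<lambda>x. ?\<alpha> n * ennreal (norm (f (x - zvec n /\<^sub>R b)))) \<partial>count_space UNIV)"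
      by (intro amalgam_suminf_le pq) measurable
    also have "\<dots> \<le> (\<integral>\<^sup>+n. ?\<alpha> n * (?N * ?A) \<partial>count_space UNIV)"
    proof (intro nn_integral_mono)
      fix n
      have "amalgam p q (\<lambda>x. ?\<alpha> n * ennreal (norm (f (x - zvec n /\<^sub>R b)))) = ?\<alpha> n * amalgam p q (\<lambda>x. ennreal (norm (f (x - zvec n /\<^sub>R b))))"
        by (intro amalgam_cmult pq) measurable
      also have "\<dots> \<le> ?\<alpha> n * (?N * ?A)"
        by (intro mult_left_mono amalgam_translate_le[of p q "\<lambda>x. ennreal (norm (f x))"] pq) auto
      finally show "amalgam p q (\<lambda>x. ?\<alpha> n * ennreal (norm (f (x - zvec n /\<^sub>R b)))) \<le> ?\<alpha> n * (?N * ?A)" .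
    qed
    also have "\<dots> = (\<integral>\<^sup>+n. ?\<alpha> n \<partial>count_space UNIV) * (?N * ?A)"
      by (rule nn_integral_multc) simp
    also have "\<dots> \<le> total_far_tail C C' b * (?N * ?A)"
      by (intro mult_right_mono sum_overlap_le b) simp
    finally show ?thesis by (simp add: mult_ac)
  qed
  finally show ?thesis by (simp add: distrib_right mult.assoc add_left_mono mult_left_mono)
qed

section \<open>Passing to representatives\<close>

lemma lebesgue_measurable_ex_borel:
  fixes f :: "'a::euclidean_space \<Rightarrow> complex"
  assumes "f \<in> borel_measurable lebesgue"
  obtains f' where "f' \<in> borel_measurable borel" "AE x in lborel. f x = f' x"
proof -
  have [measurable]: "f \<in> borel_measurable lebesgue" by fact
  have "(\<lambda>x. Re (f x)) \<in> borel_measurable lebesgue" "(\<lambda>x. Im (f x)) \<in> borel_measurable lebesgue"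
    by measurable
  then obtain u v where uv: "u \<in> borel_measurable lborel" "AE x in lborel. Re (f x) = u x"
      "v \<in> borel_measurable lborel" "AE x in lborel. Im (f x) = v x"
    using completion_ex_borel_measurable_real by metis
  have "(\<lambda>x. Complex (u x) (v x)) = (\<lambda>x. of_real (u x) + \<i> * of_real (v x))"
    by (simp add: complex_eq_iff fun_eq_iff)
  moreover have "(\<lambda>x. of_real (u x) + \<i> * of_real (v x)) \<in> borel_measurable borel"
    using uv by simp
  moreover have "AE x in lborel. f x = Complex (u x) (v x)"
    using uv(2,4) by eventually_elim (simp add: complex_eq_iff)
  ultimately show ?thesis using that by metis
qed

lemma borel_measurable_lebesgue_if_AE_eq:
  fixes f f' :: "'a::euclidean_space \<Rightarrow> complex"
  assumes "f' \<in> borel_measurable borel" "AE x in lborel. f x = f' x"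
  shows "f \<in> borel_measurable lebesgue"
proof (rule borel_measurable_AE)
  show "f' \<in> borel_measurable lebesgue" using assms(1) by (simp add: measurable_completion)
  have "AE x in lborel. f' x = f x" using assms(2) by eventually_elim simp
  then show "AE x in lebesgue. f' x = f x" by (rule AE_completion)
qed

lemma pairing_AE_eq:
  assumes f: "AE x in lborel. f x = f' x" and h: "AE x in lborel. h x = h' x"
    and [measurable]: "f' \<in> borel_measurable borel" "h' \<in> borel_measurable borel"
  shows "pairing f h = (LINT x|lborel. f' x * cnj (h' x))"
proof -
  have ae: "AE x in lborel. f x * cnj (h x) = f' x * cnj (h' x)"
    using f h by eventually_elim simp
  have m: "(\<lambda>x. f' x * cnj (h' x)) \<in> borel_measurable borel" by measurable
  have "pairing f h = (LINT x|lebesgue. f' x * cnj (h' x))"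
    unfolding pairing_def
  proof (rule integral_cong_AE)
    show "(\<lambda>x. f x * cnj (h x)) \<in> borel_measurable lebesgue"
      by (rule borel_measurable_lebesgue_if_AE_eq[OF m ae])
    show "(\<lambda>x. f' x * cnj (h' x)) \<in> borel_measurable lebesgue"
      using m by (simp add: measurable_completion)
    show "AE x in lebesgue. f x * cnj (h x) = f' x * cnj (h' x)"
      using ae by (rule AE_completion)
  qed
  also have "\<dots> = (LINT x|lborel. f' x * cnj (h' x))"
    by (rule integral_completion) measurable
  finally show ?thesis .
qed

lemma exp_eq_cis: "exp (2 * of_real pi * \<i> * of_real r) = cis (2 * pi * r)"
  by (simp add: cis_conv_exp mult_ac)

text \<open>
  With a Borel representative \<open>g1\<close> the windowed Fourier transform of \<open>g\<close> with window \<open>g\<close> is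
  \<open>FT (\<lambda>x. g1 x * cnj (g1 (x - t))) \<omega>\<close> for every \<open>t\<close> and \<open>\<omega>\<close>, which makes it jointly measurable, so that
  Tonelli's theorem applies on the product space.
\<close>

theorem feichtinger_S0_continuous_representative:
  fixes g :: "real^'d \<Rightarrow> complex"
  assumes g: "g \<in> feichtinger_S0"
  obtains g' C where "wiener_majorant g' C" "AE x in lborel. g x = g' x"
proof -
  have "g \<in> borel_measurable lebesgue" using g by (simp add: feichtinger_S0_def Lp_space_def)
  then obtain g1 where g1[measurable]: "g1 \<in> borel_measurable borel" and ae: "AE x in lborel. g x = g1 x"
    by (rule lebesgue_measurable_ex_borel)
  have "Lp_norm 2 g < \<infinity>" using g by (simp add: feichtinger_S0_def Lp_space_def)
  then have "(\<integral>\<^sup>+x. ennreal ((norm (g x))\<^sup>2) \<partial>lborel) < \<infinity>"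
    by (simp add: Lp_norm_def nn_integral_completion less_top[symmetric])
  also have "(\<integral>\<^sup>+x. ennreal ((norm (g x))\<^sup>2) \<partial>lborel) = (\<integral>\<^sup>+x. ennreal ((norm (g1 x))\<^sup>2) \<partial>lborel)"
    by (intro nn_integral_cong_AE, use ae in eventually_elim) simp
  finally have L2: "(\<integral>\<^sup>+x. ennreal ((norm (g1 x))\<^sup>2) \<partial>lborel) < \<infinity>" .
  have V: "windowed_fourier g g (t, \<omega>) = FT (\<lambda>x. g1 x * cnj (g1 (x - t))) \<omega>" for t \<omega>
  proof -
    have "AE x in lborel. tf_shift t \<omega> g x = g1 (x - t) * cis (2 * pi * (x \<bullet> \<omega>))"
      using AE_lborel_translate[OF ae, of t] by eventually_elim (simp add: tf_shift_def exp_eq_cis)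
    then have "windowed_fourier g g (t, \<omega>) = (LINT x|lborel. g1 x * cnj (g1 (x - t) * cis (2 * pi * (x \<bullet> \<omega>))))"
      unfolding windowed_fourier_def by (simp add: pairing_AE_eq[OF ae])
    then show ?thesis by (simp add: FT_def cis_cnj mult.assoc)
  qed
  have "Lp_norm 1 (windowed_fourier g g) < \<infinity>" using g by (simp add: feichtinger_S0_def Lp_space_def)
  then have "(\<integral>\<^sup>+z. ennreal (norm (windowed_fourier g g z)) \<partial>lborel) < \<infinity>"
    by (simp add: Lp_norm_def nn_integral_completion less_top[symmetric])
  also have "(\<integral>\<^sup>+z. ennreal (norm (windowed_fourier g g z)) \<partial>lborel)
      = (\<integral>\<^sup>+z. ennreal (norm (FT (\<lambda>x. g1 x * cnj (g1 (x - fst z))) (snd z))) \<partial>(lborel \<Otimes>\<^sub>M lborel))"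
    unfolding lborel_prod by (intro nn_integral_cong) (metis V prod.collapse)
  also have "\<dots> = (\<integral>\<^sup>+t. (\<integral>\<^sup>+\<omega>. ennreal (norm (FT (\<lambda>x. g1 x * cnj (g1 (x - t))) \<omega>)) \<partial>lborel) \<partial>lborel)"
  proof -
    have "(\<lambda>z. ennreal (norm (FT (\<lambda>x. g1 x * cnj (g1 (x - fst z))) (snd z)))) \<in> borel_measurable (lborel \<Otimes>\<^sub>M lborel)"
      unfolding FT_def by measurable
    from lborel.nn_integral_fst[OF this] show ?thesis by simp
  qed
  finally obtain g' C where "wiener_majorant g' C" "AE x in lborel. g1 x = g' x"
    using S0_continuous_representative[OF g1 L2] by auto
  moreover from this(2) ae have "AE x in lborel. g x = g' x" by eventually_elim simp
  ultimately show ?thesis using that by blast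
qed

text \<open>
  At a given point only countably many values of the windows and of \<open>f\<close> enter, so for almost every
  point all of them agree with those of the representatives.
\<close>

lemma frame_op_AE_eq:
  fixes g \<gamma> f :: "real^'d \<Rightarrow> complex"
  assumes g: "AE x in lborel. g x = g' x" and \<gamma>: "AE x in lborel. \<gamma> x = \<gamma>' x" and f: "AE x in lborel. f x = f' x"
    and [measurable]: "g' \<in> borel_measurable borel" "\<gamma>' \<in> borel_measurable borel"
  shows "AE x in lborel. frame_op a b g \<gamma> f x = frame_op a b g' \<gamma>' f' x"
proof -
  have eq: "pairing \<gamma> g = pairing \<gamma>' g'"
    by (subst pairing_AE_eq[OF \<gamma> g]) (auto simp: pairing_eq_lborel)
  have "AE x in lborel. (\<forall>n k. g (x - zvec n /\<^sub>R b - a *\<^sub>R zvec k) = g' (x - zvec n /\<^sub>R b - a *\<^sub>R zvec k)) \<and>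
      (\<forall>k. \<gamma> (x - a *\<^sub>R zvec k) = \<gamma>' (x - a *\<^sub>R zvec k)) \<and> (\<forall>n. f (x - zvec n /\<^sub>R b) = f' (x - zvec n /\<^sub>R b))"
    unfolding AE_conj_iff AE_all_countable diff_diff_eq
    by (intro conjI allI AE_lborel_translate g \<gamma> f)
  then show ?thesis
    by eventually_elim (simp add: frame_op_def walnut_G_def eq)
qed

lemma frame_op_borel_measurable:
  fixes g \<gamma> f :: "real^'d \<Rightarrow> complex"
  assumes [measurable]: "g \<in> borel_measurable borel" "\<gamma> \<in> borel_measurable borel" "f \<in> borel_measurable borel"
  shows "frame_op a b g \<gamma> f \<in> borel_measurable borel"
proof -
  have [measurable]: "walnut_G a b g \<gamma> n \<in> borel_measurable borel" for n
    unfolding walnut_G_eq by (intro integral_countable_measurable) measurable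
  have "(\<lambda>x. LINT n|count_space UNIV. of_real (a ^ CARD('d)) * walnut_G a b g \<gamma> n x * f (x - zvec n /\<^sub>R b)) \<in> borel_measurable borel"
    by (intro integral_countable_measurable) measurable
  then show ?thesis
    unfolding frame_op_def infsum_eq_integral by measurable
qed

lemma lattice_filter_fst: "filterlim fst (at_right 0) lattice_filter"
  and lattice_filter_snd: "filterlim snd (at_right 0) lattice_filter"
proof -
  have ev: "eventually (\<lambda>z. z \<in> {0<..} \<times> {0<..}) lattice_filter"
    unfolding lattice_filter_def by (simp add: eventually_at_filter)
  have "(fst \<longlongrightarrow> fst (0, 0 :: real)) lattice_filter" "(snd \<longlongrightarrow> snd (0 :: real, 0)) lattice_filter"
    unfolding lattice_filter_def by (intro tendsto_intros)+
  then show "filterlim fst (at_right 0) lattice_filter" "filterlim snd (at_right 0) lattice_filter"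
    using ev by (auto simp: filterlim_at elim!: eventually_mono)
qed

lemma eventually_lattice_filter_small:
  "eventually (\<lambda>z. 0 < fst z \<and> fst z \<le> 1 \<and> 0 < snd z \<and> snd z \<le> 1) lattice_filter"
proof -
  have "eventually (\<lambda>x. 0 < x \<and> x \<le> (1 :: real)) (at_right 0)"
    unfolding eventually_at_right_field by (intro exI[of _ 1]) auto
  from filterlim_iff[THEN iffD1, OF lattice_filter_fst, rule_format, OF this]
    filterlim_iff[THEN iffD1, OF lattice_filter_snd, rule_format, OF this]
  show ?thesis by eventually_elim auto
qed

text \<open>
  The bound \<open>R\<close> of \<open>amalgam_frame_op_diff_le\<close> for the representatives depends on \<open>a\<close> and \<open>b\<close> through two
  separate summands, which tend to \<open>0\<close> with \<open>a\<close> and with \<open>b\<close> respectively.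
\<close>

theorem frame_op_W_tendsto:
  fixes g \<gamma> f :: "real^'d \<Rightarrow> complex"
  assumes S0: "g \<in> feichtinger_S0" "\<gamma> \<in> feichtinger_S0" and c0: "pairing \<gamma> g \<noteq> 0"
    and p: "1 \<le> p" "p < \<infinity>" and q: "1 \<le> q" and f: "f \<in> W_space p q"
  shows "W_tendsto p q (\<lambda>(a, b). frame_op a b g \<gamma> f) f lattice_filter"
proof -
  obtain g' C where g': "wiener_majorant g' C" and geq: "AE x in lborel. g x = g' x"
    by (rule feichtinger_S0_continuous_representative[OF S0(1)])
  obtain \<gamma>' C' where \<gamma>': "wiener_majorant \<gamma>' C'" and \<gamma>eq: "AE x in lborel. \<gamma> x = \<gamma>' x"
    by (rule feichtinger_S0_continuous_representative[OF S0(2)])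
  note [measurable] = wiener_majorantD(4)[OF g'] wiener_majorantD(4)[OF \<gamma>']
  have "f \<in> borel_measurable lebesgue" using f by (simp add: W_space_def)
  then obtain f' where f'[measurable]: "f' \<in> borel_measurable borel" and feq: "AE x in lborel. f x = f' x"
    by (rule lebesgue_measurable_ex_borel)
  have c0': "pairing \<gamma>' g' \<noteq> 0"
    using c0 by (subst (asm) pairing_AE_eq[OF \<gamma>eq geq]) (auto simp: pairing_eq_lborel)
  define r where "r = enn2real p"
  have r: "1 \<le> r" unfolding r_def using p by (intro enn2real_ge_1) auto
  let ?N = "\<lambda>u :: real^'d \<Rightarrow> complex. amalgam r q (\<lambda>x. ennreal (norm (u x)))"
  have W: "W_norm p q u = ?N u" for u
    unfolding r_def by (rule W_norm_eq_amalgam[OF p])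
  have Nle: "?N u \<le> ?N v" if "AE x in lborel. u x = v x" for u v
    using that by (intro amalgam_mono_AE r q) (auto elim!: eventually_mono)
  have Nf: "?N f' < \<infinity>"
  proof -
    have "?N f' \<le> ?N f" by (rule Nle) (use feq in \<open>auto elim!: eventually_mono\<close>)
    also have "\<dots> < \<infinity>" using f by (simp add: W_space_def W)
    finally show ?thesis .
  qed
  define R where "R = (\<lambda>z. ennreal (1 / norm (pairing \<gamma>' g')) * (total_osc (window_product g' \<gamma>' 0) (fst z) +
        of_nat (card (icube 1 :: (int^'d) set)) * total_far_tail C C' (snd z)) * ?N f')"
  have R0: "(R \<longlongrightarrow> 0) lattice_filter"
  proof -
    have cont: "continuous_on UNIV (window_product g' \<gamma>' 0)"
      using wiener_majorantD(1)[OF g'] wiener_majorantD(1)[OF \<gamma>'] by (auto intro!: continuous_intros)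
    have fin: "(\<integral>\<^sup>+y. C (ifloor (y - 0)) * C' (ifloor y) \<partial>lborel) < \<infinity>"
      using overlap_finite[OF wiener_majorantD(2)[OF g'] wiener_majorantD(2)[OF \<gamma>'], of 0] unfolding overlap_def .
    have "(total_osc (window_product g' \<gamma>' 0) \<longlongrightarrow> 0) (at_right 0)"
      by (rule total_osc_tendsto_0[OF cont majorized_window_product[OF g' \<gamma>', of 0] _ fin]) measurable
    then have 1: "((\<lambda>z. total_osc (window_product g' \<gamma>' 0) (fst z)) \<longlongrightarrow> 0) lattice_filter"
      by (rule filterlim_compose[OF _ lattice_filter_fst])
    have 2: "((\<lambda>z. total_far_tail C C' (snd z)) \<longlongrightarrow> 0) lattice_filter"
      by (rule filterlim_compose[OF total_far_tail_tendsto_0[OF wiener_majorantD(2)[OF g'] wiener_majorantD(2)[OF \<gamma>']] lattice_filter_snd])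
    have "((\<lambda>z. (?N f' * ennreal (1 / norm (pairing \<gamma>' g'))) * (total_osc (window_product g' \<gamma>' 0) (fst z) +
        of_nat (card (icube 1 :: (int^'d) set)) * total_far_tail C C' (snd z))) \<longlongrightarrow>
        (?N f' * ennreal (1 / norm (pairing \<gamma>' g'))) * (0 + of_nat (card (icube 1 :: (int^'d) set)) * 0)) lattice_filter"
      using Nf by (intro ennreal_tendsto_cmult tendsto_add 1 2)
        (auto simp: ennreal_mult_less_top ennreal_of_nat_eq_real_of_nat)
    then show ?thesis unfolding R_def by (simp add: mult_ac)
  qed
  have le: "?N (\<lambda>x. frame_op a b g \<gamma> f x - f x) \<le> R (a, b)"
    if ab: "0 < a" "a \<le> 1" "0 < b" "b \<le> 1" for a b
  proof -
    have "?N (\<lambda>x. frame_op a b g \<gamma> f x - f x) \<le> ?N (\<lambda>x. frame_op a b g' \<gamma>' f' x - f' x)"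
      using frame_op_AE_eq[OF geq \<gamma>eq feq, of a b] feq by (intro Nle) (auto elim: eventually_elim2)
    also have "\<dots> \<le> R (a, b)"
      unfolding R_def fst_conv snd_conv by (intro amalgam_frame_op_diff_le g' \<gamma>' ab c0' r q) simp
    finally show ?thesis .
  qed
  have meas: "frame_op a b g \<gamma> f \<in> borel_measurable lebesgue" for a b
    by (rule borel_measurable_lebesgue_if_AE_eq[OF frame_op_borel_measurable frame_op_AE_eq[OF geq \<gamma>eq feq]]) measurable
  have lim: "((\<lambda>z. W_norm p q (\<lambda>x. (case z of (a, b) \<Rightarrow> frame_op a b g \<gamma> f) x - f x)) \<longlongrightarrow> 0) lattice_filter"
  proof (rule ennreal_tendsto_0_le[OF _ R0])
    show "\<forall>\<^sub>F z in lattice_filter. W_norm p q (\<lambda>x. (case z of (a, b) \<Rightarrow> frame_op a b g \<gamma> f) x - f x) \<le> R z"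
      using eventually_lattice_filter_small by eventually_elim (auto simp: W le split: prod.split)
  qed
  have "eventually (\<lambda>z. R z < 1) lattice_filter"
    using R0 by (auto simp: order_tendsto_iff)
  with eventually_lattice_filter_small
  have "\<forall>\<^sub>F z in lattice_filter. (case z of (a, b) \<Rightarrow> frame_op a b g \<gamma> f) \<in> W_space p q"
  proof eventually_elim
    case (elim z)
    obtain a b where z: "z = (a, b)" by (cases z)
    have "?N (frame_op a b g \<gamma> f) \<le> ?N (frame_op a b g' \<gamma>' f')"
      by (rule Nle) (rule frame_op_AE_eq[OF geq \<gamma>eq feq]; measurable)
    also have "\<dots> \<le> amalgam r q (\<lambda>x. ennreal (norm (frame_op a b g' \<gamma>' f' x - f' x)) + ennreal (norm (f' x)))"
    proof (intro amalgam_mono_AE r q AE_I2)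
      fix x
      show "ennreal (norm (frame_op a b g' \<gamma>' f' x)) \<le> ennreal (norm (frame_op a b g' \<gamma>' f' x - f' x)) + ennreal (norm (f' x))"
        using norm_triangle_ineq[of "frame_op a b g' \<gamma>' f' x - f' x" "f' x"] by (simp flip: ennreal_plus)
    qed
    also have "\<dots> \<le> ?N (\<lambda>x. frame_op a b g' \<gamma>' f' x - f' x) + ?N f'"
      using frame_op_borel_measurable[of g' \<gamma>' f' a b] by (intro amalgam_add_le r q) auto
    also have "\<dots> \<le> R (a, b) + ?N f'"
      unfolding R_def fst_conv snd_conv using elim z
      by (intro add_right_mono amalgam_frame_op_diff_le g' \<gamma>' c0' r q) auto
    also have "\<dots> < \<infinity>"
      using elim(2) Nf z by (auto simp: less_top[symmetric])
    finally show ?case by (simp add: z W_space_def W meas)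
  qed
  with lim f show ?thesis unfolding W_tendsto_def by blast
qed

section \<open>Inner products and the equivalence\<close>

lemma tendsto_0_if_ennreal_norm:
  fixes F :: "'b \<Rightarrow> complex"
  assumes "((\<lambda>z. ennreal (norm (F z))) \<longlongrightarrow> 0) A"
  shows "(F \<longlongrightarrow> 0) A"
proof -
  have "((\<lambda>z. ennreal (norm (F z))) \<longlongrightarrow> ennreal 0) A" using assms by simp
  then have "((\<lambda>z. norm (F z)) \<longlongrightarrow> 0) A" by (subst (asm) tendsto_ennreal_iff) auto
  then show ?thesis by (rule tendsto_norm_zero_cancel)
qed

text \<open>
  The quantitative Riemann-Lebesgue lemma: translation by \<open>u = \<omega> / (2 |\<omega>|\<^sup>2)\<close> is half a period of the
  character and changes its sign, so twice the integral is the integral of \<open>h x - h (x - u)\<close> against it.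
\<close>

lemma half_period_shift_le:
  fixes h :: "'a::euclidean_space \<Rightarrow> complex"
  assumes h: "integrable lborel h" and \<omega>: "\<omega> \<noteq> 0"
  shows "ennreal (norm (LINT x|lborel. h x * cis (2 * pi * (\<omega> \<bullet> x)))) \<le> shift_dist h (\<omega> /\<^sub>R (2 * (norm \<omega>)\<^sup>2))"
proof -
  have [measurable]: "h \<in> borel_measurable borel" using h by auto
  define u where "u = \<omega> /\<^sub>R (2 * (norm \<omega>)\<^sup>2)"
  let ?I = "LINT x|lborel. h x * cis (2 * pi * (\<omega> \<bullet> x))"
  have "\<omega> \<bullet> u = 1 / 2" using \<omega> by (simp add: u_def dot_square_norm)
  then have cis: "cis (2 * pi * (\<omega> \<bullet> (x - u))) = - cis (2 * pi * (\<omega> \<bullet> x))" for x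
  proof -
    have "2 * pi * (\<omega> \<bullet> (x - u)) = 2 * pi * (\<omega> \<bullet> x) - pi"
      using \<open>\<omega> \<bullet> u = 1 / 2\<close> by (simp add: inner_diff_right right_diff_distrib)
    then show ?thesis by (simp add: cis_divide[symmetric])
  qed
  have int: "integrable lborel (\<lambda>x. k x * cis (2 * pi * (\<omega> \<bullet> x)))" if "integrable lborel k" for k :: "'a \<Rightarrow> complex"
    using that by (rule Bochner_Integration.integrable_bound) (use that in \<open>auto simp: norm_mult\<close>)
  have hu: "integrable lborel (\<lambda>x. h (x - u))"
    using integrable_lborel_affine[OF h, of 1 "-u"] by simp
  have "?I = (LINT x|lborel. h (x - u) * cis (2 * pi * (\<omega> \<bullet> (x - u))))"
    using lborel_integral_affine[of "\<lambda>x. h x * cis (2 * pi * (\<omega> \<bullet> x))" 1 "-u"] by simp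
  also have "\<dots> = - (LINT x|lborel. h (x - u) * cis (2 * pi * (\<omega> \<bullet> x)))"
    unfolding cis by simp
  finally have I: "?I = - (LINT x|lborel. h (x - u) * cis (2 * pi * (\<omega> \<bullet> x)))" .
  have "2 * ?I = ?I - (LINT x|lborel. h (x - u) * cis (2 * pi * (\<omega> \<bullet> x)))"
    using I by simp
  also have "\<dots> = (LINT x|lborel. h x * cis (2 * pi * (\<omega> \<bullet> x)) - h (x - u) * cis (2 * pi * (\<omega> \<bullet> x)))"
    by (rule Bochner_Integration.integral_diff[symmetric]) (intro int h hu)+
  finally have I2: "2 * ?I = (LINT x|lborel. h x * cis (2 * pi * (\<omega> \<bullet> x)) - h (x - u) * cis (2 * pi * (\<omega> \<bullet> x)))" .
  have "ennreal (norm (2 * ?I)) \<le> (\<integral>\<^sup>+x. ennreal (norm (h x * cis (2 * pi * (\<omega> \<bullet> x)) - h (x - u) * cis (2 * pi * (\<omega> \<bullet> x)))) \<partial>lborel)"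
    unfolding I2 by (rule norm_integral_le_nn_integral)
  also have "\<dots> = shift_dist h u"
    unfolding shift_dist_def left_diff_distrib[symmetric] by (simp add: norm_mult norm_minus_commute)
  finally have "ennreal (norm (2 * ?I)) \<le> shift_dist h u" .
  moreover have "ennreal (norm ?I) \<le> ennreal (norm (2 * ?I))" by (intro ennreal_leI) (simp add: norm_mult)
  ultimately show ?thesis unfolding u_def by (rule order_trans[rotated])
qed

text \<open>
  For \<open>n \<noteq> 0\<close> the inner product is at most one of the overlaps, uniformly in the modulation. For
  \<open>n = 0\<close> it is the transform of the integrable function \<open>cnj g * \<gamma>\<close> at the frequency \<open>l / a\<close>, whose
  half-period shift is proportional to \<open>a\<close>.
\<close>

theorem biorthogonality_limit:
  fixes g \<gamma> :: "real^'d \<Rightarrow> complex"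
  assumes S0: "g \<in> feichtinger_S0" "\<gamma> \<in> feichtinger_S0" and c0: "pairing \<gamma> g \<noteq> 0"
  shows "((\<lambda>(a, b). 1 / pairing \<gamma> g * pairing \<gamma> (modul (zvec l /\<^sub>R a) (transl (zvec n /\<^sub>R b) g)))
          \<longlongrightarrow> of_bool (l = 0) * of_bool (n = 0)) lattice_filter"
proof -
  obtain g' C where g': "wiener_majorant g' C" and geq: "AE x in lborel. g x = g' x"
    by (rule feichtinger_S0_continuous_representative[OF S0(1)])
  obtain \<gamma>' C' where \<gamma>': "wiener_majorant \<gamma>' C'" and \<gamma>eq: "AE x in lborel. \<gamma> x = \<gamma>' x"
    by (rule feichtinger_S0_continuous_representative[OF S0(2)])
  note [measurable] = wiener_majorantD(4)[OF g'] wiener_majorantD(4)[OF \<gamma>']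
  define P where "P = (\<lambda>z. pairing \<gamma> (modul (zvec l /\<^sub>R fst z) (transl (zvec n /\<^sub>R snd z) g)))"
  have P: "P z = (LINT x|lborel. window_product g' \<gamma>' (zvec n /\<^sub>R snd z) x * cis (2 * pi * ((- zvec l /\<^sub>R fst z) \<bullet> x)))" for z
  proof -
    have "AE x in lborel. modul (zvec l /\<^sub>R fst z) (transl (zvec n /\<^sub>R snd z) g) x
        = cis (2 * pi * ((zvec l /\<^sub>R fst z) \<bullet> x)) * g' (x - zvec n /\<^sub>R snd z)"
      using AE_lborel_translate[OF geq, of "zvec n /\<^sub>R snd z"] unfolding modul_def transl_def exp_eq_cis
      by eventually_elim simp
    then have "P z = (LINT x|lborel. \<gamma>' x * cnj (cis (2 * pi * ((zvec l /\<^sub>R fst z) \<bullet> x)) * g' (x - zvec n /\<^sub>R snd z)))"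
      unfolding P_def by (rule pairing_AE_eq[OF \<gamma>eq]) measurable
    then show ?thesis by (simp add: cis_cnj mult_ac)
  qed
  have "((\<lambda>z. 1 / pairing \<gamma> g * P z) \<longlongrightarrow> of_bool (l = 0) * of_bool (n = 0)) lattice_filter"
  proof (cases "l = 0 \<and> n = 0")
    case True
    then have "P = (\<lambda>_. pairing \<gamma> g)"
      by (simp add: P_def modul_def transl_def)
    then show ?thesis using True c0 by simp
  next
    case False
    have "(P \<longlongrightarrow> 0) lattice_filter"
    proof (cases "n = 0")
      case n0: False
      show ?thesis
      proof (rule tendsto_0_if_ennreal_norm, rule ennreal_tendsto_0_le)
        show "((\<lambda>z. total_far_tail C C' (snd z)) \<longlongrightarrow> 0) lattice_filter"
          by (rule filterlim_compose[OF total_far_tail_tendsto_0[OF wiener_majorantD(2)[OF g'] wiener_majorantD(2)[OF \<gamma>']] lattice_filter_snd])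
        show "\<forall>\<^sub>F z in lattice_filter. ennreal (norm (P z)) \<le> total_far_tail C C' (snd z)"
          using eventually_lattice_filter_small
        proof eventually_elim
          case (elim z)
          let ?t = "\<lambda>n. zvec n /\<^sub>R snd z"
          have "ennreal (norm (P z)) \<le> (\<integral>\<^sup>+x. ennreal (norm (window_product g' \<gamma>' (?t n) x * cis (2 * pi * ((- zvec l /\<^sub>R fst z) \<bullet> x)))) \<partial>lborel)"
            unfolding P by (rule norm_integral_le_nn_integral)
          also have "\<dots> = (\<integral>\<^sup>+x. ennreal (norm (window_product g' \<gamma>' (?t n) x)) \<partial>lborel)"
            by (simp add: norm_mult)
          also have "\<dots> \<le> overlap C C' (?t n)"
            unfolding overlap_def
            by (intro nn_integral_mono majorized_window_product[OF g' \<gamma>', unfolded majorized_def, rule_format]) simp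
          also have "\<dots> = indicator (- {0}) n * overlap C C' (?t n)" using n0 by simp
          also have "\<dots> \<le> (\<integral>\<^sup>+n. indicator (- {0}) n * overlap C C' (?t n) \<partial>count_space UNIV)"
            by (rule nn_integral_ge_point) simp
          also have "\<dots> \<le> total_far_tail C C' (snd z)" using elim by (intro sum_overlap_le) auto
          finally show ?case .
        qed
      qed
    next
      case True
      with False have l: "(zvec l :: real^'d) \<noteq> 0" by (auto simp: zvec_def vec_eq_iff)
      define h where "h = window_product g' \<gamma>' 0"
      have [measurable]: "h \<in> borel_measurable borel" unfolding h_def by measurable
      have "integrable lborel h"
      proof (rule integrableI_bounded)
        have "(\<integral>\<^sup>+x. ennreal (norm (h x)) \<partial>lborel) \<le> overlap C C' 0"
          unfolding overlap_def h_def
          by (intro nn_integral_mono majorized_window_product[OF g' \<gamma>', unfolded majorized_def, rule_format]) simp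
        also have "\<dots> < \<infinity>" by (rule overlap_finite[OF wiener_majorantD(2)[OF g'] wiener_majorantD(2)[OF \<gamma>']])
        finally show "(\<integral>\<^sup>+x. ennreal (norm (h x)) \<partial>lborel) < \<infinity>" .
      qed simp
      let ?u = "\<lambda>z::real \<times> real. fst z *\<^sub>R (- zvec l /\<^sub>R (2 * (norm (zvec l :: real^'d))\<^sup>2))"
      have "(fst \<longlongrightarrow> (0 :: real)) lattice_filter"
        using lattice_filter_fst by (simp add: filterlim_at)
      then have "(?u \<longlongrightarrow> 0 *\<^sub>R (- zvec l /\<^sub>R (2 * (norm (zvec l :: real^'d))\<^sup>2))) lattice_filter"
        by (intro tendsto_scaleR tendsto_const)
      then have u: "(?u \<longlongrightarrow> 0) lattice_filter" by simp
      show ?thesis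
      proof (rule tendsto_0_if_ennreal_norm, rule ennreal_tendsto_0_le)
        show "((\<lambda>z. shift_dist h (?u z)) \<longlongrightarrow> 0) lattice_filter"
          by (rule filterlim_compose[OF shift_dist_tendsto_nhds[OF \<open>integrable lborel h\<close>] u])
        show "\<forall>\<^sub>F z in lattice_filter. ennreal (norm (P z)) \<le> shift_dist h (?u z)"
          using eventually_lattice_filter_small
        proof eventually_elim
          case (elim z)
          define \<omega> where "\<omega> = - zvec l /\<^sub>R fst z"
          have "\<omega> \<noteq> 0" using elim l by (simp add: \<omega>_def)
          from half_period_shift_le[OF \<open>integrable lborel h\<close> this]
          have "ennreal (norm (P z)) \<le> shift_dist h (\<omega> /\<^sub>R (2 * (norm \<omega>)\<^sup>2))"
            unfolding P True h_def \<omega>_def by simp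
          also have "\<omega> /\<^sub>R (2 * (norm \<omega>)\<^sup>2) = ?u z"
            using elim l by (simp add: \<omega>_def power2_eq_square field_simps)
          finally show ?case .
        qed
      qed
    qed
    then have "((\<lambda>z. 1 / pairing \<gamma> g * P z) \<longlongrightarrow> 1 / pairing \<gamma> g * 0) lattice_filter"
      by (intro tendsto_mult tendsto_const)
    moreover have "of_bool (l = 0) * of_bool (n = 0) = (0 :: complex)" using False by auto
    ultimately show ?thesis by simp
  qed
  then show ?thesis unfolding P_def by (simp add: case_prod_beta')
qed

lemma pairing_commute: "pairing f h = cnj (pairing h f)"
  unfolding pairing_def by (subst Bochner_Integration.integral_cnj[symmetric]) (simp add: mult.commute)

theorem theorem5p3:
  fixes g \<gamma> :: "real^'d \<Rightarrow> complex" and p q :: ennreal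
  assumes "g \<in> feichtinger_S0" and "\<gamma> \<in> feichtinger_S0"
    and "pairing \<gamma> g \<noteq> 0"
    and "1 \<le> p" and "p < \<infinity>" and "1 \<le> q"
  shows
    "(\<forall>f \<in> W_space p q.
        W_tendsto p q (\<lambda>(a, b). frame_op a b g \<gamma> f) f lattice_filter \<and>
        W_tendsto p q (\<lambda>(a, b). frame_op a b \<gamma> g f) f lattice_filter)
     \<longleftrightarrow>
     (\<forall>l n :: int^'d.
        ((\<lambda>(a, b). 1 / pairing \<gamma> g *
            pairing \<gamma> (modul (zvec l /\<^sub>R a) (transl (zvec n /\<^sub>R b) g)))
          \<longlongrightarrow> of_bool (l = 0) * of_bool (n = 0)) lattice_filter)"
proof -
  have "pairing g \<gamma> \<noteq> 0" using assms(3) by (subst pairing_commute) simp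
  then show ?thesis
    using assms frame_op_W_tendsto biorthogonality_limit by blast
qed

end
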